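(* Let $V$ be a framed vertex operator algebra with Ising frame $F=\mathrm{Vir}(e^1)\otimes\cdots\otimes\mathrm{Vir}(e^n)$ and let $V^0$ be the subalgebra of $V$ defined below. For every $\theta\in\mathrm{Stab}^{\mathrm{pt}}_V(F)$ there exist $\xi,\eta\in\mathbb{Z}_2^n$ such that $\theta|_{V^0}=\sigma_\xi$ and $\theta^2=\tau_\eta$. In particular $\theta^4=1$.
   Context: An Ising vector of a VOA $V$ is $e\in V_2$ with $e_{(1)}e=2e$, $e_{(3)}e=\tfrac14\mathbf 1$ generating a subalgebra $\mathrm{Vir}(e)\cong L(\tfrac12,0)$. A simple VOA $(V,\omega)$ is framed if $\omega=e^1+\cdots+e^n$ with Ising vectors $e^i$ satisfying $[Y(e^i,z_1),Y(e^j,z_2)]=0$ for $i\ne j$; $F\cong L(\tfrac12,0)^{\otimes n}$ is the frame. For an Ising vector $e$, let $V_e(h)$ be the sum of irreducible $\mathrm{Vir}(e)$-submodules isomorphic to $L(\tfrac12,h)$, $h\in\{0,\tfrac12,\tfrac1{16}\}$. The Miyamoto involution $\tau_e\in\mathrm{Aut}(V)$ acts as $1$ on $V_e(0)\oplus V_e(\tfrac12)$ and $-1$ on $V_e(\tfrac1{16})$; on the fixed point subalgebra $V^{\langle\tau_e\rangle}$ the automorphism $\sigma_e$ acts as $1$ on $V_e(0)$ and $-1$ on $V_e(\tfrac12)$. Here $V^0$ denotes the sum of all irreducible $F$-submodules $L(\tfrac12,h_1)\otimes\cdots\otimes L(\tfrac12,h_n)$ of $V$ with all $h_i\in\{0,\tfrac12\}$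 (it is the fixed point subalgebra of all $\tau_{e^i}$). For $\beta\in\mathbb{Z}_2^n$, $\sigma_\beta=\prod_{i\in\mathrm{supp}(\beta)}\sigma_{e^i}\in\mathrm{Aut}(V^0)$ and $\tau_\beta=\prod_{i\in\mathrm{supp}(\beta)}\tau_{e^i}\in\mathrm{Aut}(V)$. $\mathrm{Stab}^{\mathrm{pt}}_V(F)$ is the group of automorphisms of $V$ fixing $F$ pointwise. *)

theory Defs
  imports Complex_Main
begin

text \<open>The data of a VOA on a carrier type 'v: scalar multiplication, the vertex
 operator in modes (vop u n v = u_(n) v, i.e. Y(u,z) = sum_n u_(n) z^(-n-1)),
 the vacuum vector and the conformal vector.\<close>

record 'v voa =
  smul :: "complex \<Rightarrow> 'v \<Rightarrow> 'v"
  vop  :: "'v \<Rightarrow> int \<Rightarrow> 'v \<Rightarrow> 'v"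
  vac  :: "'v"
  cvec :: "'v"

definition fsum :: "(nat \<Rightarrow> 'v::ab_group_add) \<Rightarrow> 'v" where
  "fsum f = sum f {i. f i \<noteq> 0}"

definition vspan :: "('v::ab_group_add, 'm) voa_scheme \<Rightarrow> 'v set \<Rightarrow> 'v set" where
  "vspan V S = module.span (smul V) S"

definition vsubspace :: "('v::ab_group_add, 'm) voa_scheme \<Rightarrow> 'v set \<Rightarrow> bool" where
  "vsubspace V S = module.subspace (smul V) S"

text \<open>Homogeneous subspace V_k: the eigenspace of L(0) = omega_(1) with eigenvalue k.\<close>
definition grade :: "('v::ab_group_add, 'm) voa_scheme \<Rightarrow> int \<Rightarrow> 'v set" where
  "grade V k = {v. vop V (cvec V) 1 v = smul V (of_int k) v}"

definition borcherds :: "('v::ab_group_add, 'm) voa_scheme \<Rightarrow> bool" where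
  "borcherds V \<longleftrightarrow> (\<forall>u v w (p::int) (q::int) (r::int).
     fsum (\<lambda>i. smul V ((of_int p :: complex) gchoose i)
                 (vop V (vop V u (r + int i) v) (p + q - int i) w))
   = fsum (\<lambda>i. smul V ((-1) ^ i * ((of_int r :: complex) gchoose i))
                 (vop V u (p + r - int i) (vop V v (q + int i) w)
                  - smul V ((-1) powi r) (vop V v (q + r - int i) (vop V u (p + int i) w)))))"

text \<open>Virasoro relations with central charge c for the modes L(m) = x_(m+1) of a vector x.\<close>
definition virasoro_rel :: "('v::ab_group_add, 'm) voa_scheme \<Rightarrow> 'v \<Rightarrow> complex \<Rightarrow> bool" where
  "virasoro_rel V x c \<longleftrightarrow> (\<forall>(m::int) (k::int) v.
     vop V x (m + 1) (vop V x (k + 1) v) - vop V x (k + 1) (vop V x (m + 1) v)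
   = smul V (of_int (m - k)) (vop V x (m + k + 1) v)
     + (if m + k = 0 then smul V ((of_int m ^ 3 - of_int m) / 12 * c) v else 0))"

definition is_VOA :: "('v::ab_group_add, 'm) voa_scheme \<Rightarrow> bool" where
  "is_VOA V \<longleftrightarrow>
     Vector_Spaces.vector_space (smul V) \<and>
     (\<forall>u n. Vector_Spaces.linear (smul V) (smul V) (vop V u n)) \<and>
     (\<forall>n v. Vector_Spaces.linear (smul V) (smul V) (\<lambda>u. vop V u n v)) \<and>
     (\<forall>u v. \<exists>N. \<forall>n\<ge>N. vop V u n v = 0) \<and>
     (\<forall>n v. vop V (vac V) n v = (if n = -1 then v else 0)) \<and>
     (\<forall>u. vop V u (-1) (vac V) = u \<and> (\<forall>n\<ge>0. vop V u n (vac V) = 0)) \<and>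
     borcherds V \<and>
     (\<exists>c. virasoro_rel V (cvec V) c) \<and>
     (\<forall>u n v. vop V (vop V (cvec V) 0 u) n v = smul V (- of_int n) (vop V u (n - 1) v)) \<and>
     (\<forall>v. v \<in> vspan V (\<Union>k. grade V k)) \<and>
     (\<forall>k. \<exists>B. finite B \<and> grade V k \<subseteq> vspan V B) \<and>
     (\<exists>N. \<forall>k<N. grade V k = {0})"

definition voa_ideal :: "('v::ab_group_add, 'm) voa_scheme \<Rightarrow> 'v set \<Rightarrow> bool" where
  "voa_ideal V I \<longleftrightarrow> vsubspace V I \<and>
     (\<forall>u v n. v \<in> I \<longrightarrow> vop V u n v \<in> I \<and> vop V v n u \<in> I)"

definition simple_VOA :: "('v::ab_group_add, 'm) voa_scheme \<Rightarrow> bool" where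
  "simple_VOA V \<longleftrightarrow> is_VOA V \<and> (\<forall>I. voa_ideal V I \<longrightarrow> I = {0} \<or> I = UNIV)"

definition gen_sub :: "('v::ab_group_add, 'm) voa_scheme \<Rightarrow> 'v set \<Rightarrow> 'v set" where
  "gen_sub V S = \<Inter>{W. vsubspace V W \<and> vac V \<in> W \<and> S \<subseteq> W \<and>
                        (\<forall>u\<in>W. \<forall>v\<in>W. \<forall>n. vop V u n v \<in> W)}"

definition submod :: "('v::ab_group_add, 'm) voa_scheme \<Rightarrow> 'v set \<Rightarrow> 'v set \<Rightarrow> bool" where
  "submod V U M \<longleftrightarrow> vsubspace V M \<and> (\<forall>u\<in>U. \<forall>w\<in>M. \<forall>n. vop V u n w \<in> M)"

definition irr_submod :: "('v::ab_group_add, 'm) voa_scheme \<Rightarrow> 'v set \<Rightarrow> 'v set \<Rightarrow> bool" where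
  "irr_submod V U M \<longleftrightarrow> submod V U M \<and> M \<noteq> {0} \<and>
     (\<forall>M'. submod V U M' \<and> M' \<subseteq> M \<longrightarrow> M' = {0} \<or> M' = M)"

definition Vir :: "('v::ab_group_add, 'm) voa_scheme \<Rightarrow> 'v \<Rightarrow> 'v set" where
  "Vir V e = gen_sub V {e}"

text \<open>Ising vector: e in V_2, e_(1)e = 2e, e_(3)e = 1/4 vac, and Vir(e) is isomorphic
 to L(1/2,0) with e corresponding to its conformal vector, i.e. the modes of e satisfy the
 Virasoro relations with c = 1/2 and Vir(e) is simple (irreducible over itself).\<close>
definition ising :: "('v::ab_group_add, 'm) voa_scheme \<Rightarrow> 'v \<Rightarrow> bool" where
  "ising V e \<longleftrightarrow> e \<in> grade V 2 \<and>
     vop V e 1 e = smul V 2 e \<and> vop V e 3 e = smul V (1/4) (vac V) \<and>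
     virasoro_rel V e (1/2) \<and> irr_submod V (Vir V e) (Vir V e)"

text \<open>An irreducible module M over the algebra generated by the commuting Ising vectors
 es i (i in I) is isomorphic to the tensor product of the L(1/2, hs i), i in I, iff it
 contains a nonzero joint highest weight vector of weights hs i.\<close>
definition hw_type :: "('v::ab_group_add, 'm) voa_scheme \<Rightarrow> nat set \<Rightarrow> (nat \<Rightarrow> 'v)
    \<Rightarrow> (nat \<Rightarrow> complex) \<Rightarrow> 'v set \<Rightarrow> bool" where
  "hw_type V I es hs M \<longleftrightarrow> (\<exists>w\<in>M. w \<noteq> 0 \<and> (\<forall>i\<in>I.
       vop V (es i) 1 w = smul V (hs i) w \<and> (\<forall>m>0. vop V (es i) (m + 1) w = 0)))"

definition Vh :: "('v::ab_group_add, 'm) voa_scheme \<Rightarrow> 'v \<Rightarrow> complex \<Rightarrow> 'v set" where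
  "Vh V e h = vspan V (\<Union>{M. irr_submod V (Vir V e) M \<and> hw_type V {0} (\<lambda>_. e) (\<lambda>_. h) M})"

text \<open>Miyamoto involutions tau_e (on V) and sigma_e (on the fixed points of tau_e).\<close>
definition tau :: "('v::ab_group_add, 'm) voa_scheme \<Rightarrow> 'v \<Rightarrow> 'v \<Rightarrow> 'v" where
  "tau V e v = (THE w. \<exists>a b d. a \<in> Vh V e 0 \<and> b \<in> Vh V e (1/2) \<and> d \<in> Vh V e (1/16) \<and>
                              v = a + b + d \<and> w = a + b - d)"

definition sigma :: "('v::ab_group_add, 'm) voa_scheme \<Rightarrow> 'v \<Rightarrow> 'v \<Rightarrow> 'v" where
  "sigma V e v = (THE w. \<exists>a b. a \<in> Vh V e 0 \<and> b \<in> Vh V e (1/2) \<and> v = a + b \<and> w = a - b)"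

text \<open>Products over beta in Z_2^n, represented as a subset of {0..<n}.\<close>
definition tau_prod :: "('v::ab_group_add, 'm) voa_scheme \<Rightarrow> (nat \<Rightarrow> 'v) \<Rightarrow> nat set \<Rightarrow> 'v \<Rightarrow> 'v" where
  "tau_prod V es \<beta> = foldr (\<lambda>i f. tau V (es i) \<circ> f) (sorted_list_of_set \<beta>) id"

definition sigma_prod :: "('v::ab_group_add, 'm) voa_scheme \<Rightarrow> (nat \<Rightarrow> 'v) \<Rightarrow> nat set \<Rightarrow> 'v \<Rightarrow> 'v" where
  "sigma_prod V es \<beta> = foldr (\<lambda>i f. sigma V (es i) \<circ> f) (sorted_list_of_set \<beta>) id"

definition framed :: "('v::ab_group_add, 'm) voa_scheme \<Rightarrow> nat \<Rightarrow> (nat \<Rightarrow> 'v) \<Rightarrow> bool" where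
  "framed V n es \<longleftrightarrow> simple_VOA V \<and> (\<forall>i<n. ising V (es i)) \<and>
     cvec V = (\<Sum>i<n. es i) \<and>
     (\<forall>i<n. \<forall>j<n. i \<noteq> j \<longrightarrow> (\<forall>m k v.
        vop V (es i) m (vop V (es j) k v) = vop V (es j) k (vop V (es i) m v)))"

definition frame :: "('v::ab_group_add, 'm) voa_scheme \<Rightarrow> nat \<Rightarrow> (nat \<Rightarrow> 'v) \<Rightarrow> 'v set" where
  "frame V n es = gen_sub V (es ` {..<n})"

definition V0 :: "('v::ab_group_add, 'm) voa_scheme \<Rightarrow> nat \<Rightarrow> (nat \<Rightarrow> 'v) \<Rightarrow> 'v set" where
  "V0 V n es = vspan V (\<Union>{M. irr_submod V (frame V n es) M \<and>
       (\<exists>hs. (\<forall>i<n. hs i \<in> {0, 1/2}) \<and> hw_type V {..<n} es hs M)})"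

definition voa_aut :: "('v::ab_group_add, 'm) voa_scheme \<Rightarrow> ('v \<Rightarrow> 'v) set" where
  "voa_aut V = {g. Vector_Spaces.linear (smul V) (smul V) g \<and> bij g \<and>
      g (vac V) = vac V \<and> g (cvec V) = cvec V \<and>
      (\<forall>u n v. g (vop V u n v) = vop V (g u) n (g v))}"

definition stab_pt :: "('v::ab_group_add, 'm) voa_scheme \<Rightarrow> 'v set \<Rightarrow> ('v \<Rightarrow> 'v) set" where
  "stab_pt V F = {g \<in> voa_aut V. \<forall>x\<in>F. g x = x}"

end

theory Submission
  imports Defs "HOL-Library.FuncSet" "HOL-Computational_Algebra.Fundamental_Theorem_Algebra"
begin

text \<open>
  For an Ising vector \<open>e\<close> the vector \<open>(64 L\<^sub>-\<^sub>2\<^sup>3 + 93 L\<^sub>-\<^sub>3\<^sup>2 - 264 L\<^sub>-\<^sub>4 L\<^sub>-\<^sub>2 - 108 L\<^sub>-\<^sub>6) 1\<close> is singular, hence zero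
  in the simple algebra \<open>Vir e\<close>. Its zero mode forces \<open>L\<^sub>0\<close> to satisfy \<open>x (16 x - 1) (2 x - 1) = 0\<close>
  on highest weight vectors, also modulo a submodule. As \<open>0\<close>, \<open>1/2\<close>, \<open>1/16\<close> are incongruent modulo
  the integers, complete reducibility follows, and the null vectors of weight one and two of the
  three irreducible modules give the fusion rules.

  Hence \<open>V\<close> is spanned by joint eigenvectors of the \<open>L\<^sub>0\<close>-operators of the frame, and their eigenvalues
  modulo the integers grade \<open>V\<close>: by \<open>{0, 1/2}\<close> against \<open>1/16\<close> at each site, and \<open>V0\<close> more finely by
  \<open>0\<close> against \<open>1/2\<close>. Let \<open>w\<close> be an eigenvector of an automorphism in a homogeneous component. By
  simplicity \<open>V\<close> is spanned by the products \<open>u\<^sub>k w\<close>, so the component of \<open>w\<close> is spanned by those with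
  \<open>u\<close> of degree zero. An automorphism that is trivial in degree zero is therefore scalar on each
  component, and since products in a simple algebra do not all vanish, the scalars form a character of
  a subgroup of \<open>\<int>\<^sub>2\<^sup>n\<close>, which extends to \<open>\<int>\<^sub>2\<^sup>n\<close>. In the fine grading the degree zero part is generated by the
  vacuum over the frame, so this applies to \<open>\<theta>\<close> and gives \<open>\<xi>\<close>; in the coarse grading it is \<open>V0\<close>, on
  which \<open>\<theta>\<^sup>2\<close> is trivial, so this applies to \<open>\<theta>\<^sup>2\<close> and gives \<open>\<eta>\<close>.
\<close>


section \<open>Eigenvectors\<close>

text \<open>Neither \<open>Y e 1\<close> nor an automorphism is known to be diagonalizable at the
  outset, and no invariant form is at hand. For \<open>Y e 1\<close> this is why the polynomial
  relation is derived modulo a submodule: its roots are simple, so a Jordan block is excluded by the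
  derivative of the polynomial. For an automorphism a single eigenvector per component suffices.
  Simplicity is given for V only, and the fine grading does not extend beyond V0: at a site, two
  weights 1/16 fuse to both 0 and 1/2. So even for V0 all of V acts on \<open>w\<close>, and the
  products that leave the component of \<open>w\<close> are split off; on the 1/16 sectors only
  \<theta>^2 is controlled. Weight six occurs because c = 1/2 belongs to the minimal model (3,4),
  whose vacuum has its null vector at level (3-1)(4-1). Isomorphism types of modules are replaced
  throughout by eigenvalues modulo the integers.\<close>

context vector_space
begin

lemma span_UN_sum:
  assumes sub: "\<And>a. a \<in> A \<Longrightarrow> subspace (J a)" and x: "x \<in> span (\<Union>a\<in>A. J a)"
  obtains M f where "finite M" "M \<subseteq> A" "\<And>a. a \<in> M \<Longrightarrow> f a \<in> J a" "x = sum f M"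
proof -
  have "\<exists>M f. finite M \<and> M \<subseteq> A \<and> (\<forall>a\<in>M. f a \<in> J a) \<and> x = sum f M"
    using x
  proof (induction rule: span_induct_alt)
    case base
    then show ?case by (intro exI[of _ "{}"]) auto
  next
    case (step c x y)
    then obtain M f a where M: "finite M" "M \<subseteq> A" "\<forall>a\<in>M. f a \<in> J a" "y = sum f M"
      and a: "a \<in> A" "x \<in> J a" by blast
    define f' where "f' b = (if b \<in> M then f b else 0)" for b
    define g where "g b = (if b = a then c *s x else 0) + f' b" for b
    have "sum g (insert a M) = c *s x + sum f' (insert a M)"
      using M(1) by (simp add: g_def sum.distrib)
    also have "sum f' (insert a M) = sum f M"
      using M(1) by (cases "a \<in> M") (auto simp: f'_def insert_absorb intro!: sum.cong)
    finally have "c *s x + y = sum g (insert a M)" by (simp add: M)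
    moreover have "\<forall>b\<in>insert a M. g b \<in> J b"
      using M a sub by (auto simp: g_def f'_def subspace_0 intro!: subspace_add subspace_scale)
    ultimately show ?case using M(1,2) a by (intro exI[of _ "insert a M"] exI[of _ g]) auto
  qed
  then show thesis using that by blast
qed

text \<open>The separating operator may depend on the pair of indices. Applying
  \<open>T i - ev b i\<close> to a relation removes the term at \<open>b\<close> and rescales the
  term at \<open>a\<close> by a nonzero number, so the relation gets shorter.\<close>

lemma joint_eigenvectors_independent:
  assumes lin: "\<And>i. i \<in> I \<Longrightarrow> Vector_Spaces.linear scale scale (T i)"
    and "finite M"
    and "\<And>a b. a \<in> M \<Longrightarrow> b \<in> M \<Longrightarrow> a \<noteq> b \<Longrightarrow> \<exists>i\<in>I. ev a i \<noteq> ev b i"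
    and "\<And>a i. a \<in> M \<Longrightarrow> i \<in> I \<Longrightarrow> T i (f a) = ev a i *s f a"
    and "sum f M = 0" and "a \<in> M"
  shows "f a = 0"
  using assms(2-)
proof (induction "card M" arbitrary: M f a rule: less_induct)
  case less
  show ?case
  proof (cases "M = {a}")
    case True
    then show ?thesis using less by simp
  next
    case False
    then obtain b where b: "b \<in> M" "b \<noteq> a" using less by blast
    then obtain i where i: "i \<in> I" "ev a i \<noteq> ev b i" using less.prems(2)[OF less.prems(5), of b] by auto
    interpret Ti: Vector_Spaces.linear scale scale "T i" using lin i by blast
    define g where "g c = (ev c i - ev b i) *s f c" for c
    have "0 = T i (sum f M) - ev b i *s sum f M"
      by (simp add: less.prems)
    also have "\<dots> = (\<Sum>c\<in>M. T i (f c) - ev b i *s f c)"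
      by (simp only: Ti.sum scale_sum_right sum_subtractf)
    also have "\<dots> = (\<Sum>c\<in>M. g c)"
      using less.prems(3) i by (intro sum.cong) (simp_all add: g_def scale_left_diff_distrib)
    also have "\<dots> = (\<Sum>c\<in>M - {b}. g c)"
      using b less.prems(1) by (subst sum.remove[of M b]) (simp_all add: g_def)
    finally have s: "(\<Sum>c\<in>M - {b}. g c) = 0" ..
    have "g a = 0"
    proof (rule less.hyps[of "M - {b}" g a])
      show "card (M - {b}) < card M" using b less.prems(1) by (intro psubset_card_mono) auto
      fix c j assume cj: "c \<in> M - {b}" "j \<in> I"
      interpret Tj: Vector_Spaces.linear scale scale "T j" using lin cj by blast
      show "T j (g c) = ev c j *s g c"
        using less.prems(3) cj by (simp add: g_def Tj.scale mult.commute)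
    next
      fix c d assume "c \<in> M - {b}" "d \<in> M - {b}" "c \<noteq> d"
      then show "\<exists>i\<in>I. ev c i \<noteq> ev d i" using less.prems(2) by simp
    qed (use less.prems(1,5) b s in auto)
    then show ?thesis using i by (simp add: g_def)
  qed
qed

text \<open>Serves both a single operator (\<open>I\<close> a singleton) and the family of all frame
  operators. Two representations of \<open>x\<close> over disjoint index sets combine to one
  relation with value 0.\<close>

lemma joint_eigenspans_disjoint:
  assumes lin: "\<And>i. i \<in> I \<Longrightarrow> Vector_Spaces.linear scale scale (T i)"
    and sep: "\<And>a b. a \<in> A \<union> B \<Longrightarrow> b \<in> A \<union> B \<Longrightarrow> a \<noteq> b \<Longrightarrow> \<exists>i\<in>I. ev a i \<noteq> ev b i"
    and AB: "A \<inter> B = {}"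
    and xA: "x \<in> span (\<Union>a\<in>A. {x. \<forall>i\<in>I. T i x = ev a i *s x})"
    and xB: "x \<in> span (\<Union>a\<in>B. {x. \<forall>i\<in>I. T i x = ev a i *s x})"
  shows "x = 0"
proof -
  let ?J = "\<lambda>a. {x. \<forall>i\<in>I. T i x = ev a i *s x}"
  have sub: "subspace (?J a)" for a
  proof -
    have "subspace (\<Inter>i\<in>I. {x. T i x - ev a i *s x = 0})"
    proof (intro subspace_Int)
      fix i assume "i \<in> I"
      then interpret Vector_Spaces.linear scale scale "T i" by (rule lin)
      show "subspace {x. T i x - ev a i *s x = 0}"
      proof (rule subspaceI)
        fix c x assume "x \<in> {x. T i x - ev a i *s x = 0}"
        then have "T i (c *s x) = c *s (ev a i *s x)" by (simp add: scale)
        then show "c *s x \<in> {x. T i x - ev a i *s x = 0}" by (simp add: mult.commute)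
      next
        fix x y assume "x \<in> {x. T i x - ev a i *s x = 0}" "y \<in> {x. T i x - ev a i *s x = 0}"
        then show "x + y \<in> {x. T i x - ev a i *s x = 0}" by (simp add: add scale_right_distrib)
      qed simp
    qed
    also have "(\<Inter>i\<in>I. {x. T i x - ev a i *s x = 0}) = ?J a" by auto
    finally show ?thesis .
  qed
  obtain M f where M: "finite M" "M \<subseteq> A" "\<And>a. a \<in> M \<Longrightarrow> f a \<in> ?J a" "x = sum f M"
    by (rule span_UN_sum[of A ?J x, OF sub xA]) (rule that)
  obtain N g where N: "finite N" "N \<subseteq> B" "\<And>a. a \<in> N \<Longrightarrow> g a \<in> ?J a" "x = sum g N"
    by (rule span_UN_sum[of B ?J x, OF sub xB]) (rule that)
  have disj: "M \<inter> N = {}" using M N AB by blast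
  define h where "h a = (if a \<in> M then f a else - g a)" for a
  have hM: "sum h M = sum f M" by (intro sum.cong) (auto simp: h_def)
  have hN: "sum h N = - sum g N"
    unfolding sum_negf[symmetric] using disj by (intro sum.cong) (auto simp: h_def)
  have "sum h (M \<union> N) = 0"
    using M N disj by (simp add: sum.union_disjoint hM hN)
  have "h a = 0" if "a \<in> M \<union> N" for a
  proof (rule joint_eigenvectors_independent[of I T "M \<union> N" ev h])
    fix b i assume b: "b \<in> M \<union> N" "i \<in> I"
    have "h b \<in> ?J b"
      using b M(3) N(3) subspace_neg[OF sub] by (auto simp: h_def)
    then show "T i (h b) = ev b i *s h b" using b by blast
  next
    fix a b assume "a \<in> M \<union> N" "b \<in> M \<union> N" "a \<noteq> b"
    then show "\<exists>i\<in>I. ev a i \<noteq> ev b i" using sep M(2) N(2) by blast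
  qed (use lin M N that \<open>sum h (M \<union> N) = 0\<close> in auto)
  then have "sum h M = 0" by (auto intro: sum.neutral)
  then show "x = 0" using M hM by simp
qed

end

text \<open>The ambient space may be infinite-dimensional, so the argument uses the polynomial of
  least degree annihilating one vector \<open>v\<close> of \<open>S\<close>: if \<open>l\<close> is
  a root and \<open>q\<close> the cofactor, then \<open>q\<close> evaluated at \<open>T\<close>
  sends \<open>v\<close> to an eigenvector.\<close>

lemma exists_eigenvector:
  fixes scale :: "complex \<Rightarrow> 'v::ab_group_add \<Rightarrow> 'v"
  assumes vs: "vector_space scale" and lin: "Vector_Spaces.linear scale scale T"
    and S: "module.subspace scale S" "S \<noteq> {0}" "S \<subseteq> module.span scale B" "finite B"
    and TS: "\<And>x. x \<in> S \<Longrightarrow> T x \<in> S"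
  obtains w l where "w \<in> S" "w \<noteq> 0" "T w = scale l w"
proof -
  interpret vector_space scale by fact
  interpret T: Vector_Spaces.linear scale scale T by fact
  define ev where "ev p x = (\<Sum>i\<le>degree p. scale (coeff p i) ((T ^^ i) x))" for p x
  have ev: "ev p x = (\<Sum>i\<le>n. scale (coeff p i) ((T ^^ i) x))" if "degree p \<le> n" for p x n
    unfolding ev_def using that
    by (intro sum.mono_neutral_left) (auto simp: coeff_eq_0)
  have evS: "ev p x \<in> S" if "x \<in> S" for p x
  proof -
    have "(T ^^ i) x \<in> S" for i by (induction i) (auto simp: that TS)
    then show ?thesis unfolding ev_def by (intro subspace_sum subspace_scale S)
  qed
  obtain v where v: "v \<in> S" "v \<noteq> 0" using S subspace_0[OF S(1)] by blast
  \<comment> \<open>Either two of the iterates coincide, which gives a difference of two monomials,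
    or they are \<open>card B + 1\<close> distinct vectors in the span of \<open>card B\<close>
    vectors.\<close>
  have "\<exists>p. p \<noteq> 0 \<and> ev p v = 0"
  proof (cases "inj_on (\<lambda>i. (T ^^ i) v) {..card B}")
    case False
    then obtain i j where ij: "i \<noteq> j" "(T ^^ i) v = (T ^^ j) v" by (auto simp: inj_on_def)
    define p where "p = monom (1::complex) i - monom 1 j"
    have "coeff p i = 1" using ij by (simp add: p_def)
    then have "p \<noteq> 0" by auto
    have "ev p v = (\<Sum>k\<le>max (degree p) (max i j). scale (coeff p k) ((T ^^ k) v))"
      by (rule ev) simp
    also have "\<dots> = (\<Sum>k\<le>max (degree p) (max i j). (if k = i then (T ^^ k) v else 0) - (if k = j then (T ^^ k) v else 0))"
      by (intro sum.cong) (auto simp: p_def)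
    also have "\<dots> = 0"
      unfolding sum_subtractf by (subst (1 2) sum.delta) (use ij in auto)
    finally show ?thesis using \<open>p \<noteq> 0\<close> by blast
  next
    case True
    let ?X = "(\<lambda>i. (T ^^ i) v) ` {..card B}"
    have "(T ^^ i) v \<in> S" for i by (induction i) (auto simp: v TS)
    then have "?X \<subseteq> span B" using S by blast
    moreover have "card ?X = Suc (card B)" using True by (simp add: card_image)
    ultimately have "dependent ?X"
      using independent_span_bound[OF S(4), of ?X] by auto
    then obtain u y where u: "y \<in> ?X" "u y \<noteq> 0" "(\<Sum>x\<in>?X. scale (u x) x) = 0"
      using dependent_finite[of ?X] by auto
    define p where "p = (\<Sum>i\<le>card B. monom (u ((T ^^ i) v)) i)"
    have cp: "coeff p i = (if i \<le> card B then u ((T ^^ i) v) else 0)" for i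
      by (simp add: p_def coeff_sum)
    have "degree p \<le> card B" by (rule degree_le) (simp add: cp)
    then have "ev p v = (\<Sum>i\<le>card B. scale (u ((T ^^ i) v)) ((T ^^ i) v))"
      by (subst ev[of p "card B"]) (auto simp: cp)
    also have "\<dots> = 0" using u(3) by (subst (asm) sum.reindex[OF True]) simp
    finally have "ev p v = 0" .
    moreover have "p \<noteq> 0" using u(1,2) cp by (metis (no_types, lifting) atMost_iff coeff_0 imageE)
    ultimately show ?thesis by blast
  qed
  define P where "P n \<longleftrightarrow> (\<exists>p. p \<noteq> 0 \<and> ev p v = 0 \<and> degree p = n)" for n
  have exP: "\<exists>n. P n" unfolding P_def using \<open>\<exists>p. p \<noteq> 0 \<and> ev p v = 0\<close> by blast
  obtain p where p: "p \<noteq> 0" "ev p v = 0" "degree p = Least P"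
    using LeastI_ex[OF exP] unfolding P_def[of "Least P"] by blast
  have "degree p \<noteq> 0"
  proof
    assume "degree p = 0"
    then have "ev p v = scale (coeff p 0) v" by (simp add: ev_def)
    then show False using p v \<open>degree p = 0\<close> by (metis leading_coeff_0_iff scale_eq_0_iff)
  qed
  then obtain l where "poly p l = 0"
    using fundamental_theorem_of_algebra constant_degree by metis
  then obtain q where q: "p = [:-l, 1:] * q" by (auto simp: poly_eq_0_iff_dvd)
  then have q0: "q \<noteq> 0" using p by auto
  then have dq: "degree p = Suc (degree q)" unfolding q by (subst degree_mult_eq) auto
  then have evq: "ev q v \<noteq> 0"
    using not_less_Least[of "degree q" P] p(3) q0 unfolding P_def[of "degree q"] by auto
  have "ev p v = (\<Sum>i\<le>Suc (degree q). scale (coeff p i) ((T ^^ i) v))"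
    by (rule ev) (simp add: dq)
  \<comment> \<open>The coefficients of \<open>[:-l, 1:] * q\<close> are split into those of
    \<open>- l\<close> times \<open>q\<close> and those of \<open>pCons 0 q\<close>; the shift of
    degree in the latter becomes one more application of \<open>T\<close>.\<close>
  also have "\<dots> = (\<Sum>i\<le>Suc (degree q). scale (- l * coeff q i) ((T ^^ i) v))
      + (\<Sum>i\<le>Suc (degree q). scale (coeff (pCons 0 q) i) ((T ^^ i) v))"
    unfolding sum.distrib[symmetric]
    by (intro sum.cong) (auto simp: q scale_left_diff_distrib)
  also have "(\<Sum>i\<le>Suc (degree q). scale (- l * coeff q i) ((T ^^ i) v)) = - scale l (ev q v)"
    by (simp add: ev_def coeff_eq_0 scale_sum_right sum_negf)
  also have "(\<Sum>i\<le>Suc (degree q). scale (coeff (pCons 0 q) i) ((T ^^ i) v)) = T (ev q v)"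
    by (subst sum.atMost_Suc_shift) (simp add: ev_def T.sum T.scale)
  finally have "T (ev q v) = scale l (ev q v)" using p by simp
  then show thesis using that evS v evq by blast
qed

section \<open>Consequences of the Borcherds identity\<close>

text \<open>\<open>fsum\<close> ranges over the support and takes the default value 0 if that is
  infinite, so truncation must be supplied before a sum is split.\<close>

lemma fsum_eq_sum:
  assumes "\<And>i. i \<ge> N \<Longrightarrow> f i = 0"
  shows "fsum f = (\<Sum>i<N. f i)"
  unfolding fsum_def using assms
  by (intro sum.mono_neutral_left) (auto simp: not_less[symmetric])

lemma fsum_eq_head:
  assumes "\<And>i. i > 0 \<Longrightarrow> f i = 0"
  shows "fsum f = f 0"
  using fsum_eq_sum[of 1 f] assms by simp

lemma fsum_split_head:
  assumes "\<And>i. i \<ge> N \<Longrightarrow> f i = 0"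
  shows "fsum f = f 0 + (\<Sum>i<N. f (Suc i))"
proof -
  have "fsum f = (\<Sum>i<Suc N. f i)" using assms by (intro fsum_eq_sum) simp
  then show ?thesis by (simp only: sum.lessThan_Suc_shift)
qed

locale VOA =
  fixes V :: "('v::ab_group_add) voa"
  assumes VOA: "is_VOA V"
begin

sublocale vector_space "smul V"
  using VOA unfolding is_VOA_def by (elim conjE)

lemmas VOA_conj = VOA[unfolded is_VOA_def borcherds_def vspan_def, THEN conjunct2]

abbreviation scl (infixr "\<cdot>" 75) where "c \<cdot> x \<equiv> smul V c x"
abbreviation Y where "Y \<equiv> vop V"
abbreviation vacuum ("\<Omega>") where "\<Omega> \<equiv> vac V"
abbreviation conformal ("\<omega>") where "\<omega> \<equiv> cvec V"

lemma linear_Y: "Vector_Spaces.linear (smul V) (smul V) (Y u n)"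
  using VOA_conj[THEN conjunct1] by blast

lemma linear_Y_left: "Vector_Spaces.linear (smul V) (smul V) (\<lambda>u. Y u n v)"
  using VOA_conj[THEN conjunct2, THEN conjunct1] by blast

lemma Y_right:
  "Y u n (x + y) = Y u n x + Y u n y" "Y u n (c \<cdot> x) = c \<cdot> Y u n x" "Y u n 0 = 0"
  "Y u n (x - y) = Y u n x - Y u n y" "Y u n (- x) = - Y u n x"
  "Y u n (sum f A) = (\<Sum>a\<in>A. Y u n (f a))"
proof -
  interpret l: Vector_Spaces.linear "smul V" "smul V" "Y u n" by (rule linear_Y)
  show "Y u n (x + y) = Y u n x + Y u n y" "Y u n (c \<cdot> x) = c \<cdot> Y u n x" "Y u n 0 = 0"
    "Y u n (x - y) = Y u n x - Y u n y" "Y u n (- x) = - Y u n x"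
    "Y u n (sum f A) = (\<Sum>a\<in>A. Y u n (f a))"
    by (simp_all add: l.add l.scale l.diff l.neg l.sum)
qed

lemma Y_left:
  "Y (x + y) n v = Y x n v + Y y n v" "Y (c \<cdot> x) n v = c \<cdot> Y x n v" "Y 0 n v = 0"
  "Y (x - y) n v = Y x n v - Y y n v" "Y (- x) n v = - Y x n v"
  "Y (sum f A) n v = (\<Sum>a\<in>A. Y (f a) n v)"
proof -
  interpret l: Vector_Spaces.linear "smul V" "smul V" "\<lambda>u. Y u n v" by (rule linear_Y_left)
  show "Y (x + y) n v = Y x n v + Y y n v" "Y (c \<cdot> x) n v = c \<cdot> Y x n v" "Y 0 n v = 0"
    "Y (x - y) n v = Y x n v - Y y n v" "Y (- x) n v = - Y x n v"
    "Y (sum f A) n v = (\<Sum>a\<in>A. Y (f a) n v)"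
    by (simp_all add: l.add l.scale l.diff l.neg l.sum)
qed

lemma truncation: obtains N where "\<And>n. n \<ge> N \<Longrightarrow> Y u n v = 0"
  using VOA_conj[THEN conjunct2, THEN conjunct2, THEN conjunct1] by blast

lemma Y_vacuum: "Y \<Omega> n v = (if n = -1 then v else 0)"
  using VOA_conj[THEN conjunct2, THEN conjunct2, THEN conjunct2, THEN conjunct1] by blast

lemma creation: "Y u (-1) \<Omega> = u" and annihilation: "n \<ge> 0 \<Longrightarrow> Y u n \<Omega> = 0"
  using VOA_conj[THEN conjunct2, THEN conjunct2, THEN conjunct2, THEN conjunct2, THEN conjunct1] by blast+

lemma borcherds_identity:
  "fsum (\<lambda>i. ((of_int p :: complex) gchoose i) \<cdot> Y (Y u (r + int i) v) (p + q - int i) w)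
   = fsum (\<lambda>i. ((-1) ^ i * ((of_int r :: complex) gchoose i)) \<cdot>
       (Y u (p + r - int i) (Y v (q + int i) w)
        - ((-1) powi r) \<cdot> Y v (q + r - int i) (Y u (p + int i) w)))"
  using VOA_conj[THEN conjunct2, THEN conjunct2, THEN conjunct2, THEN conjunct2, THEN conjunct2, THEN conjunct1] by (elim allE)

lemma translation: "Y (Y \<omega> 0 u) n v = (- of_int n) \<cdot> Y u (n - 1) v"
  using VOA_conj[THEN conjunct2, THEN conjunct2, THEN conjunct2, THEN conjunct2, THEN conjunct2, THEN conjunct2, THEN conjunct2, THEN conjunct1] by (elim allE)

lemma span_grades: "v \<in> span (\<Union>k. grade V k)"
  using VOA_conj[THEN conjunct2, THEN conjunct2, THEN conjunct2, THEN conjunct2, THEN conjunct2, THEN conjunct2, THEN conjunct2, THEN conjunct2, THEN conjunct1] by blast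

lemma grade_finite_dim: obtains B where "finite B" "grade V k \<subseteq> span B"
  using VOA_conj[THEN conjunct2, THEN conjunct2, THEN conjunct2, THEN conjunct2, THEN conjunct2, THEN conjunct2, THEN conjunct2, THEN conjunct2, THEN conjunct2, THEN conjunct1] by blast

lemma grade_bounded_below: obtains N where "\<And>k. k < N \<Longrightarrow> grade V k = {0}"
  using VOA_conj[THEN conjunct2, THEN conjunct2, THEN conjunct2, THEN conjunct2, THEN conjunct2, THEN conjunct2, THEN conjunct2, THEN conjunct2, THEN conjunct2, THEN conjunct2] by blast

text \<open>The Borcherds identity at \<open>r = 0\<close>: the binomials \<open>0 gchoose i\<close>
  leave only the head on the other side. The iterate formula is the case
  \<open>p = 0\<close>.\<close>

lemma commutator_formula:
  "Y u p (Y v q w) - Y v q (Y u p w)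
   = fsum (\<lambda>i. ((of_int p :: complex) gchoose i) \<cdot> Y (Y u (int i) v) (p + q - int i) w)"
  by (subst borcherds_identity[of p u 0 v q w, simplified add_0])
     (subst fsum_eq_head; simp add: gbinomial_0_left)

lemma iterate_formula:
  "Y (Y u r v) q w = fsum (\<lambda>i. ((-1) ^ i * ((of_int r :: complex) gchoose i)) \<cdot>
       (Y u (r - int i) (Y v (q + int i) w)
        - ((-1) powi r) \<cdot> Y v (q + r - int i) (Y u (int i) w)))"
  by (subst borcherds_identity[of 0 u r v q w, simplified add_0, symmetric])
     (subst fsum_eq_head; simp add: gbinomial_0_left)

lemma commutator_0: "Y u 0 (Y v q w) = Y v q (Y u 0 w) + Y (Y u 0 v) q w"
proof -
  have "Y u 0 (Y v q w) - Y v q (Y u 0 w) = Y (Y u 0 v) q w"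
    unfolding commutator_formula by (subst fsum_eq_head; simp add: gbinomial_0_left)
  then show ?thesis by (simp add: algebra_simps)
qed

lemma commutator_1:
  "Y u 1 (Y v q w) = Y v q (Y u 1 w) + Y (Y u 0 v) (q + 1) w + Y (Y u 1 v) q w"
proof -
  have "(1::complex) gchoose i = 0" if "i \<ge> 2" for i
    using that binomial_gbinomial[of 1 i, where 'a = complex] by (simp add: binomial_eq_0)
  then have "Y u 1 (Y v q w) - Y v q (Y u 1 w) = Y (Y u 0 v) (q + 1) w + Y (Y u 1 v) q w"
    unfolding commutator_formula by (subst fsum_eq_sum[of 2]; simp add: numeral_2_eq_2 add.commute)
  then show ?thesis by (simp add: algebra_simps)
qed

lemma fsum_in_subspace: "subspace W \<Longrightarrow> (\<And>i. f i \<in> W) \<Longrightarrow> fsum f \<in> W"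
  unfolding fsum_def by (rule subspace_sum)

text \<open>Used to solve a Borcherds identity for its leading term, when the total and all later
  terms are already under control.\<close>

lemma fsum_head_in_subspace:
  assumes W: "subspace W" and f: "\<And>i. f (Suc i) \<in> W" "\<And>i. i \<ge> N \<Longrightarrow> f i = 0" and "fsum f \<in> W"
  shows "f 0 \<in> W"
proof -
  have "f 0 = fsum f - (\<Sum>i<N. f (Suc i))"
    using fsum_split_head[of N f] f by (simp add: algebra_simps)
  then show ?thesis using assms by (auto intro!: subspace_diff subspace_sum)
qed

lemma linear_span_image:
  assumes "Vector_Spaces.linear (smul V) (smul V) T" "subspace W" "x \<in> span S"
    and "\<And>y. y \<in> S \<Longrightarrow> T y \<in> W"
  shows "T x \<in> W"
proof -
  interpret T: Vector_Spaces.linear "smul V" "smul V" T by fact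
  have "span S \<subseteq> {x. T x \<in> W}"
    using assms(4) T.subspace_linear_preimage[OF assms(2)] by (intro span_minimal) auto
  then show ?thesis using assms by blast
qed

subsection \<open>Ideals\<close>

lemma left_ideal_imp_ideal:
  assumes I: "subspace I" and left: "\<And>u n v. v \<in> I \<Longrightarrow> Y u n v \<in> I"
  shows "voa_ideal V I"
proof -
  \<comment> \<open>These vectors are \<open>L_{-1}^i y / i!\<close>, where \<open>L_{-1}\<close> is
    the mode \<open>Y \<omega> 0\<close>; a left ideal is closed under it.\<close>
  have translates: "Y y (-1 - int i) \<Omega> \<in> I" if "y \<in> I" for y i
    using that
  proof (induction i arbitrary: y)
    case 0
    then show ?case by (simp add: creation)
  next
    case (Suc i)
    have "Y (Y \<omega> 0 y) (-1 - int i) \<Omega> = (1 + of_nat i) \<cdot> Y y (-1 - int (Suc i)) \<Omega>"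
      by (subst translation) (simp add: algebra_simps)
    then have "Y y (-1 - int (Suc i)) \<Omega> = (1 / (1 + of_nat i)) \<cdot> Y (Y \<omega> 0 y) (-1 - int i) \<Omega>"
      using of_nat_neq_0[of i, where 'a = complex] by simp
    then show ?case using Suc left I by (metis subspace_scale)
  qed
  \<comment> \<open>skew symmetry: the Borcherds identity at the vacuum with p = -1 and q = 0\<close>
  have right: "Y v r u \<in> I" if v: "v \<in> I" for u r v
  proof -
    let ?R = "\<lambda>i. ((-1) ^ i * ((of_int r :: complex) gchoose i)) \<cdot>
       (Y u (-1 + r - int i) (Y v (0 + int i) \<Omega>)
        - ((-1) powi r) \<cdot> Y v (0 + r - int i) (Y u (-1 + int i) \<Omega>))"
    have "fsum ?R \<in> I"
      unfolding borcherds_identity[of "-1" u r v 0 \<Omega>, symmetric]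
      using translates[OF left[OF v]] by (intro fsum_in_subspace I subspace_scale) simp
    moreover have "fsum ?R = ?R 0"
      by (intro fsum_eq_head) (simp add: annihilation Y_right)
    ultimately have "- ((-1) powi r) \<cdot> Y v r u \<in> I"
      by (simp add: annihilation creation Y_right)
    moreover define z where "z = - ((-1 :: complex) powi r)"
    ultimately have "z \<cdot> Y v r u \<in> I" by blast
    then have "inverse z \<cdot> (z \<cdot> Y v r u) \<in> I" by (rule subspace_scale[OF I])
    moreover have "z \<noteq> 0" by (simp add: z_def)
    ultimately show ?thesis by simp
  qed
  show ?thesis using assms right by (auto simp: voa_ideal_def vsubspace_def)
qed

text \<open>Associativity. With \<open>p = P\<close> beyond the truncation bound of \<open>u\<close>
  on \<open>w\<close>, the terms in which \<open>u\<close> meets \<open>w\<close> first vanish, and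
  the other side consists of single modes applied to \<open>w\<close>. The terms besides the head
  have larger \<open>q\<close>, so the induction descends from the bound \<open>N\<close> where
  \<open>v\<close> kills \<open>w\<close>.\<close>

lemma cyclic_left_closed:
  assumes x: "x \<in> span {Y v q w |v q. True}"
  shows "Y u m x \<in> span {Y v q w |v q. True}"
proof (rule linear_span_image[OF linear_Y subspace_span x])
  fix y assume "y \<in> {Y v q w |v q. True}"
  then obtain v q where y: "y = Y v q w" by blast
  let ?I = "span {Y v q w |v q. True}"
  obtain P where P: "\<And>n. n \<ge> P \<Longrightarrow> Y u n w = 0" using truncation by blast
  obtain N where N: "\<And>n. n \<ge> N \<Longrightarrow> Y v n w = 0" using truncation by blast
  have "Y u m (Y v q w) \<in> ?I" if "q \<ge> N - int k" for k m q
    using that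
  proof (induction k arbitrary: q m)
    case 0
    then show ?case by (simp add: N Y_right span_zero)
  next
    case (Suc k)
    let ?r = "m - P"
    let ?R = "\<lambda>i. ((-1) ^ i * ((of_int ?r :: complex) gchoose i)) \<cdot>
       (Y u (P + ?r - int i) (Y v (q + int i) w)
        - ((-1) powi ?r) \<cdot> Y v (q + ?r - int i) (Y u (P + int i) w))"
    have "?R 0 \<in> ?I"
    proof (rule fsum_head_in_subspace[of ?I ?R "nat (N - q)"])
      show "?R (Suc i) \<in> ?I" for i
      proof -
        have "Y u (m - int (Suc i)) (Y v (q + int (Suc i)) w) \<in> ?I"
          using Suc by (intro Suc.IH) simp
        then show ?thesis by (simp add: P Y_right span_scale span_neg)
      qed
      show "?R i = 0" if "i \<ge> nat (N - q)" for i
        using that by (simp add: N P Y_right)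
      show "fsum ?R \<in> ?I"
        unfolding borcherds_identity[of P u ?r v q w, symmetric]
        by (intro fsum_in_subspace subspace_span span_scale span_base) blast
    qed auto
    then show ?case by (simp add: P Y_right)
  qed
  from this[of "nat (N - q)" q m] show "Y u m y \<in> ?I" by (simp add: y)
qed

text \<open>Locality. For \<open>r\<close> beyond the truncation bound of \<open>u\<close> on
  \<open>v\<close> one side of the Borcherds identity is empty, and the terms with \<open>u\<close>
  next to \<open>w\<close> vanish by assumption; what remains is solved for its head by descending
  induction on \<open>q\<close>.\<close>

lemma annihilated_left_closed:
  assumes "\<And>k. Y u k w = 0"
  shows "Y u m (Y v q w) = 0"
proof -
  obtain R where R: "\<And>n. n \<ge> R \<Longrightarrow> Y u n v = 0" using truncation by blast
  obtain N where N: "\<And>n. n \<ge> N \<Longrightarrow> Y v n w = 0" using truncation by blast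
  define r where "r = max R 0"
  have "Y u m (Y v q w) = 0" if "q \<ge> N - int k" for k m q
    using that
  proof (induction k arbitrary: q m)
    case 0
    then show ?case by (simp add: N Y_right)
  next
    case (Suc k)
    let ?R = "\<lambda>i. ((-1) ^ i * ((of_int r :: complex) gchoose i)) \<cdot>
       (Y u ((m - r) + r - int i) (Y v (q + int i) w)
        - ((-1) powi r) \<cdot> Y v (q + r - int i) (Y u ((m - r) + int i) w))"
    have "?R 0 \<in> {0}"
    proof (rule fsum_head_in_subspace[of "{0}" ?R "nat (N - q)"])
      show "?R (Suc i) \<in> {0}" for i
        using Suc.IH[of "q + int (Suc i)" "m - int (Suc i)"] Suc.prems
        by (simp add: assms Y_right)
      show "?R i = 0" if "i \<ge> nat (N - q)" for i
        using that by (simp add: N assms Y_right)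
      show "fsum ?R \<in> {0}"
        unfolding borcherds_identity[of "m - r" u r v q w, symmetric]
        by (intro fsum_in_subspace) (auto simp: R r_def Y_left)
    qed auto
    then show ?case by (simp add: assms Y_right)
  qed
  from this[of "nat (N - q)" q m] show ?thesis by simp
qed

end

section \<open>Consequences of simplicity\<close>

locale simple_voa = VOA +
  assumes simple: "simple_VOA V"
begin

lemma cyclic_span:
  assumes "w \<noteq> 0"
  shows "span {Y v q w |v q. True} = UNIV"
proof -
  let ?I = "span {Y v q w |v q. True}"
  have "voa_ideal V ?I"
    by (intro left_ideal_imp_ideal cyclic_left_closed subspace_span)
  moreover have "w \<in> ?I"
    using Y_vacuum[of "-1" w] by (intro span_base) (metis (mono_tags, lifting) mem_Collect_eq)
  ultimately show ?thesis using simple assms unfolding simple_VOA_def by blast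
qed

text \<open>A vector all of whose modes kill \<open>w\<close> also kills everything generated from
  \<open>w\<close>, hence the vacuum; but \<open>u\<close> is recovered from its action on the
  vacuum.\<close>

lemma product_nonzero:
  assumes "u \<noteq> 0" "w \<noteq> 0"
  obtains k where "Y u k w \<noteq> 0"
proof (rule ccontr)
  assume "\<not> thesis"
  then have u: "Y u k w = 0" for k using that by blast
  have "\<Omega> \<in> span {Y v q w |v q. True}" using cyclic_span[OF assms(2)] by blast
  then have "Y u (-1) \<Omega> \<in> {0}"
    by (rule linear_span_image[OF linear_Y subspace_single_0])
       (auto simp: annihilated_left_closed[OF u])
  then show False using assms by (simp add: creation)
qed

text \<open>For a translation-invariant vector all modes but the (-1)-st vanish, and that one commutes
  with everything, so its eigenspaces are ideals.\<close>

lemma translation_invariant_imp_scalar: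
  assumes w: "Y \<omega> 0 w = 0" "w \<in> grade V 0"
  obtains c where "w = c \<cdot> \<Omega>"
proof (cases "\<Omega> = 0")
  case True
  then show thesis using that[of 0] creation[of w] by (simp add: Y_right)
next
  case False
  have modes: "Y w n v = 0" if "n \<noteq> -1" for n v
  proof -
    have "(- of_int (n + 1)) \<cdot> Y w n v = 0"
      using translation[of w "n + 1" v] w by (simp add: Y_left)
    moreover have "(of_int (n + 1) :: complex) \<noteq> 0"
      using that by (subst of_int_eq_0_iff) simp
    ultimately show ?thesis by (simp del: of_int_add)
  qed
  \<comment> \<open>A nonzero finite-dimensional space preserved by \<open>Y w (-1)\<close>; it is
    needed because an operator on all of V might have no eigenvector.\<close>
  let ?S = "{x. Y \<omega> 0 x = 0} \<inter> grade V 0"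
  have S: "subspace ?S"
    by (rule subspaceI) (auto simp: grade_def Y_right)
  have "\<Omega> \<in> ?S" by (simp add: grade_def annihilation)
  obtain B where B: "finite B" "grade V 0 \<subseteq> span B" by (rule grade_finite_dim)
  obtain x c where x: "x \<in> ?S" "x \<noteq> 0" "Y w (-1) x = c \<cdot> x"
  proof (rule exists_eigenvector[OF vector_space_axioms linear_Y S, of B w "-1"])
    fix x assume x: "x \<in> ?S"
    have "Y \<omega> 0 (Y w (-1) x) = 0" using x w by (simp add: commutator_0 Y_right Y_left)
    moreover have "Y \<omega> 1 (Y w (-1) x) = 0"
      using x w by (simp add: grade_def commutator_1 Y_right Y_left)
    ultimately show "Y w (-1) x \<in> ?S" by (simp add: grade_def)
  qed (use B False \<open>\<Omega> \<in> ?S\<close> in auto)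
  let ?K = "{v. Y w (-1) v = c \<cdot> v}"
  have "Y w (-1) (Y u n v) = Y u n (Y w (-1) v)" for u n v
    using commutator_formula[of w "-1" u n v]
    by (simp add: modes Y_left fsum_def)
  then have "voa_ideal V ?K"
    by (intro left_ideal_imp_ideal subspaceI) (auto simp: Y_right algebra_simps)
  then have "?K = UNIV"
    using simple x unfolding simple_VOA_def by blast
  then have "Y w (-1) \<Omega> = c \<cdot> \<Omega>" by blast
  then show thesis using that creation by metis
qed

end

section \<open>Submodules via generators, spectral subspaces and the weight filtration\<close>

context VOA
begin

definition stable :: "'v set \<Rightarrow> 'v set \<Rightarrow> bool" where
  "stable S W \<longleftrightarrow> subspace W \<and> (\<forall>s\<in>S. \<forall>m. \<forall>x\<in>W. Y s m x \<in> W)"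

lemma product_preserves:
  assumes W: "subspace W" and "\<And>n x. x \<in> W \<Longrightarrow> Y u n x \<in> W" "\<And>n x. x \<in> W \<Longrightarrow> Y v n x \<in> W" "x \<in> W"
  shows "Y (Y u r v) n x \<in> W"
  unfolding iterate_formula
  by (intro fsum_in_subspace subspace_scale subspace_diff W assms)

text \<open>The vectors whose modes all preserve \<open>W\<close> form a subalgebra, so it is enough
  to test generators.\<close>

lemma stable_iff_submod: "stable S W \<longleftrightarrow> submod V (gen_sub V S) W"
proof
  assume st: "stable S W"
  let ?T = "{u. \<forall>n. \<forall>x\<in>W. Y u n x \<in> W}"
  have W: "subspace W" using st by (simp add: stable_def)
  have "subspace ?T"
    by (rule subspaceI) (auto simp: Y_left intro!: subspace_0 subspace_add subspace_scale W)
  moreover have "\<Omega> \<in> ?T" using subspace_0[OF W] by (auto simp: Y_vacuum)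
  moreover have "S \<subseteq> ?T" using st by (auto simp: stable_def)
  moreover have "\<forall>u\<in>?T. \<forall>v\<in>?T. \<forall>n. Y u n v \<in> ?T"
    using product_preserves[OF W] by blast
  ultimately have "gen_sub V S \<subseteq> ?T" unfolding gen_sub_def vsubspace_def by blast
  then show "submod V (gen_sub V S) W" using W by (auto simp: submod_def vsubspace_def)
next
  assume sm: "submod V (gen_sub V S) W"
  have "S \<subseteq> gen_sub V S" unfolding gen_sub_def by blast
  then show "stable S W" using sm unfolding submod_def stable_def vsubspace_def by blast
qed

lemma gen_sub_props:
  shows "subspace (gen_sub V S)" "\<Omega> \<in> gen_sub V S" "S \<subseteq> gen_sub V S" "stable S (gen_sub V S)"
proof -
  show sub: "subspace (gen_sub V S)"
    unfolding gen_sub_def vsubspace_def by (rule subspace_Inter) blast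
  show "\<Omega> \<in> gen_sub V S" "S \<subseteq> gen_sub V S" unfolding gen_sub_def by blast+
  show "stable S (gen_sub V S)"
    unfolding stable_def
  proof (intro conjI ballI allI sub)
    fix s m x assume s: "s \<in> S" "x \<in> gen_sub V S"
    show "Y s m x \<in> gen_sub V S"
      unfolding gen_sub_def
    proof (rule InterI)
      fix W assume W: "W \<in> {W. vsubspace V W \<and> \<Omega> \<in> W \<and> S \<subseteq> W \<and> (\<forall>u\<in>W. \<forall>v\<in>W. \<forall>n. Y u n v \<in> W)}"
      then have "s \<in> W" "x \<in> W" using s unfolding gen_sub_def by blast+
      then show "Y s m x \<in> W" using W by blast
    qed
  qed
qed

text \<open>A sum of genuine eigenspaces. That it exhausts V for a suitable \<open>A\<close> is a
  result (\<open>eig_nonneg_UNIV\<close>), since Jordan blocks are not excluded beforehand.\<close>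

definition eig :: "'v \<Rightarrow> complex set \<Rightarrow> 'v set" where
  "eig e A = span (\<Union>\<mu>\<in>A. {x. Y e 1 x = \<mu> \<cdot> x})"

lemma subspace_eig: "subspace (eig e A)"
  by (simp add: eig_def)

lemma eigI: "Y e 1 x = \<mu> \<cdot> x \<Longrightarrow> \<mu> \<in> A \<Longrightarrow> x \<in> eig e A"
  unfolding eig_def by (rule span_base) blast

lemma eig_mono: "A \<subseteq> B \<Longrightarrow> eig e A \<subseteq> eig e B"
  unfolding eig_def by (rule span_mono) blast

lemma eig_disjoint:
  assumes "A \<inter> B = {}" "x \<in> eig e A" "x \<in> eig e B"
  shows "x = 0"
  by (rule joint_eigenspans_disjoint[of "{()}" "\<lambda>_. Y e 1" A B "\<lambda>\<mu> _. \<mu>" x])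
     (use assms in \<open>auto simp: eig_def linear_Y\<close>)

definition hwv :: "'v \<Rightarrow> complex \<Rightarrow> 'v \<Rightarrow> bool" where
  "hwv e h w \<longleftrightarrow> Y e 1 w = h \<cdot> w \<and> (\<forall>m\<ge>2. Y e m w = 0)"

text \<open>Filters by conformal weight. It vanishes far down and the modes of an Ising vector with
  index at least 2 lower it strictly, which drives the induction for complete reducibility.\<close>

definition filtration :: "int \<Rightarrow> 'v set" where
  "filtration k = span (\<Union>j\<in>{..k}. grade V j)"

lemma filtration_mono: "j \<le> k \<Longrightarrow> filtration j \<subseteq> filtration k"
  unfolding filtration_def by (intro span_mono UN_mono) auto

lemma in_filtration: obtains k where "v \<in> filtration k"
proof -
  have "\<exists>k. v \<in> filtration k"
    using span_grades[of v]
  proof (induction rule: span_induct_alt)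
    case base
    then show ?case by (auto simp: filtration_def span_zero)
  next
    case (step c x y)
    then obtain j k where "x \<in> grade V j" "y \<in> filtration k" by blast
    then have "x \<in> filtration (max j k)" unfolding filtration_def by (intro span_base UN_I[of j]) auto
    moreover have "y \<in> filtration (max j k)"
      using filtration_mono[of k "max j k"] \<open>y \<in> filtration k\<close> by auto
    ultimately have "c \<cdot> x + y \<in> filtration (max j k)" by (simp add: filtration_def span_add span_scale)
    then show ?case ..
  qed
  then show thesis using that by blast
qed

lemma filtration_trivial: obtains N where "filtration N = {0}"
proof -
  obtain N where N: "\<And>k. k < N \<Longrightarrow> grade V k = {0}" using grade_bounded_below by blast
  have "(\<Union>j\<in>{..N - 1}. grade V j) \<subseteq> {0}" using N by auto
  then have "filtration (N - 1) \<subseteq> {0}" unfolding filtration_def by (rule span_minimal) simp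
  then show thesis using that span_zero unfolding filtration_def by blast
qed

end

section \<open>A single Ising vector\<close>

definition ising_weights :: "complex set" where "ising_weights = {0, 1/2, 1/16}"

definition weight_class :: "complex \<Rightarrow> complex set" where
  "weight_class h = range (\<lambda>k::int. h + of_int k)"

lemma shift_in_weight_class: "h + of_int k \<in> weight_class h"
  unfolding weight_class_def by (rule rangeI)

lemma nat_shift_in_weight_class: "range (\<lambda>k::nat. h + of_nat k) \<subseteq> weight_class h"
proof
  fix x assume "x \<in> range (\<lambda>k::nat. h + of_nat k)"
  then obtain k :: nat where "x = h + of_nat k" by blast
  then show "x \<in> weight_class h" unfolding weight_class_def by (intro range_eqI[of _ _ "int k"]) simp
qed

text \<open>The real parts lie between 0 and 1/2, so an integral difference is zero.\<close>

lemma ising_weight_in_class: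
  assumes "h \<in> ising_weights" "h' \<in> ising_weights" "h' \<in> weight_class h"
  shows "h' = h"
proof -
  obtain k :: int where k: "h' = h + of_int k" using assms by (auto simp: weight_class_def)
  have "0 \<le> Re x \<and> Re x \<le> 1/2" if "x \<in> ising_weights" for x
    using that unfolding ising_weights_def by (elim insertE emptyE; hypsubst; simp)
  from this[OF assms(1)] this[OF assms(2)] k have "\<bar>real_of_int k\<bar> < 1" by auto
  then show ?thesis using k by simp
qed

lemma weight_class_disjoint: "h \<in> ising_weights \<Longrightarrow> h' \<in> ising_weights \<Longrightarrow> h \<noteq> h' \<Longrightarrow> weight_class h \<inter> weight_class h' = {}"
proof (rule ccontr)
  assume h: "h \<in> ising_weights" "h' \<in> ising_weights" "h \<noteq> h'" "weight_class h \<inter> weight_class h' \<noteq> {}"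
  then obtain k l :: int where "h + of_int k = h' + of_int l" by (auto simp: weight_class_def)
  then have "h' = h + of_int (k - l)" by (simp add: algebra_simps)
  then have "h' \<in> weight_class h" using shift_in_weight_class by metis
  then show False using h ising_weight_in_class[of h h'] by simp
qed

text \<open>On the three Ising weights these are the usual fusion rules: 0 is neutral, 1/2 x 1/2 =
  0, 1/2 x 1/16 = 1/16, 1/16 x 1/16 = 0 + 1/2. The equation is the one imposed on weights by the
  null vector \<open>L_{-1}^2 u = ((4a+2)/3) L_{-2} u\<close>; its other roots are not Ising
  weights.\<close>

definition fuses :: "complex \<Rightarrow> complex \<Rightarrow> complex \<Rightarrow> bool" where
  "fuses a b c \<longleftrightarrow> (if a = 0 then c = b
     else (c - b - a - 1) * (c - b - a) = (4 * a + 2) / 3 * (2 * b + a - c))"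

text \<open>In terms of Virasoro operators, \<open>Y e m\<close> is \<open>L (m - 1)\<close>; so \<open>Y e 1\<close> is the grading operator.\<close>

locale ising_VOA = VOA V for V :: "('v::ab_group_add) voa" +
  fixes e :: 'v
  assumes ising: "ising V e"
begin

lemma virasoro:
  "Y e m (Y e k v) = Y e k (Y e m v) + of_int (m - k) \<cdot> Y e (m + k - 1) v
     + (if m + k = 2 then (((of_int m - 1) ^ 3 - (of_int m - 1)) / 24) \<cdot> v else 0)"
proof -
  have "virasoro_rel V e (1/2)" using ising by (simp add: ising_def)
  then have "Y e ((m - 1) + 1) (Y e ((k - 1) + 1) v) - Y e ((k - 1) + 1) (Y e ((m - 1) + 1) v)
     = of_int ((m - 1) - (k - 1)) \<cdot> Y e ((m - 1) + (k - 1) + 1) v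
     + (if (m - 1) + (k - 1) = 0
        then ((of_int (m - 1) ^ 3 - of_int (m - 1)) / 12 * (1/2)) \<cdot> v else 0)"
    unfolding virasoro_rel_def by blast
  moreover have "m - 1 + (k - 1) + 1 = m + k - 1" "(m - 1) - (k - 1) = m - k"
    "(m - 1) + (k - 1) = 0 \<longleftrightarrow> m + k = 2"
    "(of_int (m - 1) ^ 3 - of_int (m - 1)) / 12 * (1/2)
      = ((of_int m - 1) ^ 3 - (of_int m - 1)) / (24::complex)" by auto
  ultimately show ?thesis by (simp only: diff_eq_eq diff_add_cancel) (simp only: add_ac)
qed

lemma Y1_commute:
  assumes "Y e 1 x = h \<cdot> x"
  shows "Y e 1 (Y e m x) = (h + 1 - of_int m) \<cdot> Y e m x"
proof -
  have "Y e 1 (Y e m x) = h \<cdot> Y e m x + of_int (1 - m) \<cdot> Y e m x"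
    using virasoro[of 1 m x] by (simp add: assms Y_right)
  also have "\<dots> = (h + of_int (1 - m)) \<cdot> Y e m x" by (simp only: scale_left_distrib)
  finally show ?thesis by (simp add: algebra_simps)
qed

lemma filtration_mode: "x \<in> filtration k \<Longrightarrow> Y e m x \<in> filtration (k + 1 - m)"
  unfolding filtration_def
proof (rule linear_span_image[OF linear_Y subspace_span])
  fix y assume "y \<in> (\<Union>j\<in>{..k}. grade V j)"
  then obtain j where j: "j \<le> k" "y \<in> grade V j" by blast
  have "Y \<omega> 1 e = 2 \<cdot> e" using ising by (simp add: ising_def grade_def)
  then have "Y \<omega> 1 (Y e m y)
      = of_int j \<cdot> Y e m y + (- of_int (m + 1)) \<cdot> Y e m y + 2 \<cdot> Y e m y"
    using j translation[of e "m + 1" y]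
    by (simp add: commutator_1 grade_def Y_right Y_left)
  also have "\<dots> = (of_int j + (- of_int (m + 1)) + 2) \<cdot> Y e m y"
    by (simp only: scale_left_distrib)
  also have "of_int j + (- of_int (m + 1)) + 2 = (of_int (j + 1 - m) :: complex)" by simp
  finally have "Y \<omega> 1 (Y e m y) = of_int (j + 1 - m) \<cdot> Y e m y" .
  then have "Y e m y \<in> grade V (j + 1 - m)" by (simp add: grade_def)
  then show "Y e m y \<in> span (\<Union>j\<in>{..k + 1 - m}. grade V j)" using j by (intro span_base) auto
qed

text \<open>\<open>Y e 2\<close> and \<open>Y e 3\<close> are \<open>L_1\<close> and
  \<open>L_2\<close>, which generate all positive modes by commutators.\<close>

lemma hwvI:
  assumes "Y e 1 w = h \<cdot> w" "Y e 2 w = 0" "Y e 3 w = 0"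
  shows "hwv e h w"
proof -
  have "Y e (int n + 3) w = 0" for n
  proof (induction n)
    case 0
    then show ?case using assms by simp
  next
    case (Suc n)
    have "of_int (- 1 - int n) \<cdot> Y e (int n + 4) w = 0"
      using virasoro[of 2 "int n + 3" w] Suc assms by (simp add: Y_right algebra_simps)
    moreover have "of_int (- 1 - int n) \<noteq> (0::complex)" by (subst of_int_eq_0_iff) simp
    ultimately have "Y e (int n + 4) w = 0" by (simp del: of_int_diff of_int_minus)
    then show ?case by (simp add: add.commute)
  qed
  then have "Y e m w = 0" if "m \<ge> 2" for m
    using that assms(2) \<open>Y e (int (nat (m - 3)) + 3) w = 0\<close> by (cases "m = 2") auto
  then show ?thesis using assms by (simp add: hwv_def)
qed

subsection \<open>Highest weight modules\<close>

text \<open>Monomials in the raising modes, with their depth as second argument;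
  \<open>Y e (- int m)\<close> is \<open>L_{-m-1}\<close>, whence the \<open>Suc\<close>. They are
  left unordered, as only their span and their weights matter.\<close>

inductive desc :: "'v \<Rightarrow> nat \<Rightarrow> 'v \<Rightarrow> bool" for w where
  desc_base: "desc w 0 w"
| desc_step: "desc w k x \<Longrightarrow> desc w (k + Suc m) (Y e (- int m) x)"

definition hw_module :: "'v \<Rightarrow> 'v set" where
  "hw_module w = span {x. \<exists>k. desc w k x}"

lemma desc_weight:
  assumes "desc w k x" "Y e 1 w = h \<cdot> w"
  shows "Y e 1 x = (h + of_nat k) \<cdot> x"
  using assms
proof (induction rule: desc.induct)
  case (desc_step k x m)
  then show ?case using Y1_commute[of x "h + of_nat k" "- int m"] by (simp add: algebra_simps)
qed simp

lemma hw_module_self: "w \<in> hw_module w"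
  unfolding hw_module_def by (rule span_base) (auto intro: desc_base)

lemma hw_module_minimal: "stable {e} W \<Longrightarrow> w \<in> W \<Longrightarrow> hw_module w \<subseteq> W"
proof -
  assume W: "stable {e} W" "w \<in> W"
  have "x \<in> W" if "desc w k x" for k x
    using that by induction (use W in \<open>auto simp: stable_def\<close>)
  then show ?thesis unfolding hw_module_def using W by (intro span_minimal) (auto simp: stable_def)
qed

lemma hw_module_weights: "Y e 1 w = h \<cdot> w \<Longrightarrow> hw_module w \<subseteq> eig e (range (\<lambda>k. h + of_nat k))"
  unfolding hw_module_def by (intro span_minimal subspace_eig) (auto dest: desc_weight intro: eigI)

lemma stable_hw_module:
  assumes w: "hwv e h w"
  shows "stable {e} (hw_module w)"
proof -
  have down: "Y e (- int m) x \<in> hw_module w" if "x \<in> hw_module w" for m x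
    using that unfolding hw_module_def
    by (rule linear_span_image[OF linear_Y subspace_span]) (auto intro: span_base desc_step)
  \<comment> \<open>All \<open>m\<close> are treated at once because the commutator with the
    outermost mode produces another mode on \<open>x\<close>.\<close>
  have "\<forall>m. Y e m x \<in> hw_module w" if "desc w k x" for k x
    using that
  proof induction
    case desc_base
    have "Y e m w \<in> hw_module w" for m
    proof -
      consider "m \<le> 0" | "m = 1" | "m \<ge> 2" by linarith
      then show ?thesis
      proof cases
        case 1
        then show ?thesis using down[OF hw_module_self, of "nat (- m)"] by simp
      next
        case 2
        then show ?thesis using w hw_module_self by (simp add: hwv_def hw_module_def span_scale)
      next
        case 3
        then show ?thesis using w by (simp add: hwv_def hw_module_def span_zero)
      qed
    qed
    then show ?case ..
  next
    case (desc_step k x j)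
    have "x \<in> hw_module w" unfolding hw_module_def using desc_step by (intro span_base) blast
    have "Y e m (Y e (- int j) x) \<in> hw_module w" for m
      unfolding virasoro[of m]
      using desc_step.IH \<open>x \<in> hw_module w\<close> down
      by (auto simp: hw_module_def intro!: span_add span_scale span_zero)
    then show ?case ..
  qed
  then have "Y e m x \<in> hw_module w" if "x \<in> hw_module w" for m x
    using that unfolding hw_module_def
    by - (rule linear_span_image[OF linear_Y subspace_span], assumption, blast)
  then show ?thesis by (auto simp: stable_def hw_module_def)
qed

subsection \<open>The null vector of weight six\<close>

text \<open>The coefficients are found, up to a common factor, from the conditions that
  \<open>L_1\<close> and \<open>L_2\<close> annihilate the vector. These are four linear equations
  for four unknowns, written out in \<open>hwv_null6\<close>; the central charge enters through 99/4
  and 1/4, and c = 1/2 makes a nonzero solution possible.\<close>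

definition null6 :: 'v where
  "null6 = 64 \<cdot> Y e (-1) (Y e (-1) (Y e (-1) \<Omega>)) + 93 \<cdot> Y e (-2) (Y e (-2) \<Omega>)
     - 264 \<cdot> Y e (-3) (Y e (-1) \<Omega>) - 108 \<cdot> Y e (-5) \<Omega>"

text \<open>The guard \<open>k < m\<close> orients the relation, so that rewriting moves larger
  modes towards the vacuum and terminates.\<close>

lemma virasoro_sort:
  "k < m \<Longrightarrow> Y e m (Y e k v) = Y e k (Y e m v) + of_int (m - k) \<cdot> Y e (m + k - 1) v
     + (if m + k = 2 then (((of_int m - 1) ^ 3 - (of_int m - 1)) / 24) \<cdot> v else 0)"
  by (rule virasoro)

lemma hwv_null6: "hwv e 6 null6"
proof (rule hwvI)
  have w: "Y e 1 (Y e m x) = (h + 1 - of_int m) \<cdot> Y e m x" if "Y e 1 x = h \<cdot> x" for m x h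
    using that by (rule Y1_commute)
  have 0: "Y e 1 \<Omega> = 0 \<cdot> \<Omega>" by (simp add: annihilation)
  have "Y e 1 (Y e (-1) (Y e (-1) (Y e (-1) \<Omega>))) = 6 \<cdot> Y e (-1) (Y e (-1) (Y e (-1) \<Omega>))"
    using w[OF w[OF w[OF 0]], of "-1" "-1" "-1"] by simp
  moreover have "Y e 1 (Y e (-2) (Y e (-2) \<Omega>)) = 6 \<cdot> Y e (-2) (Y e (-2) \<Omega>)"
    using w[OF w[OF 0], of "-2" "-2"] by simp
  moreover have "Y e 1 (Y e (-3) (Y e (-1) \<Omega>)) = 6 \<cdot> Y e (-3) (Y e (-1) \<Omega>)"
    using w[OF w[OF 0], of "-3" "-1"] by simp
  moreover have "Y e 1 (Y e (-5) \<Omega>) = 6 \<cdot> Y e (-5) \<Omega>"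
    using w[OF 0, of "-5"] by simp
  ultimately show "Y e 1 null6 = 6 \<cdot> null6"
    by (simp add: null6_def Y_right scale_right_distrib scale_right_diff_distrib)
next
  have "9 \<cdot> x = 3 \<cdot> x + 3 \<cdot> x + 3 \<cdot> x" "6 \<cdot> x = 3 \<cdot> x + 3 \<cdot> x" for x
    by (simp_all flip: scale_left_distrib)
  then have a: "Y e 2 (Y e (-1) (Y e (-1) (Y e (-1) \<Omega>))) = 9 \<cdot> Y e (-2) (Y e (-1) \<Omega>) + 6 \<cdot> Y e (-4) \<Omega>"
    by (simp add: virasoro_sort annihilation Y_right scale_right_distrib)
  have b: "Y e 2 (Y e (-2) (Y e (-2) \<Omega>)) = 8 \<cdot> Y e (-2) (Y e (-1) \<Omega>) + 4 \<cdot> Y e (-4) \<Omega>"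
    by (simp add: virasoro_sort annihilation Y_right scale_right_distrib) (simp flip: scale_left_distrib)
  have c: "Y e 2 (Y e (-3) (Y e (-1) \<Omega>)) = 5 \<cdot> Y e (-2) (Y e (-1) \<Omega>)"
    by (simp add: virasoro_sort annihilation Y_right scale_right_distrib)
  have d: "Y e 2 (Y e (-5) \<Omega>) = 7 \<cdot> Y e (-4) \<Omega>"
    by (simp add: virasoro_sort annihilation Y_right scale_right_distrib)
  have "Y e 2 null6 = (64 * 9 + 93 * 8 - 264 * 5) \<cdot> Y e (-2) (Y e (-1) \<Omega>)
      + (64 * 6 + 93 * 4 - 108 * 7) \<cdot> Y e (-4) \<Omega>"
    unfolding null6_def Y_right a b c d by (simp only: scale_scale algebra_simps)
  then show "Y e 2 null6 = 0" by simp
next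
  have a: "Y e 3 (Y e (-1) (Y e (-1) (Y e (-1) \<Omega>))) = (99/4) \<cdot> Y e (-1) (Y e (-1) \<Omega>)"
    by (simp add: virasoro_sort annihilation Y_right scale_right_distrib) (simp flip: scale_left_distrib)
  have b: "Y e 3 (Y e (-2) (Y e (-2) \<Omega>)) = 10 \<cdot> Y e (-3) \<Omega>"
    by (simp add: virasoro_sort annihilation Y_right scale_right_distrib)
  have c: "Y e 3 (Y e (-3) (Y e (-1) \<Omega>)) = 6 \<cdot> Y e (-1) (Y e (-1) \<Omega>) + (1/4) \<cdot> Y e (-3) \<Omega>"
    by (simp add: virasoro_sort annihilation Y_right scale_right_distrib)
  have d: "Y e 3 (Y e (-5) \<Omega>) = 8 \<cdot> Y e (-3) \<Omega>"
    by (simp add: virasoro_sort annihilation Y_right scale_right_distrib)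
  have "Y e 3 null6 = (64 * (99/4) - 264 * 6) \<cdot> Y e (-1) (Y e (-1) \<Omega>)
      + (93 * 10 - 264 * (1/4) - 108 * 8) \<cdot> Y e (-3) \<Omega>"
    unfolding null6_def Y_right a b c d by (simp only: scale_scale algebra_simps)
  then show "Y e 3 null6 = 0" by simp
qed

text \<open>The weights of the submodule generated by \<open>null6\<close> are at least 6, so it
  misses the vacuum and is not all of the simple algebra.\<close>

lemma null6_eq_0: "null6 = 0"
proof (cases "\<Omega> = 0")
  case True
  then show ?thesis using creation[of null6] by (simp add: Y_right)
next
  case False
  let ?U = "Vir V e"
  have U: "stable {e} ?U" "\<Omega> \<in> ?U" "subspace ?U"
    using gen_sub_props[of "{e}"] by (simp_all add: Vir_def)
  then have st: "Y e m x \<in> ?U" if "x \<in> ?U" for m x using that by (simp add: stable_def)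
  have "null6 \<in> ?U"
    unfolding null6_def by (intro subspace_diff subspace_add subspace_scale U st)
  then have sub: "hw_module null6 \<subseteq> ?U" using U by (intro hw_module_minimal)
  have "submod V ?U (hw_module null6)"
    using stable_hw_module[OF hwv_null6] by (simp add: stable_iff_submod Vir_def)
  then have "hw_module null6 = {0} \<or> hw_module null6 = ?U"
    using ising sub by (simp add: ising_def irr_submod_def)
  moreover have "hw_module null6 \<noteq> ?U"
  proof
    assume "hw_module null6 = ?U"
    then have "\<Omega> \<in> eig e (range (\<lambda>k. 6 + of_nat k))"
      using U hw_module_weights[of null6 6] hwv_null6 by (auto simp: hwv_def)
    moreover have "\<Omega> \<in> eig e {0}" by (rule eigI[of _ _ 0]) (auto simp: annihilation)
    moreover have "(6 + of_nat k :: complex) \<noteq> 0" for k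
      using of_nat_neq_0[of "k + 5", where 'a = complex] by (simp add: algebra_simps)
    then have "range (\<lambda>k. 6 + of_nat k :: complex) \<inter> {0} = {}" by auto
    ultimately show False using False eig_disjoint by metis
  qed
  ultimately show ?thesis using hw_module_self[of null6] by blast
qed

end

context VOA begin

text \<open>Intended for the iterate formula on vectors that are killed, modulo \<open>W\<close>, by
  all \<open>Y e i\<close> with i \<ge> 2: there only i = 0 and i = 1 contribute.\<close>

lemma fsum_two_heads:
  assumes W: "subspace W" and f: "\<And>i. i \<ge> 2 \<Longrightarrow> f i \<in> W" "\<And>i. i \<ge> N \<Longrightarrow> f i = 0"
  shows "fsum f - (f 0 + f 1) \<in> W"
proof -
  have "fsum f = (\<Sum>i<Suc (Suc N). f i)" using f by (intro fsum_eq_sum) simp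
  also have "\<dots> = f 0 + (f 1 + (\<Sum>i<N. f (Suc (Suc i))))"
    by (simp only: sum.lessThan_Suc_shift One_nat_def)
  finally have "fsum f - (f 0 + f 1) = (\<Sum>i<N. f (Suc (Suc i)))" by simp
  then show ?thesis using f W by (auto intro!: subspace_sum)
qed

end

subsection \<open>Zero modes modulo a submodule\<close>

context ising_VOA
begin

definition sing_mod :: "'v set \<Rightarrow> 'v set" where
  "sing_mod W = {v. \<forall>m\<ge>2. Y e m v \<in> W}"

text \<open>Zhu's algebra in disguise: \<open>g\<close> is the action of the class of \<open>y\<close> on the top level of \<open>V/W\<close>.\<close>

definition zero_mode :: "'v set \<Rightarrow> int \<Rightarrow> ('v \<Rightarrow> 'v) \<Rightarrow> 'v \<Rightarrow> bool" where
  "zero_mode W d g y \<longleftrightarrow> Y e 1 y = of_int d \<cdot> y \<and> (\<forall>n. \<forall>x\<in>W. Y y n x \<in> W) \<and>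
     (\<forall>v\<in>sing_mod W. (\<forall>j\<ge>d. Y y j v \<in> W) \<and> Y y (d - 1) v - g v \<in> W) \<and>
     (\<forall>v. g (Y e 1 v) = Y e 1 (g v))"

lemma sing_mod_Y1:
  assumes W: "stable {e} W" and v: "v \<in> sing_mod W"
  shows "Y e 1 v \<in> sing_mod W"
  unfolding sing_mod_def
proof (intro CollectI allI impI)
  fix m :: int assume "m \<ge> 2"
  then have "Y e m v \<in> W" using v by (simp add: sing_mod_def)
  then show "Y e m (Y e 1 v) \<in> W"
    using W unfolding virasoro[of m 1]
    by (auto simp: stable_def intro!: subspace_add subspace_scale subspace_0)
qed

lemma zero_mode_vacuum: "subspace W \<Longrightarrow> zero_mode W 0 (\<lambda>v. v) \<Omega>"
  by (auto simp: zero_mode_def annihilation Y_vacuum subspace_0)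

text \<open>Zhu's recursion from \<open>y\<close> to \<open>Y e r y\<close>. In the iterate formula
  every term with \<open>e\<close> in front carries a mode of \<open>y\<close> of index at least
  \<open>d\<close> and so lies in \<open>W\<close>; the other halves of the terms i = 0 and i = 1
  give the new operator. Starting from the vacuum this yields the zero mode of every
  monomial.\<close>

lemma zero_mode_step:
  assumes W: "stable {e} W" and y: "zero_mode W d g y" and r: "r < 0"
    and g: "\<And>x z. g (x + z) = g x + g z" "\<And>c x. g (c \<cdot> x) = c \<cdot> g x"
  shows "zero_mode W (d + 1 - r)
    (\<lambda>v. ((-1) powi (r + 1)) \<cdot> (of_int d \<cdot> g v - of_int r \<cdot> g (Y e 1 v))) (Y e r y)"
proof -
  have subW: "subspace W" and eW: "\<And>m x. x \<in> W \<Longrightarrow> Y e m x \<in> W"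
    using W by (auto simp: stable_def)
  have y1: "Y e 1 y = of_int d \<cdot> y" and yW: "\<And>n x. x \<in> W \<Longrightarrow> Y y n x \<in> W"
    and yv: "\<And>v j. v \<in> sing_mod W \<Longrightarrow> j \<ge> d \<Longrightarrow> Y y j v \<in> W"
    and yg: "\<And>v. v \<in> sing_mod W \<Longrightarrow> Y y (d - 1) v - g v \<in> W"
    and gY: "\<And>v. g (Y e 1 v) = Y e 1 (g v)"
    using y by (auto simp: zero_mode_def)
  let ?g = "\<lambda>v. ((-1) powi (r + 1)) \<cdot> (of_int d \<cdot> g v - of_int r \<cdot> g (Y e 1 v))"
  have 1: "Y e 1 (Y e r y) = of_int (d + 1 - r) \<cdot> Y e r y"
    using Y1_commute[OF y1] by simp
  have 2: "Y (Y e r y) n x \<in> W" if "x \<in> W" for n x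
    using that by (intro product_preserves[OF subW] eW yW)
  \<comment> \<open>\<open>Y e 0 v\<close> need not lie in \<open>sing_mod W\<close>, so what is
    known about \<open>y\<close> does not apply to it. Instead \<open>Y e 0\<close> is moved to the
    front by \<open>L0\<close>, at the cost of the derivative \<open>Y e 0 y\<close>, which
    \<open>L\<close> trades for \<open>Y e 1\<close>.\<close>
  have L: "Y (Y e 0 y) j v = Y e 1 (Y y (j - 1) v) - Y y (j - 1) (Y e 1 v) - of_int d \<cdot> Y y (j - 1) v"
    for j v
    using commutator_1[of e y "j - 1" v] by (simp add: y1 Y_left)
  have L0: "Y y j (Y e 0 v) = Y e 0 (Y y j v) - Y (Y e 0 y) j v" for j v
    using commutator_0[of e y j v] by simp
  have high: "Y y j (Y e 0 v) \<in> W" if v: "v \<in> sing_mod W" and "j \<ge> d + 1" for v j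
    unfolding L0 L
    by (intro subspace_diff subspace_scale subW eW yv v sing_mod_Y1[OF W]) (use that in auto)
  have mid: "Y y d (Y e 0 v) - of_int d \<cdot> g v \<in> W" if v: "v \<in> sing_mod W" for v
  proof -
    have "Y y d (Y e 0 v) - of_int d \<cdot> g v = Y e 0 (Y y d v) - Y e 1 (Y y (d - 1) v - g v)
        + (Y y (d - 1) (Y e 1 v) - g (Y e 1 v)) + of_int d \<cdot> (Y y (d - 1) v - g v)"
      unfolding L0 L by (simp add: gY Y_right algebra_simps)
    also have "\<dots> \<in> W"
      by (intro subspace_diff subspace_add subspace_scale subW eW yv yg v sing_mod_Y1[OF W]) simp
    finally show ?thesis .
  qed
  have tail: "((-1) ^ i * (of_int r gchoose i)) \<cdot> (Y e (r - int i) (Y y (q + int i) v)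
        - ((-1) powi r) \<cdot> Y y (q + r - int i) (Y e (int i) v)) \<in> W"
    if v: "v \<in> sing_mod W" and "i \<ge> 2" "q \<ge> d" for v q i
  proof -
    have "Y e (int i) v \<in> W" using that by (simp add: sing_mod_def)
    moreover have "Y y (q + int i) v \<in> W" using that by (intro yv v) auto
    ultimately show ?thesis
      by (intro subspace_scale subW subspace_diff[OF subW eW subspace_scale[OF subW yW]])
  qed
  have 3: "Y (Y e r y) j v \<in> W" if v: "v \<in> sing_mod W" and j: "j \<ge> d + 1 - r" for v j
    unfolding iterate_formula
  proof (rule fsum_in_subspace[OF subW])
    fix i :: nat
    consider "i = 0" | "i = 1" | "i \<ge> 2" by linarith
    then show "((-1) ^ i * (of_int r gchoose i)) \<cdot> (Y e (r - int i) (Y y (j + int i) v)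
        - ((-1) powi r) \<cdot> Y y (j + r - int i) (Y e (int i) v)) \<in> W"
    proof cases
      case 1
      have "Y e r (Y y j v) \<in> W" "Y y (j + r) (Y e 0 v) \<in> W"
        using j r by (auto intro!: eW yv[OF v] high[OF v])
      then show ?thesis using subW 1 by (simp add: subspace_diff subspace_scale)
    next
      case 2
      have "Y e (r - 1) (Y y (j + 1) v) \<in> W" "Y y (j + r - 1) (Y e 1 v) \<in> W"
        using j r by (auto intro!: eW yv[OF v] yv[OF sing_mod_Y1[OF W v]])
      then show ?thesis using subW 2 by (simp add: subspace_diff subspace_scale subspace_neg)
    qed (use tail v j r in auto)
  qed
  have 4: "Y (Y e r y) (d + 1 - r - 1) v - ?g v \<in> W" if v: "v \<in> sing_mod W" for v
  proof -
    let ?q = "d - r"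
    let ?f = "\<lambda>i. ((-1) ^ i * (of_int r gchoose i)) \<cdot> (Y e (r - int i) (Y y (?q + int i) v)
        - ((-1) powi r) \<cdot> Y y (?q + r - int i) (Y e (int i) v))"
    obtain N1 where N1: "\<And>n. n \<ge> N1 \<Longrightarrow> Y y n v = 0" using truncation by blast
    obtain N2 where N2: "\<And>n. n \<ge> N2 \<Longrightarrow> Y e n v = 0" using truncation by blast
    have "fsum ?f - (?f 0 + ?f 1) \<in> W"
    proof (rule fsum_two_heads[OF subW, of ?f "nat (max (N1 - ?q) N2)"])
      fix i assume "i \<ge> nat (max (N1 - ?q) N2)"
      then show "?f i = 0" by (simp add: N1 N2 Y_right)
    next
      fix i :: nat assume "i \<ge> 2"
      then show "?f i \<in> W" using r by (intro tail v) auto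
    qed
    moreover have "?f 0 + ?f 1 - ?g v \<in> W"
    proof -
      have p: "(-1) powi (r + 1) = - ((-1 :: complex) powi r)" by (simp add: power_int_add)
      have "?f 0 + ?f 1 - ?g v = Y e r (Y y (d - r) v)
          - ((-1) powi r) \<cdot> (Y y d (Y e 0 v) - of_int d \<cdot> g v)
          - of_int r \<cdot> Y e (r - 1) (Y y (d - r + 1) v)
          + (of_int r * (-1) powi r) \<cdot> (Y y (d - 1) (Y e 1 v) - g (Y e 1 v))"
        unfolding p by (simp add: algebra_simps)
      also have "\<dots> \<in> W" using r
        by (intro subspace_diff subspace_add subspace_scale subW eW yv yg mid v sing_mod_Y1[OF W]) auto
      finally show ?thesis .
    qed
    moreover have "Y (Y e r y) (d + 1 - r - 1) v = fsum ?f"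
      by (subst iterate_formula) simp
    ultimately show ?thesis
      using subspace_add[OF subW, of "fsum ?f - (?f 0 + ?f 1)" "?f 0 + ?f 1 - ?g v"] by simp
  qed
  have 5: "?g (Y e 1 v) = Y e 1 (?g v)" for v by (simp add: Y_right gY)
  show ?thesis unfolding zero_mode_def using 1 2 3 4 5 by blast
qed

text \<open>The polynomial is \<open>2x(16x - 1)(2x - 1)\<close>.\<close>

lemma zhu_relation:
  assumes W: "stable {e} W" and v: "v \<in> sing_mod W"
  shows "64 \<cdot> Y e 1 (Y e 1 (Y e 1 v)) - 36 \<cdot> Y e 1 (Y e 1 v) + 2 \<cdot> Y e 1 v \<in> W"
proof -
  have subW: "subspace W" using W by (simp add: stable_def)
  note step = zero_mode_step[OF W]
  have z0: "zero_mode W 0 (\<lambda>v. v) \<Omega>" by (rule zero_mode_vacuum[OF subW])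
  have z1: "zero_mode W 2 (\<lambda>v. Y e 1 v) (Y e (-1) \<Omega>)"
    using step[OF z0, of "-1"] by simp
  have z2: "zero_mode W 4 (\<lambda>v. 2 \<cdot> Y e 1 v + Y e 1 (Y e 1 v)) (Y e (-1) (Y e (-1) \<Omega>))"
    using step[OF z1, of "-1"] by (simp add: Y_right)
  have z3: "zero_mode W 6 (\<lambda>v. 8 \<cdot> Y e 1 v + 6 \<cdot> Y e 1 (Y e 1 v) + Y e 1 (Y e 1 (Y e 1 v)))
      (Y e (-1) (Y e (-1) (Y e (-1) \<Omega>)))"
  proof -
    have *: "8 \<cdot> a + 6 \<cdot> b + c = 4 \<cdot> (2 \<cdot> a + b) + (2 \<cdot> b + c)" for a b c
      by (simp add: scale_right_distrib flip: scale_left_distrib add.assoc)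
    have minus: "x - (- p - q) = x + (p + q)" for x p q :: 'v by simp
    show ?thesis
      unfolding * using step[OF z2, of "-1"] by (simp add: minus Y_right scale_right_distrib)
  qed
  have z4: "zero_mode W 3 (\<lambda>v. (-2) \<cdot> Y e 1 v) (Y e (-2) \<Omega>)"
    using step[OF z0, of "-2"] by simp
  have z5: "zero_mode W 6 (\<lambda>v. 6 \<cdot> Y e 1 v + 4 \<cdot> Y e 1 (Y e 1 v)) (Y e (-2) (Y e (-2) \<Omega>))"
    using step[OF z4, of "-2"] by (simp add: Y_right scale_right_distrib add.commute)
  have z6: "zero_mode W 6 (\<lambda>v. 2 \<cdot> Y e 1 v + 3 \<cdot> Y e 1 (Y e 1 v)) (Y e (-3) (Y e (-1) \<Omega>))"
    using step[OF z1, of "-3"] by (simp add: Y_right)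
  have z7: "zero_mode W 6 (\<lambda>v. 5 \<cdot> Y e 1 v) (Y e (-5) \<Omega>)"
    using step[OF z0, of "-5"] by simp
  \<comment> \<open>Each monomial of \<open>null6\<close> has weight 6, so its zero mode has index
    5.\<close>
  let ?a = "Y (Y e (-1) (Y e (-1) (Y e (-1) \<Omega>))) 5 v" and ?b = "Y (Y e (-2) (Y e (-2) \<Omega>)) 5 v"
    and ?c = "Y (Y e (-3) (Y e (-1) \<Omega>)) 5 v" and ?d = "Y (Y e (-5) \<Omega>) 5 v"
  let ?x = "Y e 1 v" and ?y = "Y e 1 (Y e 1 v)" and ?z = "Y e 1 (Y e 1 (Y e 1 v))"
  have m: "?a - (8 \<cdot> ?x + 6 \<cdot> ?y + ?z) \<in> W" "?b - (6 \<cdot> ?x + 4 \<cdot> ?y) \<in> W"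
    "?c - (2 \<cdot> ?x + 3 \<cdot> ?y) \<in> W" "?d - 5 \<cdot> ?x \<in> W"
    using z3 z5 z6 z7 v by (auto simp: zero_mode_def)
  have "64 \<cdot> ?a + 93 \<cdot> ?b - 264 \<cdot> ?c - 108 \<cdot> ?d = Y null6 5 v"
    by (simp add: null6_def Y_left)
  also have "\<dots> = 0" by (simp add: null6_eq_0 Y_left)
  finally have 0: "64 \<cdot> ?a + 93 \<cdot> ?b - 264 \<cdot> ?c - 108 \<cdot> ?d = 0" .
  have "64 \<cdot> (?a - (8 \<cdot> ?x + 6 \<cdot> ?y + ?z)) + 93 \<cdot> (?b - (6 \<cdot> ?x + 4 \<cdot> ?y))
      - 264 \<cdot> (?c - (2 \<cdot> ?x + 3 \<cdot> ?y)) - 108 \<cdot> (?d - 5 \<cdot> ?x)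
    = (64 \<cdot> ?a + 93 \<cdot> ?b - 264 \<cdot> ?c - 108 \<cdot> ?d)
      - (64 \<cdot> ?z + (64 * 6 + 93 * 4 - 264 * 3) \<cdot> ?y + (64 * 8 + 93 * 6 - 264 * 2 - 108 * 5) \<cdot> ?x)"
    by (simp only: scale_scale algebra_simps)
  also have "\<dots> = - (64 \<cdot> ?z - 36 \<cdot> ?y + 2 \<cdot> ?x)"
    unfolding 0 by simp
  finally have "- (64 \<cdot> ?z - 36 \<cdot> ?y + 2 \<cdot> ?x) \<in> W"
    using m by (metis (no_types, lifting) subW subspace_add subspace_diff subspace_scale)
  then have "- (- (64 \<cdot> ?z - 36 \<cdot> ?y + 2 \<cdot> ?x)) \<in> W" by (rule subspace_neg[OF subW])
  then show ?thesis by (simp only: minus_minus)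
qed

subsection \<open>Complete reducibility\<close>

lemma hwv_weight:
  assumes "hwv e h w" "w \<noteq> 0"
  shows "h \<in> ising_weights"
proof -
  have w: "Y e 1 w = h \<cdot> w" "\<And>m. m \<ge> 2 \<Longrightarrow> Y e m w = 0" using assms by (auto simp: hwv_def)
  have "stable {e} {0}" by (simp add: stable_def Y_right)
  then have "64 \<cdot> Y e 1 (Y e 1 (Y e 1 w)) - 36 \<cdot> Y e 1 (Y e 1 w) + 2 \<cdot> Y e 1 w \<in> {0}"
    by (rule zhu_relation) (simp add: sing_mod_def w)
  then have "(64 * h * h * h - 36 * h * h + 2 * h) \<cdot> w = 0"
    by (simp add: w Y_right scale_left_distrib scale_left_diff_distrib mult.assoc)
  then have "64 * h * h * h - 36 * h * h + 2 * h = 0" using assms by simp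
  then have "2 * h * (16 * h - 1) * (2 * h - 1) = 0" by (simp add: algebra_simps)
  then have "h = 0 \<or> 16 * h = 1 \<or> 2 * h = 1" by auto
  then show ?thesis by (auto simp: ising_weights_def field_simps)
qed

definition gen_hw :: "'v set \<Rightarrow> 'v set" where
  "gen_hw U = span {x. \<exists>w\<in>U. \<exists>h\<in>ising_weights. hwv e h w \<and> (\<exists>k. desc w k x)}"

lemma hw_module_subset_gen_hw: "w \<in> U \<Longrightarrow> h \<in> ising_weights \<Longrightarrow> hwv e h w \<Longrightarrow> hw_module w \<subseteq> gen_hw U"
  unfolding hw_module_def gen_hw_def by (rule span_mono) blast

lemma stable_gen_hw: "stable {e} (gen_hw U)"
proof -
  have "Y e m x \<in> gen_hw U" if x: "x \<in> gen_hw U" for m x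
    using x unfolding gen_hw_def
  proof (rule linear_span_image[OF linear_Y subspace_span])
    fix y assume "y \<in> {x. \<exists>w\<in>U. \<exists>h\<in>ising_weights. hwv e h w \<and> (\<exists>k. desc w k x)}"
    then obtain w h k where w: "w \<in> U" "h \<in> ising_weights" "hwv e h w" "desc w k y" by blast
    then have "y \<in> hw_module w" unfolding hw_module_def by (intro span_base) blast
    then have "Y e m y \<in> hw_module w" using stable_hw_module[OF w(3)] by (simp add: stable_def)
    then show "Y e m y \<in> span {x. \<exists>w\<in>U. \<exists>h\<in>ising_weights. hwv e h w \<and> (\<exists>k. desc w k x)}"
      using hw_module_subset_gen_hw[OF w(1-3)] by (auto simp: gen_hw_def)
  qed
  then show ?thesis by (auto simp: stable_def gen_hw_def)
qed

lemma gen_hw_weights: "gen_hw U \<subseteq> eig e (\<Union>h\<in>ising_weights. range (\<lambda>k. h + of_nat k))"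
  unfolding gen_hw_def
  by (intro span_minimal subspace_eig) (auto simp: hwv_def dest!: desc_weight intro!: eigI)

text \<open>The real part of h + 1 - m is at most -1/2, whereas the weights occurring in
  \<open>gen_hw U\<close> have nonnegative real part.\<close>

lemma gen_hw_no_low_weight:
  assumes "x \<in> gen_hw U" "Y e 1 x = (h + 1 - of_int m) \<cdot> x" "h \<in> ising_weights" "m \<ge> 2"
  shows "x = 0"
proof (rule eig_disjoint)
  show "x \<in> eig e (\<Union>h\<in>ising_weights. range (\<lambda>k. h + of_nat k))" using assms gen_hw_weights by blast
  show "x \<in> eig e {h + 1 - of_int m}" using assms by (intro eigI) auto
  have "h' + of_nat k \<noteq> h + 1 - of_int m" if "h' \<in> ising_weights" for h' k
  proof -
    have "Re h' \<ge> 0" using that unfolding ising_weights_def by (elim insertE emptyE; hypsubst; simp)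
    moreover have "Re h \<le> 1/2"
      using assms(3) unfolding ising_weights_def by (elim insertE emptyE; hypsubst; simp)
    moreover have "real_of_int m \<ge> 2" using assms by linarith
    ultimately have "Re h' + real k \<noteq> Re h + 1 - real_of_int m" by linarith
    then have "Re (h' + of_nat k) \<noteq> Re (h + 1 - of_int m)" by simp
    then show ?thesis by metis
  qed
  then show "(\<Union>h\<in>ising_weights. range (\<lambda>k. h + of_nat k)) \<inter> {h + 1 - of_int m} = {}" by blast
qed

text \<open>On a space spanned by eigenvectors, kernel and image of \<open>Y e 1 - h\<close>
  together span: a component of eigenvalue \<mu> \<noteq> h is divided by \<mu> - h, one of
  eigenvalue \<open>h\<close> is kept.\<close>

lemma gen_hw_adjust:
  assumes "t \<in> gen_hw U"
  shows "\<exists>y\<in>gen_hw U. Y e 1 (t - (Y e 1 y - h \<cdot> y)) = h \<cdot> (t - (Y e 1 y - h \<cdot> y))"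
  using assms unfolding gen_hw_def
proof (induction rule: span_induct_alt)
  case base
  show ?case by (rule bexI[of _ 0]) (auto simp: Y_right span_zero)
next
  case (step c b t)
  let ?W = "span {x. \<exists>w\<in>U. \<exists>h\<in>ising_weights. hwv e h w \<and> (\<exists>k. desc w k x)}"
  obtain y where y: "y \<in> ?W" "Y e 1 (t - (Y e 1 y - h \<cdot> y)) = h \<cdot> (t - (Y e 1 y - h \<cdot> y))"
    using step by blast
  have b: "b \<in> ?W" using step by (intro span_base)
  obtain \<mu> where \<mu>: "Y e 1 b = \<mu> \<cdot> b"
    using step(1) desc_weight unfolding hwv_def by blast
  define y' where "y' = (if \<mu> = h then 0 else (c / (\<mu> - h)) \<cdot> b)"
  define d where "d = (if \<mu> = h then c else 0)"
  have "y' \<in> ?W" using b by (auto simp: y'_def span_zero span_scale)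
  moreover have "Y e 1 y' - h \<cdot> y' = (c - d) \<cdot> b"
  proof (cases "\<mu> = h")
    case False
    then have "c / (\<mu> - h) * \<mu> - h * (c / (\<mu> - h)) = c"
      by (simp add: divide_simps) (simp add: algebra_simps)
    then show ?thesis
      using False by (simp add: y'_def d_def \<mu> Y_right flip: scale_left_diff_distrib)
  qed (simp add: y'_def d_def Y_right)
  moreover have "Y e 1 (d \<cdot> b) = h \<cdot> d \<cdot> b" by (simp add: d_def \<mu> Y_right mult.commute)
  moreover have "c \<cdot> b + t - (Y e 1 (y' + y) - h \<cdot> (y' + y))
      = c \<cdot> b - (Y e 1 y' - h \<cdot> y') + (t - (Y e 1 y - h \<cdot> y))"
    by (simp add: Y_right scale_right_distrib)
  ultimately have "c \<cdot> b + t - (Y e 1 (y' + y) - h \<cdot> (y' + y)) = d \<cdot> b + (t - (Y e 1 y - h \<cdot> y))"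
    by (simp add: scale_left_diff_distrib)
  then have "Y e 1 (c \<cdot> b + t - (Y e 1 (y' + y) - h \<cdot> (y' + y)))
      = h \<cdot> (c \<cdot> b + t - (Y e 1 (y' + y) - h \<cdot> (y' + y)))"
    using y(2) \<open>Y e 1 (d \<cdot> b) = h \<cdot> d \<cdot> b\<close> by (simp only: Y_right(1) scale_right_distrib)
  then show ?case using y(1) \<open>y' \<in> ?W\<close> by (intro bexI[of _ "y' + y"] span_add)
qed

text \<open>Extensions by \<open>gen_hw U\<close> split. A correction \<open>y\<close> from
  \<open>gen_hw U\<close> makes the defect \<open>z\<close> of the eigenvalue equation an
  eigenvector for \<open>h\<close>. Positive modes of the corrected vector \<open>x'\<close> then
  have a weight too low for \<open>gen_hw U\<close>, so \<open>x'\<close> is truly singular, and a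
  Jordan block at \<open>h\<close> would contradict the simplicity of the roots of Zhu's polynomial.
  Thus \<open>x'\<close> is a highest weight vector of \<open>U\<close>.\<close>

lemma gen_hw_absorbs:
  assumes U: "stable {e} U" and x: "x \<in> U" "x \<in> sing_mod (gen_hw U)"
    and h: "h \<in> ising_weights" "Y e 1 x - h \<cdot> x \<in> gen_hw U"
  shows "x \<in> gen_hw U"
proof -
  let ?W = "gen_hw U"
  have W: "stable {e} ?W" "subspace ?W" "?W \<subseteq> U"
  proof -
    show "stable {e} ?W" by (rule stable_gen_hw)
    then show "subspace ?W" by (simp add: stable_def)
    have "x \<in> U" if w: "w \<in> U" "desc w k x" for w k x
    proof -
      have "x \<in> hw_module w" unfolding hw_module_def by (rule span_base) (use w(2) in blast)
      then show ?thesis using hw_module_minimal[OF U w(1)] by blast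
    qed
    then show "?W \<subseteq> U" unfolding gen_hw_def using U by (intro span_minimal) (auto simp: stable_def)
  qed
  obtain y where y: "y \<in> ?W"
    "Y e 1 (Y e 1 x - h \<cdot> x - (Y e 1 y - h \<cdot> y)) = h \<cdot> (Y e 1 x - h \<cdot> x - (Y e 1 y - h \<cdot> y))"
    using gen_hw_adjust[OF h(2)] by blast
  define x' where "x' = x - y"
  define z where "z = Y e 1 x' - h \<cdot> x'"
  have z_eq: "z = Y e 1 x - h \<cdot> x - (Y e 1 y - h \<cdot> y)"
    by (simp add: z_def x'_def Y_right scale_right_diff_distrib)
  have z: "Y e 1 z = h \<cdot> z" unfolding z_eq by (rule y)
  have "z \<in> ?W" unfolding z_eq using h y W by (auto simp: stable_def intro!: subspace_diff subspace_scale)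
  have x'1: "Y e 1 x' = h \<cdot> x' + z" by (simp add: z_def)
  \<comment> \<open>First \<open>Y e m z\<close> is shown to vanish, since only then is
    \<open>Y e m x'\<close> an eigenvector and the bound on weights applicable.\<close>
  have kill: "Y e m x' = 0" if m: "m \<ge> 2" for m
  proof -
    have "Y e m z = 0"
      using m h(1) Y1_commute[OF z] W(1) \<open>z \<in> ?W\<close>
      by (intro gen_hw_no_low_weight[of _ U h m]) (auto simp: stable_def)
    have "Y e m x' \<in> ?W"
      using x(2) y(1) m W by (auto simp: x'_def Y_right sing_mod_def stable_def intro!: subspace_diff)
    moreover have "Y e 1 (Y e m x') = (h + 1 - of_int m) \<cdot> Y e m x'"
    proof -
      have "Y e 1 (Y e m x') = Y e m (Y e 1 x') + of_int (1 - m) \<cdot> Y e m x'"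
        using virasoro[of 1 m x'] m by simp
      also have "\<dots> = (h + of_int (1 - m)) \<cdot> Y e m x'"
        unfolding x'1 by (simp only: Y_right \<open>Y e m z = 0\<close> scale_left_distrib add_0_right)
      finally show ?thesis by (simp add: algebra_simps)
    qed
    ultimately show ?thesis using m h(1) by (intro gen_hw_no_low_weight[of _ U h m])
  qed
  have "z = 0"
  proof -
    have "stable {e} {0}" by (simp add: stable_def Y_right)
    then have "64 \<cdot> Y e 1 (Y e 1 (Y e 1 x')) - 36 \<cdot> Y e 1 (Y e 1 x') + 2 \<cdot> Y e 1 x' \<in> {0}"
      by (rule zhu_relation) (simp add: sing_mod_def kill)
    then have "64 \<cdot> Y e 1 (Y e 1 (Y e 1 x')) - 36 \<cdot> Y e 1 (Y e 1 x') + 2 \<cdot> Y e 1 x' = 0"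
      by simp
    \<comment> \<open>Taylor expansion on a Jordan block: a polynomial \<open>p\<close> acts as
      \<open>p(h) x' + p'(h) z\<close>, here with \<open>p'(h)\<close> nonzero.\<close>
    moreover have "64 \<cdot> Y e 1 (Y e 1 (Y e 1 x')) - 36 \<cdot> Y e 1 (Y e 1 x') + 2 \<cdot> Y e 1 x'
      = (64 * h * h * h - 36 * h * h + 2 * h) \<cdot> x' + (192 * h * h - 72 * h + 2) \<cdot> z"
    proof -
      have "Y e 1 (Y e 1 x') = (h * h) \<cdot> x' + (2 * h) \<cdot> z"
        by (simp add: x'1 z Y_right scale_right_distrib add.assoc flip: scale_left_distrib)
      moreover from this have "Y e 1 (Y e 1 (Y e 1 x')) = (h * h * h) \<cdot> x' + (3 * h * h) \<cdot> z"
        by (simp add: x'1 z Y_right scale_right_distrib add.assoc flip: scale_left_distrib)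
      moreover have "64 \<cdot> ((h * h * h) \<cdot> x' + (3 * h * h) \<cdot> z) - 36 \<cdot> ((h * h) \<cdot> x' + (2 * h) \<cdot> z)
          + 2 \<cdot> (h \<cdot> x' + z) = (64 * h * h * h - 36 * h * h + 2 * h) \<cdot> x' + (192 * h * h - 72 * h + 2) \<cdot> z"
        by (simp add: scale_right_distrib scale_left_distrib scale_left_diff_distrib mult.assoc)
      ultimately show ?thesis by (simp add: x'1)
    qed
    moreover have "64 * h * h * h - 36 * h * h + 2 * h = 0" "192 * h * h - 72 * h + 2 \<noteq> 0"
      using h(1) unfolding ising_weights_def by (elim insertE emptyE; hypsubst; simp)+
    ultimately show ?thesis by simp
  qed
  have "hwv e h x'" using x'1 kill \<open>z = 0\<close> by (simp add: hwv_def)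
  moreover have "x' \<in> U" using x y W U unfolding x'_def by (auto simp: stable_def intro!: subspace_diff)
  ultimately have "x' \<in> ?W" using hw_module_subset_gen_hw[of x' U h] h(1) hw_module_self by blast
  then have "x' + y \<in> ?W" using y(1) W(2) by (intro subspace_add)
  then show ?thesis by (simp add: x'_def)
qed

text \<open>Induction along the weight filtration: positive modes lead one step down, so modulo
  \<open>gen_hw U\<close> the vectors of the next step are singular. Interpolation cuts such a
  vector into three, one for each Ising weight, and each is absorbed.\<close>

theorem complete_reducibility:
  assumes U: "stable {e} U" and v: "v \<in> U"
  shows "v \<in> gen_hw U"
proof -
  let ?W = "gen_hw U"
  have W: "stable {e} ?W" by (rule stable_gen_hw)
  then have subW: "subspace ?W" by (simp add: stable_def)
  have subU: "subspace U" and eU: "\<And>m x. x \<in> U \<Longrightarrow> Y e m x \<in> U" using U by (auto simp: stable_def)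
  obtain N where N: "filtration N = {0}" by (rule filtration_trivial)
  have "U \<inter> filtration (N + int k) \<subseteq> ?W" for k
  proof (induction k)
    case 0
    then show ?case using N subspace_0[OF subW] by auto
  next
    case (Suc k)
    let ?F = "U \<inter> filtration (N + int (Suc k))"
    have subF: "subspace ?F" using subU by (simp add: filtration_def subspace_inter)
    have sing: "x \<in> sing_mod ?W" if "x \<in> ?F" for x
      unfolding sing_mod_def
    proof (intro CollectI allI impI)
      fix m :: int assume "m \<ge> 2"
      then have "Y e m x \<in> filtration (N + int k)"
        using that filtration_mode[of x "N + int (Suc k)" m] filtration_mono[of "N + int (Suc k) + 1 - m" "N + int k"]
        by auto
      then show "Y e m x \<in> ?W" using Suc eU that by blast
    qed
    have F1: "Y e 1 x \<in> ?F" if "x \<in> ?F" for x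
      using that eU filtration_mode[of x "N + int (Suc k)" 1] by (simp add: algebra_simps)
    show ?case
    proof
      fix v assume v: "v \<in> ?F"
      define T where "T = Y e 1"
      have T: "T (x + y) = T x + T y" "T (x - y) = T x - T y" "T (c \<cdot> x) = c \<cdot> T x" for x y c
        by (simp_all add: T_def Y_right)
      have TF: "T x \<in> ?F" if "x \<in> ?F" for x using F1[OF that] by (simp add: T_def)
      have zhu: "64 \<cdot> T (T (T v)) - 36 \<cdot> T (T v) + 2 \<cdot> T v \<in> ?W"
        unfolding T_def by (rule zhu_relation[OF W sing[OF v]])
      \<comment> \<open>Lagrange interpolation at the three roots of Zhu's polynomial\<close>
      define a where "a = 32 \<cdot> T (T v) - 18 \<cdot> T v + v"
      define b where "b = (32/7) \<cdot> T (T v) - (2/7) \<cdot> T v"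
      define c where "c = (- 256/7) \<cdot> T (T v) + (128/7) \<cdot> T v"
      have F: "a \<in> ?F" "b \<in> ?F" "c \<in> ?F"
        unfolding a_def b_def c_def
        by (intro subspace_add subspace_diff subspace_scale subF TF v)+
      have "a + b + c = (32 + 32/7 + (- 256/7)) \<cdot> T (T v) + (- 18 - 2/7 + 128/7) \<cdot> T v + v"
        unfolding a_def b_def c_def by (simp only: scale_left_distrib scale_left_diff_distrib scale_minus_left) simp
      then have sum: "v = a + b + c" by simp
      let ?z = "64 \<cdot> T (T (T v)) - 36 \<cdot> T (T v) + 2 \<cdot> T v"
      have "T a - 0 \<cdot> a = (1/2) \<cdot> ?z"
        by (simp add: a_def T scale_right_distrib scale_right_diff_distrib)
      moreover have "(18/7) \<cdot> q = (2/7) \<cdot> q + (16/7) \<cdot> q" for q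
        by (simp flip: scale_left_distrib)
      then have "T b - (1/2) \<cdot> b = (1/14) \<cdot> ?z"
        by (simp add: b_def T scale_right_distrib scale_right_diff_distrib)
      moreover have "(144/7) \<cdot> q = (128/7) \<cdot> q + (16/7) \<cdot> q" for q
        by (simp flip: scale_left_distrib)
      then have "T c - (1/16) \<cdot> c = (- 4/7) \<cdot> ?z"
        by (simp add: c_def T scale_right_distrib scale_right_diff_distrib)
      ultimately have "T a - 0 \<cdot> a \<in> ?W" "T b - (1/2) \<cdot> b \<in> ?W" "T c - (1/16) \<cdot> c \<in> ?W"
        using subspace_scale[OF subW zhu] by metis+
      then have "a \<in> ?W" "b \<in> ?W" "c \<in> ?W"
        using F sing gen_hw_absorbs[OF U] unfolding T_def ising_weights_def by blast+
      then show "v \<in> ?W" unfolding sum by (intro subspace_add subW)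
    qed
  qed
  moreover obtain k where "v \<in> filtration k" by (rule in_filtration)
  moreover have "filtration k \<subseteq> filtration (N + int (nat (k - N)))" by (rule filtration_mono) simp
  ultimately show ?thesis using v by blast
qed

subsection \<open>The isotypic components\<close>

lemma stable_UNIV: "stable {e} UNIV"
  by (simp add: stable_def)

lemma eig_nonneg_UNIV: "eig e (\<Union>h\<in>ising_weights. range (\<lambda>k. h + of_nat k)) = UNIV"
  using complete_reducibility[OF stable_UNIV] gen_hw_weights[of UNIV] by blast

lemma stable_eig_class: "stable {e} (eig e (weight_class h))"
proof -
  have "Y e m x \<in> eig e (weight_class h)" if "x \<in> eig e (weight_class h)" for m x
    using that unfolding eig_def[of e "weight_class h"]
  proof (rule linear_span_image[OF linear_Y subspace_span])
    fix y assume "y \<in> (\<Union>\<mu>\<in>weight_class h. {x. Y e 1 x = \<mu> \<cdot> x})"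
    then obtain k :: int where "Y e 1 y = (h + of_int k) \<cdot> y" by (auto simp: weight_class_def)
    from Y1_commute[OF this] have "Y e 1 (Y e m y) = (h + of_int (k + 1 - m)) \<cdot> Y e m y"
      by (simp add: algebra_simps)
    then have "Y e m y \<in> eig e (weight_class h)" by (rule eigI) (rule shift_in_weight_class)
    then show "Y e m y \<in> span (\<Union>\<mu>\<in>weight_class h. {x. Y e 1 x = \<mu> \<cdot> x})" by (simp add: eig_def)
  qed
  then show ?thesis by (simp add: stable_def subspace_eig)
qed

lemma desc_0: "desc 0 k x \<Longrightarrow> x = 0"
  by (induction rule: desc.induct) (auto simp: Y_right)

lemma stable_nonzero_hwv:
  assumes "stable {e} U" "U \<noteq> {0}"
  obtains w h where "w \<in> U" "w \<noteq> 0" "h \<in> ising_weights" "hwv e h w"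
proof (rule ccontr)
  assume "\<not> thesis"
  then have *: "\<And>w h. w \<in> U \<Longrightarrow> h \<in> ising_weights \<Longrightarrow> hwv e h w \<Longrightarrow> w = 0" using that by blast
  have "gen_hw U \<subseteq> {0}"
    unfolding gen_hw_def using * desc_0 by (intro span_minimal) auto
  then have "U \<subseteq> {0}" using complete_reducibility[OF assms(1)] by blast
  then show False using assms by (auto simp: stable_def dest: subspace_0)
qed

text \<open>Descendants of positive depth have weight h + k with k > 0, so only multiples of
  \<open>w\<close> remain at weight \<open>h\<close>.\<close>

lemma hw_module_top:
  assumes w: "hwv e h w" and x: "x \<in> hw_module w" "Y e 1 x = h \<cdot> x"
  obtains c where "x = c \<cdot> w"
proof -
  let ?A = "range (\<lambda>k. h + of_nat (Suc k))"
  have "\<exists>c. x - c \<cdot> w \<in> eig e ?A"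
    using x(1) unfolding hw_module_def
  proof (induction rule: span_induct_alt)
    case base
    show ?case by (rule exI[of _ 0]) (simp add: subspace_0 subspace_eig)
  next
    case (step c y z)
    then obtain d where d: "z - d \<cdot> w \<in> eig e ?A" by blast
    obtain k where k: "desc w k y" using step by blast
    show ?case
    proof (cases "k = 0")
      case True
      have "y = w" using k True by (auto elim: desc.cases)
      then have "c \<cdot> y + z - (c + d) \<cdot> w = z - d \<cdot> w" by (simp add: scale_left_distrib)
      then show ?thesis using d by metis
    next
      case False
      have "Y e 1 y = (h + of_nat k) \<cdot> y" using desc_weight[OF k] w by (simp add: hwv_def)
      then have "y \<in> eig e ?A" using False by (intro eigI) (auto intro!: range_eqI[of _ _ "k - 1"])
      then have "c \<cdot> y + (z - d \<cdot> w) \<in> eig e ?A"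
        using d by (intro subspace_add subspace_scale subspace_eig)
      then show ?thesis by (auto simp: algebra_simps intro!: exI[of _ d])
    qed
  qed
  then obtain c where c: "x - c \<cdot> w \<in> eig e ?A" by blast
  have "Y e 1 (x - c \<cdot> w) = h \<cdot> (x - c \<cdot> w)"
    using w x by (simp add: hwv_def Y_right scale_right_diff_distrib mult.commute)
  then have "x - c \<cdot> w \<in> eig e {h}" by (rule eigI) simp
  moreover have "?A \<inter> {h} = {}"
    using of_nat_neq_0[where 'a = complex] by auto
  ultimately have "x - c \<cdot> w = 0" using c eig_disjoint by metis
  then show thesis using that[of c] by simp
qed

text \<open>A nonzero submodule contains a highest weight vector. Its Ising weight is congruent to
  \<open>h\<close> modulo the integers, hence equal to \<open>h\<close>, so it is a multiple of
  \<open>w\<close>.\<close>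

lemma hw_module_irreducible:
  assumes w: "hwv e h w" "w \<noteq> 0"
  shows "irr_submod V (Vir V e) (hw_module w)"
  unfolding irr_submod_def
proof (intro conjI allI impI)
  show "submod V (Vir V e) (hw_module w)"
    using stable_hw_module[OF w(1)] by (simp add: stable_iff_submod Vir_def)
  show "hw_module w \<noteq> {0}" using w hw_module_self by blast
  fix M assume "submod V (Vir V e) M \<and> M \<subseteq> hw_module w"
  then have M: "stable {e} M" "M \<subseteq> hw_module w" by (auto simp: stable_iff_submod Vir_def)
  show "M = {0} \<or> M = hw_module w"
  proof (cases "M = {0}")
    case False
    obtain w' h' where w': "w' \<in> M" "w' \<noteq> 0" "h' \<in> ising_weights" "hwv e h' w'"
      using stable_nonzero_hwv[OF M(1) False] by blast
    have h: "h \<in> ising_weights" using hwv_weight w by blast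
    have "w' \<in> eig e (weight_class h)"
      using M w' hw_module_weights[of w h] w eig_mono[OF nat_shift_in_weight_class] unfolding hwv_def by blast
    moreover have "w' \<in> eig e {h'}" using w' by (intro eigI) (auto simp: hwv_def)
    ultimately have "weight_class h \<inter> {h'} \<noteq> {}" using eig_disjoint w' by metis
    then have "h' = h" using ising_weight_in_class[of h h'] h w' by blast
    then obtain c where "w' = c \<cdot> w" using hw_module_top[OF w(1), of w'] w' M by (auto simp: hwv_def)
    then have "w = (1/c) \<cdot> w'" using w' by auto
    then have "w \<in> M" using w' M by (auto simp: stable_def intro: subspace_scale)
    then show ?thesis using hw_module_minimal[OF M(1)] M by blast
  qed simp
qed

lemma eig_class_generated:
  assumes h: "h \<in> ising_weights" and x: "x \<in> eig e (weight_class h)"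
  shows "x \<in> span {x. \<exists>w k. hwv e h w \<and> desc w k x}"
proof -
  have "x \<in> gen_hw (eig e (weight_class h))"
    using complete_reducibility[OF stable_eig_class x] .
  also have "\<dots> \<subseteq> span {x. \<exists>w k. hwv e h w \<and> desc w k x}"
    unfolding gen_hw_def
  proof (intro span_mono subsetI CollectI)
    fix x assume "x \<in> {x. \<exists>w\<in>eig e (weight_class h). \<exists>h\<in>ising_weights. hwv e h w \<and> (\<exists>k. desc w k x)}"
    then obtain w h' k where w: "w \<in> eig e (weight_class h)" "h' \<in> ising_weights" "hwv e h' w" "desc w k x" by blast
    have "hwv e h w"
    proof (cases "w = 0")
      case True
      then show ?thesis by (simp add: hwv_def Y_right)
    next
      case False
      have "w \<in> eig e {h'}" using w by (intro eigI) (auto simp: hwv_def)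
      then have "weight_class h \<inter> {h'} \<noteq> {}" using eig_disjoint w False by metis
      then show ?thesis using ising_weight_in_class[of h h'] h w by auto
    qed
    then show "\<exists>w k. hwv e h w \<and> desc w k x" using w by blast
  qed
  finally show ?thesis .
qed

text \<open>The bridge from isotypic components, in terms of which the involutions are defined, to
  eigenvalues modulo the integers.\<close>

lemma Vh_eq_eig:
  assumes h: "h \<in> ising_weights"
  shows "Vh V e h = eig e (weight_class h)"
proof
  show "Vh V e h \<subseteq> eig e (weight_class h)"
    unfolding Vh_def vspan_def
  proof (intro span_minimal subspace_eig subsetI)
    fix x assume "x \<in> \<Union>{M. irr_submod V (Vir V e) M \<and> hw_type V {0} (\<lambda>_. e) (\<lambda>_. h) M}"
    then obtain M w where M: "irr_submod V (Vir V e) M" "x \<in> M" and w: "w \<in> M" "w \<noteq> 0"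
      "Y e 1 w = h \<cdot> w" "\<And>m. m > 0 \<Longrightarrow> Y e (m + 1) w = 0"
      by (auto simp: hw_type_def)
    have hw: "hwv e h w" unfolding hwv_def using w(3) w(4)[of "m - 1" for m] by auto
    have "stable {e} M" using M by (simp add: irr_submod_def stable_iff_submod Vir_def)
    then have "hw_module w \<subseteq> M" using w by (intro hw_module_minimal)
    moreover have "hw_module w \<noteq> {0}" using w hw_module_self by blast
    moreover have "submod V (Vir V e) (hw_module w)"
      using stable_hw_module[OF hw] by (simp add: stable_iff_submod Vir_def)
    ultimately have "M = hw_module w" using M by (auto simp: irr_submod_def)
    then show "x \<in> eig e (weight_class h)"
      using M(2) hw_module_weights[OF w(3)] eig_mono[OF nat_shift_in_weight_class] by blast
  qed
  show "eig e (weight_class h) \<subseteq> Vh V e h"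
  proof
    fix x assume "x \<in> eig e (weight_class h)"
    then have "x \<in> span {x. \<exists>w k. hwv e h w \<and> desc w k x}" by (rule eig_class_generated[OF h])
    also have "\<dots> \<subseteq> Vh V e h"
    proof (intro span_minimal subsetI)
      show "subspace (Vh V e h)" by (simp add: Vh_def vspan_def)
      fix x assume "x \<in> {x. \<exists>w k. hwv e h w \<and> desc w k x}"
      then obtain w k where w: "hwv e h w" "desc w k x" by blast
      show "x \<in> Vh V e h"
      proof (cases "w = 0")
        case True
        then have "x = 0" using w desc_0 by simp
        then show ?thesis by (simp add: Vh_def vspan_def span_zero)
      next
        case False
        have "x \<in> hw_module w" unfolding hw_module_def by (rule span_base) (use w in blast)
        moreover have "hw_type V {0} (\<lambda>_. e) (\<lambda>_. h) (hw_module w)"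
          unfolding hw_type_def using False hw_module_self[of w] w(1) by (auto simp: hwv_def)
        ultimately show ?thesis
          unfolding Vh_def vspan_def using hw_module_irreducible[OF w(1) False]
          by (intro span_base) blast
      qed
    qed
    finally show "x \<in> Vh V e h" .
  qed
qed

subsection \<open>Fusion rules\<close>

text \<open>\<open>L_{-1} u\<close> would be a highest weight vector of weight 1, which is not an
  Ising weight.\<close>

lemma hwv_null1:
  assumes u: "hwv e 0 u"
  shows "Y e 0 u = 0"
proof (rule ccontr)
  assume nz: "Y e 0 u \<noteq> 0"
  have u1: "Y e 1 u = 0" "Y e 2 u = 0" "Y e 3 u = 0" using u by (auto simp: hwv_def)
  have "hwv e 1 (Y e 0 u)"
    by (rule hwvI) (simp_all add: virasoro_sort u1 Y_right)
  then have "1 \<in> ising_weights" using nz hwv_weight by blast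
  then show False by (auto simp: ising_weights_def)
qed

text \<open>The difference of the two sides is singular of weight h + 2, not an Ising weight. The
  factor comes from \<open>L_1\<close>, which gives (4h+2) against 3; the condition from
  \<open>L_2\<close> is then (2h-1)(16h-1) = 0.\<close>

lemma hwv_null2:
  assumes u: "hwv e h u" and h: "h = 1/2 \<or> h = 1/16"
  shows "Y e 0 (Y e 0 u) = ((4 * h + 2) / 3) \<cdot> Y e (-1) u"
proof -
  define y where "y = Y e 0 (Y e 0 u) - ((4 * h + 2) / 3) \<cdot> Y e (-1) u"
  have u1: "Y e 1 u = h \<cdot> u" "Y e 2 u = 0" "Y e 3 u = 0" using u by (auto simp: hwv_def)
  have "hwv e (h + 2) y"
  proof (rule hwvI)
    have "Y e 1 (Y e 0 (Y e 0 u)) = (h + 2) \<cdot> Y e 0 (Y e 0 u)"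
      using Y1_commute[OF Y1_commute[OF u1(1)], of 0 0] by (simp add: algebra_simps)
    moreover have "Y e 1 (Y e (-1) u) = (h + 2) \<cdot> Y e (-1) u"
      using Y1_commute[OF u1(1), of "-1"] by (simp add: algebra_simps)
    ultimately show "Y e 1 y = (h + 2) \<cdot> y"
      by (simp add: y_def Y_right scale_right_diff_distrib mult.commute)
    have "Y e 1 (Y e 0 u) = (h + 1) \<cdot> Y e 0 u"
      using Y1_commute[OF u1(1), of 0] by simp
    then have "Y e 2 (Y e 0 (Y e 0 u)) = (2 * h) \<cdot> Y e 0 u + (2 * (h + 1)) \<cdot> Y e 0 u"
      using virasoro[of 2 0 "Y e 0 u"] virasoro[of 2 0 u] by (simp add: u1 Y_right)
    also have "\<dots> = (4 * h + 2) \<cdot> Y e 0 u"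
      unfolding scale_left_distrib[symmetric] by (simp add: algebra_simps)
    finally show "Y e 2 y = 0"
      using virasoro[of 2 "-1" u] by (simp add: y_def u1 Y_right)
    have "Y e 3 (Y e 0 (Y e 0 u)) = (6 * h) \<cdot> u"
      using virasoro[of 3 0 "Y e 0 u"] virasoro[of 3 0 u] virasoro[of 2 0 u] by (simp add: u1 Y_right)
    moreover have "Y e 3 (Y e (-1) u) = (4 * h + 1/4) \<cdot> u"
      using virasoro[of 3 "-1" u] by (simp add: u1 Y_right scale_left_distrib)
    ultimately have "Y e 3 y = (6 * h - (4 * h + 2) / 3 * (4 * h + 1/4)) \<cdot> u"
      by (simp add: y_def Y_right scale_left_diff_distrib)
    moreover have "6 * h - (4 * h + 2) / 3 * (4 * h + 1/4) = 0" using h by (elim disjE; hypsubst; simp)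
    ultimately show "Y e 3 y = 0" by simp
  qed
  moreover have "h + 2 \<notin> ising_weights"
  proof
    assume "h + 2 \<in> ising_weights"
    moreover have "h \<in> ising_weights" using h by (auto simp: ising_weights_def)
    ultimately have "h + 2 = h" using shift_in_weight_class[of h 2] by (intro ising_weight_in_class) auto
    then show False by simp
  qed
  ultimately have "y = 0" using hwv_weight by blast
  then show ?thesis by (simp add: y_def)
qed

text \<open>Modulo \<open>off c\<close> one computes as in the space of coinvariants: the raising modes of \<open>e\<close>
  vanish and its zero mode acts as \<open>c\<close>.\<close>

definition off :: "complex \<Rightarrow> 'v set" where "off c = eig e (- {c})"

lemma subspace_off: "subspace (off c)"
  by (simp add: off_def subspace_eig)

text \<open>After a raising mode all weights have real part at least 1, while \<open>c\<close> has
  real part at most 1/2.\<close>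

lemma raising_in_off:
  assumes c: "c \<in> ising_weights" and m: "m \<le> 0"
  shows "Y e m x \<in> off c"
proof (rule linear_span_image[OF linear_Y subspace_off, of x
      "\<Union>\<mu>\<in>(\<Union>h\<in>ising_weights. range (\<lambda>k. h + of_nat k)). {x. Y e 1 x = \<mu> \<cdot> x}"])
  show "x \<in> span (\<Union>\<mu>\<in>(\<Union>h\<in>ising_weights. range (\<lambda>k. h + of_nat k)). {x. Y e 1 x = \<mu> \<cdot> x})"
    using eig_nonneg_UNIV unfolding eig_def by blast
  fix y assume "y \<in> (\<Union>\<mu>\<in>(\<Union>h\<in>ising_weights. range (\<lambda>k. h + of_nat k)). {x. Y e 1 x = \<mu> \<cdot> x})"
  then obtain h and k :: nat where h: "h \<in> ising_weights" "Y e 1 y = (h + of_nat k) \<cdot> y" by blast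
  have r: "0 \<le> Re x \<and> Re x \<le> 1/2" if "x \<in> ising_weights" for x
    using that unfolding ising_weights_def by (elim insertE emptyE; hypsubst; simp)
  have "Re (h + of_nat k + 1 - of_int m) \<noteq> Re c"
    using r[OF h(1)] r[OF c] m by simp
  then have "h + of_nat k + 1 - of_int m \<noteq> c" by metis
  then show "Y e m y \<in> off c"
    unfolding off_def using Y1_commute[OF h(2)] by (intro eigI) auto
qed

lemma zero_mode_in_off: "Y e 1 x - c \<cdot> x \<in> off c"
proof -
  have lin: "Vector_Spaces.linear (smul V) (smul V) (\<lambda>x. Y e 1 x - c \<cdot> x)"
    by (intro Vector_Spaces.linear_iff[THEN iffD2] conjI vector_space_axioms)
       (auto simp: Y_right scale_right_distrib scale_right_diff_distrib mult.commute)
  show ?thesis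
  proof (rule linear_span_image[OF lin subspace_off, of x
        "\<Union>\<mu>\<in>(\<Union>h\<in>ising_weights. range (\<lambda>k. h + of_nat k)). {x. Y e 1 x = \<mu> \<cdot> x}"])
    show "x \<in> span (\<Union>\<mu>\<in>(\<Union>h\<in>ising_weights. range (\<lambda>k. h + of_nat k)). {x. Y e 1 x = \<mu> \<cdot> x})"
      using eig_nonneg_UNIV unfolding eig_def by blast
    fix y assume "y \<in> (\<Union>\<mu>\<in>(\<Union>h\<in>ising_weights. range (\<lambda>k. h + of_nat k)). {x. Y e 1 x = \<mu> \<cdot> x})"
    then obtain \<mu> where \<mu>: "Y e 1 y = \<mu> \<cdot> y" by blast
    show "Y e 1 y - c \<cdot> y \<in> off c"
    proof (cases "\<mu> = c")
      case True
      then show ?thesis by (simp add: \<mu> subspace_0 subspace_off)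
    next
      case False
      then have "y \<in> off c" unfolding off_def using \<mu> by (intro eigI) auto
      then have "(\<mu> - c) \<cdot> y \<in> off c" by (intro subspace_scale subspace_off)
      then show ?thesis by (simp add: \<mu> scale_left_diff_distrib)
    qed
  qed
qed

text \<open>Comparing \<open>Y e 1\<close> on the product with its value \<open>c\<close> determines
  the derivative: each \<open>L_{-1}\<close> on the left factor costs the scalar c - b -
  \<alpha>.\<close>

lemma fusion_L1:
  assumes "Y e 1 u = \<alpha> \<cdot> u" "Y e 1 v = b \<cdot> v"
  shows "Y (Y e 0 u) k v - (c - b - \<alpha>) \<cdot> Y u (k - 1) v \<in> off c"
proof -
  have "Y (Y e 0 u) k v - (c - b - \<alpha>) \<cdot> Y u (k - 1) v
      = Y e 1 (Y u (k - 1) v) - c \<cdot> Y u (k - 1) v"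
    using commutator_1[of e u "k - 1" v] assms
    by (simp add: Y_right Y_left scale_left_diff_distrib)
  then show ?thesis using zero_mode_in_off by simp
qed

lemma fusion_L0:
  assumes "Y e 1 u = \<alpha> \<cdot> u" "Y e 1 v = b \<cdot> v" and c: "c \<in> ising_weights"
  shows "Y u k (Y e 0 v) + (c - b - \<alpha>) \<cdot> Y u (k - 1) v \<in> off c"
proof -
  have "Y u k (Y e 0 v) + (c - b - \<alpha>) \<cdot> Y u (k - 1) v
      = Y e 0 (Y u k v) - (Y (Y e 0 u) k v - (c - b - \<alpha>) \<cdot> Y u (k - 1) v)"
    using commutator_0[of e u k v] by simp
  also have "\<dots> \<in> off c"
    by (rule subspace_diff[OF subspace_off raising_in_off[OF c] fusion_L1[OF assms(1,2)]]) simp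
  finally show ?thesis .
qed

text \<open>Both sides of the null vector equation for \<open>u\<close> are evaluated on
  \<open>v\<close> modulo \<open>off c\<close>. The left one gives (t-1)t with t = c - b - a, the
  right one the multiple (2b+a-c) of the same product. If the two scalars differ, the product itself
  lies in \<open>off c\<close>.\<close>

lemma fusion_hwv:
  assumes u: "hwv e a u" and v: "hwv e b v" and a: "a \<in> ising_weights" and c: "c \<in> ising_weights" "\<not> fuses a b c"
  shows "Y u k v \<in> off c"
proof -
  have u1: "Y e 1 u = a \<cdot> u" and v1: "Y e 1 v = b \<cdot> v" using u v by (auto simp: hwv_def)
  let ?x = "Y u k v"
  have scaled: "?x \<in> off c" if "t \<cdot> ?x \<in> off c" "t \<noteq> 0" for t
    using subspace_scale[OF subspace_off that(1), of "1/t"] that(2) by simp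
  show ?thesis
  proof (cases "a = 0")
    case True
    have "Y e 0 u = 0" using hwv_null1 u True by simp
    then have "(c - b) \<cdot> ?x \<in> off c"
      using fusion_L1[OF u1 v1, of "k + 1" c] subspace_neg[OF subspace_off] True
      by (fastforce simp: Y_left)
    then show ?thesis using scaled c True by (simp add: fuses_def)
  next
    case False
    then have null: "Y e 0 (Y e 0 u) = ((4 * a + 2) / 3) \<cdot> Y e (-1) u"
      using a hwv_null2[OF u] by (auto simp: ising_weights_def)
    have w: "Y e 1 (Y e 0 u) = (a + 1) \<cdot> Y e 0 u" using Y1_commute[OF u1, of 0] by simp
    let ?t = "c - b - a"
    have A: "Y (Y e 0 u) (k + 1) v - ?t \<cdot> ?x \<in> off c"
      using fusion_L1[OF u1 v1, of "k + 1" c] by simp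
    have B: "Y (Y e 0 (Y e 0 u)) (k + 2) v - (?t - 1) \<cdot> Y (Y e 0 u) (k + 1) v \<in> off c"
      using fusion_L1[OF w v1, of "k + 2" c] by (simp add: algebra_simps)
    \<comment> \<open>In the iterate formula the terms with \<open>e\<close> in front are raising.
      The term with \<open>Y e 0 v\<close> contributes -t by \<open>fusion_L0\<close> and the one
      with \<open>Y e 1 v\<close> contributes \<open>b\<close>, in total 2b + a - c.\<close>
    have C: "Y (Y e (-1) u) (k + 2) v - (2 * b + a - c) \<cdot> ?x \<in> off c"
    proof -
      let ?f = "\<lambda>i. ((-1) ^ i * (of_int (-1) gchoose i)) \<cdot>
         (Y e (-1 - int i) (Y u (k + 2 + int i) v)
          - ((-1) powi (-1)) \<cdot> Y u (k + 2 + -1 - int i) (Y e (int i) v))"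
      let ?g = "\<lambda>i. ((-1) ^ i * (of_int (-1) gchoose i)) \<cdot> Y u (k + 1 - int i) (Y e (int i) v)"
      have fg: "?f i = ((-1) ^ i * (of_int (-1) gchoose i)) \<cdot> Y e (-1 - int i) (Y u (k + 2 + int i) v) + ?g i" for i
        by (simp add: scale_right_distrib add.commute)
      have hi: "Y e (int i) v = 0" if "i \<ge> 2" for i using v that by (simp add: hwv_def)
      have f_in: "?f i \<in> off c" if "i \<ge> 2" for i
        unfolding fg using raising_in_off[OF c(1), of "-1 - int i"] that
        by (intro subspace_add subspace_off) (auto simp: hi Y_right subspace_0 subspace_off intro!: subspace_scale subspace_off)
      obtain N where N: "\<And>n. n \<ge> N \<Longrightarrow> Y u n v = 0" using truncation by blast
      have s1: "fsum ?f - (?f 0 + ?f 1) \<in> off c"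
      proof (rule fsum_two_heads[OF subspace_off, of ?f c "nat (max 2 (N - k - 2))", OF f_in])
        fix i assume i: "i \<ge> nat (max 2 (N - k - 2))"
        then have "Y u (k + 2 + int i) v = 0" by (intro N) linarith
        moreover have "Y e (int i) v = 0" using i by (intro hi) linarith
        ultimately show "?f i = 0" by (simp add: Y_right)
      qed
      have eq: "?f 0 + ?f 1 - (2 * b + a - c) \<cdot> ?x = Y e (-1) (Y u (k + 2) v)
          + Y e (-2) (Y u (k + 3) v) + (Y u (k + 1) (Y e 0 v) + ?t \<cdot> ?x)"
      proof -
        have "?f 0 + ?f 1 = Y e (-1) (Y u (k + 2) v) + Y u (k + 1) (Y e 0 v)
            + (Y e (-2) (Y u (k + 3) v) + b \<cdot> ?x)"
          by (simp add: v1 Y_right add.commute[of 1 k] add.commute[of 3 k])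
        moreover have "(2 * b + a - c) \<cdot> ?x = b \<cdot> ?x - ?t \<cdot> ?x"
          by (simp flip: scale_left_diff_distrib)
        ultimately show ?thesis by simp
      qed
      have s2: "?f 0 + ?f 1 - (2 * b + a - c) \<cdot> ?x \<in> off c"
        unfolding eq using fusion_L0[OF u1 v1 c(1), of "k + 1"]
        by (intro subspace_add[OF subspace_off subspace_add[OF subspace_off]] raising_in_off[OF c(1)]) simp_all
      have "(fsum ?f - (?f 0 + ?f 1)) + (?f 0 + ?f 1 - (2 * b + a - c) \<cdot> ?x) \<in> off c"
        by (rule subspace_add[OF subspace_off s1 s2])
      moreover have "Y (Y e (-1) u) (k + 2) v = fsum ?f" by (rule iterate_formula)
      ultimately show ?thesis by simp
    qed
    let ?\<kappa> = "(4 * a + 2) / 3"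
    have id: "(\<kappa> * s - p * t) \<cdot> x = (\<kappa> \<cdot> z - p \<cdot> y) + p \<cdot> (y - t \<cdot> x) - \<kappa> \<cdot> (z - s \<cdot> x)"
      for \<kappa> s p t x y z by (simp add: algebra_simps)
    have "(?\<kappa> * (2 * b + a - c) - (?t - 1) * ?t) \<cdot> ?x
      = (Y (Y e 0 (Y e 0 u)) (k + 2) v - (?t - 1) \<cdot> Y (Y e 0 u) (k + 1) v)
        + (?t - 1) \<cdot> (Y (Y e 0 u) (k + 1) v - ?t \<cdot> ?x)
        - ?\<kappa> \<cdot> (Y (Y e (-1) u) (k + 2) v - (2 * b + a - c) \<cdot> ?x)"
      unfolding null Y_left by (rule id)
    also have "\<dots> \<in> off c"
      by (intro subspace_diff subspace_add subspace_scale subspace_off A B C)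
    finally show ?thesis
      using c(2) False by (intro scaled[of "?\<kappa> * (2 * b + a - c) - (?t - 1) * ?t"]) (auto simp: fuses_def)
  qed
qed

text \<open>As \<open>v\<close> stays a highest weight vector, only \<open>Y e 0\<close> and
  \<open>Y e 1\<close> act on it nontrivially; the former is handled by \<open>fusion_L0\<close>,
  the latter is a scalar.\<close>

lemma fusion_desc_left:
  assumes d: "desc u j u'" and u: "hwv e a u" and v: "hwv e b v" and c: "c \<in> ising_weights"
    and base: "\<And>k. Y u k v \<in> off c"
  shows "Y u' k v \<in> off c"
  using d
proof (induction arbitrary: k)
  case desc_base
  then show ?case by (rule base)
next
  case (desc_step j x m)
  have x1: "Y e 1 x = (a + of_nat j) \<cdot> x" using desc_weight[OF desc_step(1)] u by (simp add: hwv_def)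
  have v1: "Y e 1 v = b \<cdot> v" using v by (simp add: hwv_def)
  note off = subspace_off[of c]
  have L0: "Y x k (Y e 0 v) \<in> off c" for k
  proof -
    have "Y x k (Y e 0 v) + (c - b - (a + of_nat j)) \<cdot> Y x (k - 1) v
        - (c - b - (a + of_nat j)) \<cdot> Y x (k - 1) v \<in> off c"
      by (intro subspace_diff[OF off] fusion_L0[OF x1 v1 c] subspace_scale[OF off] desc_step.IH)
    then show ?thesis by simp
  qed
  show ?case
    unfolding iterate_formula
  proof (intro fsum_in_subspace subspace_scale subspace_diff off)
    fix i :: nat
    show "Y e (- int m - int i) (Y x (k + int i) v) \<in> off c"
      by (rule raising_in_off[OF c]) simp
    consider "i = 0" | "i = 1" | "i \<ge> 2" by linarith
    then show "Y x (k + - int m - int i) (Y e (int i) v) \<in> off c"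
    proof cases
      case 1
      then show ?thesis using L0 by simp
    next
      case 2
      then show ?thesis using desc_step.IH by (simp add: v1 Y_right subspace_scale off)
    next
      case 3
      then show ?thesis using v by (simp add: hwv_def Y_right subspace_0 off)
    qed
  qed
qed

text \<open>Descendants on the left are treated before those on the right: moving a mode off
  \<open>v\<close> replaces \<open>u\<close> by \<open>Y e i u\<close>, so the second induction
  needs the claim for every \<open>u\<close> of the class.\<close>

lemma fusion_off:
  assumes u: "u \<in> eig e (weight_class a)" and v: "v \<in> eig e (weight_class b)" and ab: "a \<in> ising_weights" "b \<in> ising_weights"
    and c: "c \<in> ising_weights" "\<not> fuses a b c"
  shows "Y u k v \<in> off c"
proof -
  note off = subspace_off[of c]
  have 1: "Y u k w \<in> off c" if u: "u \<in> eig e (weight_class a)" and w: "hwv e b w" for u k w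
  proof (rule linear_span_image[OF linear_Y_left off eig_class_generated[OF ab(1) u]])
    fix y assume "y \<in> {x. \<exists>w k. hwv e a w \<and> desc w k x}"
    then show "Y y k w \<in> off c"
      using fusion_desc_left[OF _ _ w c(1)] fusion_hwv[OF _ w ab(1) c] by blast
  qed
  have 2: "Y u k x \<in> off c" if "desc w j x" "hwv e b w" "u \<in> eig e (weight_class a)" for u k w j x
    using that
  proof (induction arbitrary: u k)
    case desc_base
    then show ?case using 1 by blast
  next
    case (desc_step j x m)
    have eu: "Y e n u \<in> eig e (weight_class a)" for n
      using desc_step stable_eig_class[of a] by (simp add: stable_def)
    have "Y e (- int m) (Y u k x) - Y u k (Y e (- int m) x) \<in> off c"
      unfolding commutator_formula
      using desc_step eu by (intro fsum_in_subspace subspace_scale off) blast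
    then have "Y e (- int m) (Y u k x) - (Y e (- int m) (Y u k x) - Y u k (Y e (- int m) x)) \<in> off c"
      by (rule subspace_diff[OF off raising_in_off[OF c(1)], rotated]) simp
    then show ?case by simp
  qed
  show ?thesis
    by (rule linear_span_image[OF linear_Y off eig_class_generated[OF ab(2) v]]) (use 2 u in blast)
qed

text \<open>\<open>off c\<close> speaks about the exact eigenvalue \<open>c\<close>, not about its
  class modulo the integers. The gap is closed by the span \<open>?X\<close> of all products, which
  is stable and so generated by highest weight vectors: one of forbidden weight \<open>c\<close>
  lies both in \<open>off c\<close> and in the eigenspace of \<open>c\<close>, hence is
  zero.\<close>

theorem fusion:
  assumes u: "u \<in> eig e (weight_class a)" and v: "v \<in> eig e (weight_class b)" and ab: "a \<in> ising_weights" "b \<in> ising_weights"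
  shows "Y u k v \<in> eig e (\<Union>c\<in>{c\<in>ising_weights. fuses a b c}. weight_class c)"
proof -
  let ?G = "{Y u k v |u k v. u \<in> eig e (weight_class a) \<and> v \<in> eig e (weight_class b)}"
  let ?X = "span ?G"
  have st: "Y e m x \<in> eig e (weight_class h)" if "x \<in> eig e (weight_class h)" for m x h
    using that stable_eig_class[of h] by (simp add: stable_def)
  have "Y e m x \<in> ?X" if "x \<in> ?X" for m x
    using that
  proof (rule linear_span_image[OF linear_Y subspace_span])
    fix y assume "y \<in> ?G"
    then obtain u k v where y: "y = Y u k v" "u \<in> eig e (weight_class a)" "v \<in> eig e (weight_class b)" by blast
    have "Y e m (Y u k v) - Y u k (Y e m v) \<in> ?X"
      unfolding commutator_formula
      by (intro fsum_in_subspace subspace_span span_scale span_base) (use y st in blast)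
    moreover have "Y u k (Y e m v) \<in> ?X" by (rule span_base) (use y st in blast)
    ultimately have "Y e m (Y u k v) - Y u k (Y e m v) + Y u k (Y e m v) \<in> ?X" by (rule span_add)
    then show "Y e m y \<in> ?X" by (simp add: y)
  qed
  then have X: "stable {e} ?X" by (auto simp: stable_def)
  have "Y u k v \<in> ?X" by (rule span_base) (use u v in blast)
  then have "Y u k v \<in> gen_hw ?X" by (rule complete_reducibility[OF X])
  also have "\<dots> \<subseteq> eig e (\<Union>c\<in>{c\<in>ising_weights. fuses a b c}. weight_class c)"
    unfolding gen_hw_def
  proof (intro span_minimal subspace_eig subsetI)
    fix x assume "x \<in> {x. \<exists>w\<in>?X. \<exists>h\<in>ising_weights. hwv e h w \<and> (\<exists>k. desc w k x)}"
    then obtain w c j where w: "w \<in> ?X" "c \<in> ising_weights" "hwv e c w" "desc w j x" by blast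
    show "x \<in> eig e (\<Union>c\<in>{c\<in>ising_weights. fuses a b c}. weight_class c)"
    proof (cases "fuses a b c")
      case True
      have "Y e 1 x = (c + of_int (int j)) \<cdot> x" using desc_weight[OF w(4)] w(3) by (simp add: hwv_def)
      moreover have "c + of_int (int j) \<in> (\<Union>c\<in>{c\<in>ising_weights. fuses a b c}. weight_class c)"
        using True w(2) by (intro UN_I[of c] shift_in_weight_class) simp
      ultimately show ?thesis by (rule eigI)
    next
      case False
      have "?X \<subseteq> off c"
        using fusion_off[OF _ _ ab w(2) False] by (intro span_minimal subspace_off) blast
      then have "w \<in> eig e (- {c})" using w by (auto simp: off_def)
      moreover have "w \<in> eig e {c}" using w by (intro eigI) (auto simp: hwv_def)
      ultimately have "w = 0" using eig_disjoint[of "- {c}" "{c}"] by simp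
      then have "x = 0" using w desc_0 by simp
      then show ?thesis by (simp add: subspace_0 subspace_eig)
    qed
  qed
  finally show ?thesis .
qed

end

section \<open>Fusion for sets of weights\<close>

definition weight_classes :: "complex set \<Rightarrow> complex set" where
  "weight_classes H = (\<Union>h\<in>H. weight_class h)"

lemma weight_classes_disjoint:
  assumes "H \<subseteq> ising_weights" "H' \<subseteq> ising_weights" "H \<inter> H' = {}"
  shows "weight_classes H \<inter> weight_classes H' = {}"
proof -
  have "weight_class h \<inter> weight_class h' = {}" if "h \<in> H" "h' \<in> H'" for h h'
    using that assms weight_class_disjoint[of h h'] by blast
  then show ?thesis unfolding weight_classes_def by blast
qed

lemma weight_classes_split: "H \<subseteq> ising_weights \<Longrightarrow> weight_classes ising_weights = weight_classes H \<union> weight_classes (ising_weights - H)"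
  by (auto simp: weight_classes_def)

lemma (in ising_VOA) fusion_classes:
  assumes "A \<subseteq> ising_weights" "B \<subseteq> ising_weights"
    and fus: "\<And>a b c. a \<in> A \<Longrightarrow> b \<in> B \<Longrightarrow> c \<in> ising_weights \<Longrightarrow> fuses a b c \<Longrightarrow> c \<in> C"
    and u: "u \<in> eig e (weight_classes A)" and v: "v \<in> eig e (weight_classes B)"
  shows "Y u k v \<in> eig e (weight_classes C)"
proof -
  have eigenvectors: "Y x k y \<in> eig e (weight_classes C)"
    if xy: "Y e 1 x = \<mu> \<cdot> x" "\<mu> \<in> weight_classes A" "Y e 1 y = \<nu> \<cdot> y" "\<nu> \<in> weight_classes B" for x y \<mu> \<nu>
  proof -
    obtain a b where ab: "a \<in> A" "\<mu> \<in> weight_class a" "b \<in> B" "\<nu> \<in> weight_class b"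
      using xy(2,4) unfolding weight_classes_def by blast
    then have "Y x k y \<in> eig e (\<Union>c\<in>{c\<in>ising_weights. fuses a b c}. weight_class c)"
      using xy assms(1,2) by (intro fusion) (auto intro: eigI)
    moreover have "(\<Union>c\<in>{c\<in>ising_weights. fuses a b c}. weight_class c) \<subseteq> weight_classes C"
      using fus ab by (auto simp: weight_classes_def)
    ultimately show ?thesis using eig_mono by blast
  qed
  have left: "Y u k y \<in> eig e (weight_classes C)" if "Y e 1 y = \<nu> \<cdot> y" "\<nu> \<in> weight_classes B" for y \<nu>
    using u unfolding eig_def[of e "weight_classes A"]
    by (rule linear_span_image[OF linear_Y_left subspace_eig]) (use eigenvectors that in blast)
  show ?thesis
    using v unfolding eig_def[of e "weight_classes B"]
    by (rule linear_span_image[OF linear_Y subspace_eig]) (use left in blast)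
qed

section \<open>Characters of elementary abelian 2-groups\<close>

lemma neg_one_card_sym_diff:
  assumes "finite \<beta>" "finite \<gamma>"
  shows "(-1 :: complex) ^ card (sym_diff \<beta> \<gamma> \<inter> \<xi>) = (-1) ^ card (\<beta> \<inter> \<xi>) * (-1) ^ card (\<gamma> \<inter> \<xi>)"
proof -
  have "card (\<beta> \<inter> \<xi>) = card ((\<beta> - \<gamma>) \<inter> \<xi>) + card (\<beta> \<inter> \<gamma> \<inter> \<xi>)"
    using assms by (subst card_Un_disjoint[symmetric]) (auto intro!: arg_cong[of _ _ card])
  moreover have "card (\<gamma> \<inter> \<xi>) = card ((\<gamma> - \<beta>) \<inter> \<xi>) + card (\<beta> \<inter> \<gamma> \<inter> \<xi>)"
    using assms by (subst card_Un_disjoint[symmetric]) (auto intro!: arg_cong[of _ _ card])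
  moreover have "card (sym_diff \<beta> \<gamma> \<inter> \<xi>) = card ((\<beta> - \<gamma>) \<inter> \<xi>) + card ((\<gamma> - \<beta>) \<inter> \<xi>)"
    using assms by (subst card_Un_disjoint[symmetric]) (auto intro!: arg_cong[of _ _ card])
  moreover have "(-1 :: complex) ^ m * (-1) ^ m = 1" for m
    by (simp flip: power_mult_distrib)
  ultimately show ?thesis by (simp add: power_add mult_ac)
qed

text \<open>Coordinate by coordinate. If some \<alpha> in \<open>C\<close> contains the last
  coordinate, the freedom to put that coordinate into \<xi> is used to get the value at \<alpha>
  right; every other element containing it is reduced by adding \<alpha>.\<close>

lemma character_extension:
  fixes s :: "nat set \<Rightarrow> complex"
  assumes "C \<subseteq> Pow {..<n}"
    and "\<And>\<beta> \<gamma>. \<beta> \<in> C \<Longrightarrow> \<gamma> \<in> C \<Longrightarrow> sym_diff \<beta> \<gamma> \<in> C \<and> s (sym_diff \<beta> \<gamma>) = s \<beta> * s \<gamma>"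
    and "\<And>\<beta>. \<beta> \<in> C \<Longrightarrow> s \<beta> * s \<beta> = 1"
  shows "\<exists>\<xi>\<subseteq>{..<n}. \<forall>\<beta>\<in>C. s \<beta> = (-1) ^ card (\<beta> \<inter> \<xi>)"
  using assms
proof (induction n arbitrary: C)
  case 0
  have "s {} = 1" if "{} \<in> C" using 0(2)[OF that that] 0(3)[OF that] by simp
  then show ?case using 0(1) by (intro exI[of _ "{}"]) auto
next
  case (Suc n)
  have fin: "finite \<beta>" if "\<beta> \<in> C" for \<beta> using that Suc.prems(1) finite_subset by blast
  let ?C = "C \<inter> Pow {..<n}"
  have "\<exists>\<xi>\<subseteq>{..<n}. \<forall>\<beta>\<in>?C. s \<beta> = (-1) ^ card (\<beta> \<inter> \<xi>)"
  proof (rule Suc.IH)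
    fix \<beta> \<gamma> assume "\<beta> \<in> ?C" "\<gamma> \<in> ?C"
    then show "sym_diff \<beta> \<gamma> \<in> ?C \<and> s (sym_diff \<beta> \<gamma>) = s \<beta> * s \<gamma>"
      using Suc.prems(2)[of \<beta> \<gamma>] by auto
  qed (use Suc.prems(3) in auto)
  then obtain \<xi> where \<xi>: "\<xi> \<subseteq> {..<n}" "\<And>\<beta>. \<beta> \<in> ?C \<Longrightarrow> s \<beta> = (-1) ^ card (\<beta> \<inter> \<xi>)" by blast
  show ?case
  proof (cases "C \<subseteq> Pow {..<n}")
    case True
    then show ?thesis using \<xi> by (intro exI[of _ \<xi>]) force
  next
    case False
    then obtain \<alpha> where \<alpha>: "\<alpha> \<in> C" "n \<in> \<alpha>"
      using Suc.prems(1) by (force simp: less_Suc_eq)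
    define \<xi>' where "\<xi>' = (if s \<alpha> = (-1) ^ card (\<alpha> \<inter> \<xi>) then \<xi> else insert n \<xi>)"
    have low: "\<beta> \<inter> \<xi>' = \<beta> \<inter> \<xi>" if "n \<notin> \<beta>" for \<beta> using that by (auto simp: \<xi>'_def)
    have "s \<alpha> = 1 \<or> s \<alpha> = -1" using Suc.prems(3)[OF \<alpha>(1)] by (metis square_eq_1_iff)
    moreover have "(-1::complex) ^ card (\<alpha> \<inter> \<xi>) = 1 \<or> (-1::complex) ^ card (\<alpha> \<inter> \<xi>) = -1"
      by (metis neg_one_even_power neg_one_odd_power)
    moreover have "n \<notin> \<xi>" using \<xi> by blast
    then have "card (\<alpha> \<inter> insert n \<xi>) = Suc (card (\<alpha> \<inter> \<xi>))"
      using \<alpha> fin[OF \<alpha>(1)] by (simp add: Int_insert_right)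
    ultimately have s\<alpha>: "s \<alpha> = (-1) ^ card (\<alpha> \<inter> \<xi>')" by (auto simp: \<xi>'_def)
    have "s \<beta> = (-1) ^ card (\<beta> \<inter> \<xi>')" if \<beta>: "\<beta> \<in> C" for \<beta>
    proof (cases "n \<in> \<beta>")
      case True
      let ?\<gamma> = "sym_diff \<beta> \<alpha>"
      have \<gamma>: "?\<gamma> \<in> C" "s ?\<gamma> = s \<beta> * s \<alpha>" using Suc.prems(2)[OF \<beta> \<alpha>(1)] by auto
      have "n \<notin> ?\<gamma>" using True \<alpha> by blast
      then have "?\<gamma> \<in> ?C" using \<gamma>(1) Suc.prems(1) by (force simp: less_Suc_eq)
      then have "s ?\<gamma> = (-1) ^ card (?\<gamma> \<inter> \<xi>')" using \<xi>(2) low[OF \<open>n \<notin> ?\<gamma>\<close>] by metis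
      then have "s \<beta> * s \<alpha> = (-1) ^ card (\<beta> \<inter> \<xi>') * s \<alpha>"
        using \<gamma>(2) neg_one_card_sym_diff[OF fin[OF \<beta>] fin[OF \<alpha>(1)], of \<xi>'] s\<alpha> by simp
      then show ?thesis using Suc.prems(3)[OF \<alpha>(1)] by auto
    next
      case False
      then have "\<beta> \<in> ?C" using \<beta> Suc.prems(1) by (force simp: less_Suc_eq)
      then show ?thesis using \<xi>(2) low[OF False] by metis
    qed
    moreover have "\<xi>' \<subseteq> {..<Suc n}" using \<xi>(1) by (auto simp: \<xi>'_def)
    ultimately show ?thesis by blast
  qed
qed

section \<open>Framed vertex operator algebras\<close>

locale framed_VOA = simple_voa V for V :: "('v::ab_group_add) voa" +
  fixes n :: nat and es :: "nat \<Rightarrow> 'v"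
  assumes framed: "framed V n es"
begin

lemma ising_es: "i < n \<Longrightarrow> ising_VOA V (es i)"
  using framed by (auto simp: framed_def intro!: ising_VOA.intro ising_VOA_axioms.intro VOA_axioms)

lemma es_commute:
  "i < n \<Longrightarrow> j < n \<Longrightarrow> i \<noteq> j \<Longrightarrow> Y (es i) m (Y (es j) k v) = Y (es j) k (Y (es i) m v)"
  using framed unfolding framed_def by blast

lemma conformal_sum: "Y \<omega> k v = (\<Sum>i<n. Y (es i) k v)"
proof -
  have "\<omega> = (\<Sum>i<n. es i)" using framed unfolding framed_def by blast
  then show ?thesis by (simp only: Y_left)
qed

subsection \<open>Joint eigenspaces\<close>

definition joint_eigenspace :: "(nat \<Rightarrow> complex) \<Rightarrow> 'v set" where
  "joint_eigenspace \<mu> = {x. \<forall>i\<in>{..<n}. Y (es i) 1 x = \<mu> i \<cdot> x}"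

definition joint_span :: "(nat \<Rightarrow> complex) set \<Rightarrow> 'v set" where
  "joint_span A = span (\<Union>\<mu>\<in>A. joint_eigenspace \<mu>)"

lemma subspace_joint_span: "subspace (joint_span A)"
  by (simp add: joint_span_def)

lemma subspace_joint_eigenspace: "subspace (joint_eigenspace \<mu>)"
  by (rule subspaceI) (auto simp: joint_eigenspace_def Y_right scale_right_distrib mult.commute)

lemma joint_eigenspace_subset_span: "\<mu> \<in> A \<Longrightarrow> joint_eigenspace \<mu> \<subseteq> joint_span A"
  unfolding joint_span_def by (auto intro: span_base)

lemma joint_span_mono: "A \<subseteq> B \<Longrightarrow> joint_span A \<subseteq> joint_span B"
  unfolding joint_span_def by (rule span_mono) blast

lemma joint_span_minimal: "subspace W \<Longrightarrow> (\<And>\<mu>. \<mu> \<in> A \<Longrightarrow> joint_eigenspace \<mu> \<subseteq> W) \<Longrightarrow> joint_span A \<subseteq> W"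
  unfolding joint_span_def by (rule span_minimal) blast

text \<open>Extensionality makes distinct functions differ at some site of the frame; otherwise two
  indices could name the same eigenspace.\<close>

lemma joint_span_disjoint:
  assumes "A \<subseteq> extensional {..<n}" "B \<subseteq> extensional {..<n}" "A \<inter> B = {}" "x \<in> joint_span A" "x \<in> joint_span B"
  shows "x = 0"
proof (rule joint_eigenspans_disjoint[of "{..<n}" "\<lambda>i. Y (es i) 1" A B "\<lambda>\<mu>. \<mu>" x])
  fix \<mu> \<nu> assume \<mu>: "\<mu> \<in> A \<union> B" "\<nu> \<in> A \<union> B" "\<mu> \<noteq> \<nu>"
  then have "\<mu> \<in> extensional {..<n}" "\<nu> \<in> extensional {..<n}" using assms(1,2) by blast+
  then show "\<exists>i\<in>{..<n}. \<mu> i \<noteq> \<nu> i" using \<mu>(3) extensionalityI[of \<mu> "{..<n}" \<nu>] by blast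
qed (use assms in \<open>auto simp: joint_span_def joint_eigenspace_def linear_Y\<close>)

lemma joint_span_split:
  assumes "x \<in> joint_span A"
  obtains y z where "x = y + z" "y \<in> joint_span (A \<inter> B)" "z \<in> joint_span (A - B)"
proof -
  have "(\<Union>\<mu>\<in>A. joint_eigenspace \<mu>) = (\<Union>\<mu>\<in>A \<inter> B. joint_eigenspace \<mu>) \<union> (\<Union>\<mu>\<in>A - B. joint_eigenspace \<mu>)" by blast
  then have "x \<in> span ((\<Union>\<mu>\<in>A \<inter> B. joint_eigenspace \<mu>) \<union> (\<Union>\<mu>\<in>A - B. joint_eigenspace \<mu>))" using assms by (simp add: joint_span_def)
  then show thesis using that unfolding span_Un joint_span_def by blast
qed

definition allowed :: "(nat \<Rightarrow> complex) set" where
  "allowed = PiE {..<n} (\<lambda>_. weight_classes ising_weights)"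

text \<open>One site at a time: a joint eigenspace of the earlier operators is stable under the next
  Ising vector, which commutes with them, so complete reducibility applies inside it.\<close>

lemma joint_span_allowed: "joint_span allowed = UNIV"
proof -
  let ?S = "\<lambda>m. {x. \<exists>\<mu>. \<forall>i<m. \<mu> i \<in> weight_classes ising_weights \<and> Y (es i) 1 x = \<mu> i \<cdot> x}"
  have "span (?S m) = UNIV" if "m \<le> n" for m
    using that
  proof (induction m)
    case 0
    then show ?case by simp
  next
    case (Suc m)
    interpret m: ising_VOA V "es m" using Suc by (intro ising_es) simp
    have "?S m \<subseteq> span (?S (Suc m))"
    proof
      fix x assume "x \<in> ?S m"
      then obtain \<mu> where \<mu>: "\<And>i. i < m \<Longrightarrow> \<mu> i \<in> weight_classes ising_weights" "\<And>i. i < m \<Longrightarrow> Y (es i) 1 x = \<mu> i \<cdot> x"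
        by blast
      let ?U = "{x. \<forall>i<m. Y (es i) 1 x = \<mu> i \<cdot> x}"
      have "subspace ?U"
        by (rule subspaceI) (auto simp: Y_right scale_right_distrib mult.commute)
      moreover have "Y (es m) k y \<in> ?U" if "y \<in> ?U" for k y
        using that Suc.prems es_commute[of _ m] by (auto simp: Y_right)
      ultimately have U: "stable {es m} ?U" by (auto simp: stable_def)
      have "x \<in> m.gen_hw ?U" using \<mu> by (intro m.complete_reducibility[OF U]) simp
      also have "\<dots> \<subseteq> span (?S (Suc m))"
        unfolding m.gen_hw_def
      proof (intro span_mono subsetI)
        fix y assume "y \<in> {x. \<exists>w\<in>?U. \<exists>h\<in>ising_weights. hwv (es m) h w \<and> (\<exists>k. m.desc w k x)}"
        then obtain w h k where w: "w \<in> ?U" "h \<in> ising_weights" "hwv (es m) h w" "m.desc w k y" by blast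
        have "y \<in> m.hw_module w" unfolding m.hw_module_def by (rule span_base) (use w in blast)
        then have "y \<in> ?U" using m.hw_module_minimal[OF U w(1)] by blast
        moreover have "Y (es m) 1 y = (h + of_nat k) \<cdot> y"
          using m.desc_weight[OF w(4)] w(3) by (simp add: hwv_def)
        moreover have "h + of_nat k \<in> weight_classes ising_weights"
          using w(2) nat_shift_in_weight_class[of h] by (auto simp: weight_classes_def)
        ultimately show "y \<in> ?S (Suc m)"
          using \<mu>(1) by (auto simp: less_Suc_eq intro!: exI[of _ "\<mu>(m := h + of_nat k)"])
      qed
      finally show "x \<in> span (?S (Suc m))" .
    qed
    then have "span (?S m) \<subseteq> span (?S (Suc m))" by (rule span_minimal) simp
    then show ?case using Suc by auto
  qed
  then have "span (?S n) = UNIV" by simp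
  moreover have "?S n \<subseteq> (\<Union>\<mu>\<in>allowed. joint_eigenspace \<mu>)"
  proof
    fix x assume "x \<in> ?S n"
    then obtain \<mu> where \<mu>: "\<And>i. i < n \<Longrightarrow> \<mu> i \<in> weight_classes ising_weights" "\<And>i. i < n \<Longrightarrow> Y (es i) 1 x = \<mu> i \<cdot> x"
      by blast
    then have "restrict \<mu> {..<n} \<in> allowed" "x \<in> joint_eigenspace (restrict \<mu> {..<n})"
      by (auto simp: allowed_def joint_eigenspace_def)
    then show "x \<in> (\<Union>\<mu>\<in>allowed. joint_eigenspace \<mu>)" by blast
  qed
  ultimately show ?thesis using span_mono unfolding joint_span_def by blast
qed

lemma joint_span_subset_eig:
  assumes "i < n" "\<And>\<mu>. \<mu> \<in> A \<Longrightarrow> \<mu> i \<in> B"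
  shows "joint_span A \<subseteq> eig (es i) B"
  using assms by (intro joint_span_minimal subspace_eig) (auto simp: joint_eigenspace_def intro: eigI)

lemma joint_span_restrict:
  assumes x: "x \<in> joint_span A" and i: "i < n" and xi: "x \<in> eig (es i) B"
  shows "x \<in> joint_span {\<mu>\<in>A. \<mu> i \<in> B}"
proof -
  obtain y z where yz: "x = y + z" "y \<in> joint_span (A \<inter> {\<mu>. \<mu> i \<in> B})" "z \<in> joint_span (A - {\<mu>. \<mu> i \<in> B})"
    using joint_span_split[OF x] by blast
  have "y \<in> eig (es i) B" using joint_span_subset_eig[OF i, of "A \<inter> {\<mu>. \<mu> i \<in> B}" B] yz by blast
  then have "x - y \<in> eig (es i) B" using xi by (intro subspace_diff subspace_eig)
  moreover have "z \<in> eig (es i) (- B)"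
    using joint_span_subset_eig[OF i, of "A - {\<mu>. \<mu> i \<in> B}" "- B"] yz by blast
  ultimately have "z = 0" using yz(1) by (intro eig_disjoint[of B "- B" z "es i"]) auto
  then show ?thesis using yz by (simp add: Int_def)
qed

definition type_space :: "(nat \<Rightarrow> complex set) \<Rightarrow> 'v set" where
  "type_space H = joint_span (PiE {..<n} (\<lambda>i. weight_classes (H i)))"

lemma subspace_type_space: "subspace (type_space H)"
  by (simp add: type_space_def subspace_joint_span)

text \<open>Turns membership into a condition at each site separately, which is the form in which
  fusion rules apply.\<close>

lemma type_space_eq:
  assumes "\<forall>i<n. H i \<subseteq> ising_weights"
  shows "type_space H = (\<Inter>i\<in>{..<n}. eig (es i) (weight_classes (H i)))"
proof
  show "type_space H \<subseteq> (\<Inter>i\<in>{..<n}. eig (es i) (weight_classes (H i)))"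
  proof (rule INT_greatest)
    fix i assume "i \<in> {..<n}"
    then show "type_space H \<subseteq> eig (es i) (weight_classes (H i))"
      unfolding type_space_def by (intro joint_span_subset_eig) auto
  qed
  show "(\<Inter>i\<in>{..<n}. eig (es i) (weight_classes (H i))) \<subseteq> type_space H"
  proof
    fix x assume x: "x \<in> (\<Inter>i\<in>{..<n}. eig (es i) (weight_classes (H i)))"
    have "x \<in> joint_span {\<mu>\<in>allowed. \<forall>i<m. \<mu> i \<in> weight_classes (H i)}" if "m \<le> n" for m
      using that
    proof (induction m)
      case 0
      then show ?case by (simp add: joint_span_allowed)
    next
      case (Suc m)
      then have "x \<in> joint_span {\<mu>\<in>{\<mu>\<in>allowed. \<forall>i<m. \<mu> i \<in> weight_classes (H i)}. \<mu> m \<in> weight_classes (H m)}"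
        using x by (intro joint_span_restrict) auto
      also have "{\<mu>\<in>{\<mu>\<in>allowed. \<forall>i<m. \<mu> i \<in> weight_classes (H i)}. \<mu> m \<in> weight_classes (H m)}
          = {\<mu>\<in>allowed. \<forall>i<Suc m. \<mu> i \<in> weight_classes (H i)}" by (auto simp: less_Suc_eq)
      finally show ?case .
    qed
    from this[of n] have "x \<in> joint_span {\<mu>\<in>allowed. \<forall>i<n. \<mu> i \<in> weight_classes (H i)}" by simp
    also have "\<dots> \<subseteq> type_space H"
      unfolding type_space_def by (rule joint_span_mono) (auto simp: allowed_def PiE_def)
    finally show "x \<in> type_space H" .
  qed
qed

lemma eig_classes_stable:
  assumes "i < n" "j < n" "x \<in> eig (es i) (weight_classes H)"
  shows "Y (es j) m x \<in> eig (es i) (weight_classes H)"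
  using assms(3) unfolding eig_def[of "es i" "weight_classes H"]
proof (rule linear_span_image[OF linear_Y subspace_span])
  interpret i: ising_VOA V "es i" using assms by (intro ising_es)
  fix y assume "y \<in> (\<Union>\<mu>\<in>weight_classes H. {x. Y (es i) 1 x = \<mu> \<cdot> x})"
  then obtain h \<mu> where h: "h \<in> H" "\<mu> \<in> weight_class h" "Y (es i) 1 y = \<mu> \<cdot> y" by (auto simp: weight_classes_def)
  have "Y (es j) m y \<in> eig (es i) (weight_classes H)"
  proof (cases "i = j")
    case True
    have "y \<in> eig (es i) (weight_class h)" using h by (intro eigI)
    then have "Y (es i) m y \<in> eig (es i) (weight_class h)" using i.stable_eig_class[of h] by (simp add: stable_def)
    moreover have "weight_class h \<subseteq> weight_classes H" using h by (auto simp: weight_classes_def)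
    ultimately show ?thesis using True eig_mono by blast
  next
    case False
    have "Y (es i) 1 (Y (es j) m y) = \<mu> \<cdot> Y (es j) m y"
      using es_commute[OF assms(1,2) False] h by (simp add: Y_right)
    then show ?thesis using h by (intro eigI) (auto simp: weight_classes_def)
  qed
  then show "Y (es j) m y \<in> span (\<Union>\<mu>\<in>weight_classes H. {x. Y (es i) 1 x = \<mu> \<cdot> x})" by (simp add: eig_def)
qed

lemma type_space_stable:
  assumes "\<forall>i<n. H i \<subseteq> ising_weights"
  shows "stable (es ` {..<n}) (type_space H)"
  unfolding stable_def type_space_eq[OF assms]
  using eig_classes_stable by (auto intro!: subspace_Int subspace_eig)

lemma type_space_product:
  assumes H: "\<forall>i<n. A i \<subseteq> ising_weights" "\<forall>i<n. B i \<subseteq> ising_weights" "\<forall>i<n. C i \<subseteq> ising_weights"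
    and fus: "\<And>i a b c. i < n \<Longrightarrow> a \<in> A i \<Longrightarrow> b \<in> B i \<Longrightarrow> c \<in> ising_weights \<Longrightarrow> fuses a b c \<Longrightarrow> c \<in> C i"
    and uv: "u \<in> type_space A" "v \<in> type_space B"
  shows "Y u k v \<in> type_space C"
  unfolding type_space_eq[OF H(3)]
proof
  fix i assume i: "i \<in> {..<n}"
  then interpret i: ising_VOA V "es i" by (intro ising_es) simp
  have "u \<in> eig (es i) (weight_classes (A i))" using uv(1) i type_space_eq[OF H(1)] by auto
  moreover have "v \<in> eig (es i) (weight_classes (B i))" using uv(2) i type_space_eq[OF H(2)] by auto
  ultimately show "Y u k v \<in> eig (es i) (weight_classes (C i))"
    using i H fus by (intro i.fusion_classes[of "A i" "B i"]) auto
qed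

end

subsection \<open>Automorphisms fixing the frame\<close>

text \<open>The first four clauses make \<open>H\<^sub>0\<close> and \<open>H\<^sub>1\<close> the
  two degrees of a \<int>_2-grading. In the last two \<open>a\<close> is any weight outside
  \<open>H\<^sub>0\<close>, possibly in neither set, as 1/16 is in the fine case: its product with a
  homogeneous weight must leave the degree of that weight.\<close>

definition site_grading :: "complex set \<Rightarrow> complex set \<Rightarrow> bool" where
  "site_grading H\<^sub>0 H\<^sub>1 \<longleftrightarrow> H\<^sub>0 \<subseteq> ising_weights \<and> H\<^sub>1 \<subseteq> ising_weights \<and> H\<^sub>0 \<inter> H\<^sub>1 = {} \<and>
     (\<forall>a\<in>ising_weights. \<forall>b\<in>ising_weights. \<forall>c\<in>ising_weights. fuses a b c \<longrightarrow>
        (a \<in> H\<^sub>0 \<and> b \<in> H\<^sub>0 \<longrightarrow> c \<in> H\<^sub>0) \<and> (a \<in> H\<^sub>0 \<and> b \<in> H\<^sub>1 \<longrightarrow> c \<in> H\<^sub>1) \<and>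
        (a \<in> H\<^sub>1 \<and> b \<in> H\<^sub>0 \<longrightarrow> c \<in> H\<^sub>1) \<and> (a \<in> H\<^sub>1 \<and> b \<in> H\<^sub>1 \<longrightarrow> c \<in> H\<^sub>0) \<and>
        (a \<notin> H\<^sub>0 \<and> b \<in> H\<^sub>0 \<longrightarrow> c \<notin> H\<^sub>0) \<and> (a \<notin> H\<^sub>0 \<and> b \<in> H\<^sub>1 \<longrightarrow> c \<notin> H\<^sub>1))"

lemma site_grading_sigma: "site_grading {0} {1/2}"
  unfolding site_grading_def ising_weights_def fuses_def by simp

lemma site_grading_tau: "site_grading {0, 1/2} {1/16}"
  unfolding site_grading_def ising_weights_def fuses_def by simp

context framed_VOA
begin

definition piece :: "complex set \<Rightarrow> complex set \<Rightarrow> nat set \<Rightarrow> 'v set" where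
  "piece H\<^sub>0 H\<^sub>1 \<beta> = type_space (\<lambda>i. if i \<in> \<beta> then H\<^sub>1 else H\<^sub>0)"

lemma subspace_piece: "subspace (piece H\<^sub>0 H\<^sub>1 \<beta>)"
  by (simp add: piece_def subspace_type_space)

text \<open>The frame sums to the conformal vector, so the eigenvalues add up to a conformal weight,
  which is an integer. This places joint eigenspaces in finite-dimensional spaces, where
  eigenvectors of automorphisms exist.\<close>

lemma joint_eigenspace_subset_grade:
  assumes "joint_eigenspace \<mu> \<noteq> {0}"
  obtains k where "joint_eigenspace \<mu> \<subseteq> grade V k"
proof -
  have \<omega>1: "Y \<omega> 1 x = (\<Sum>i<n. \<mu> i) \<cdot> x" if "x \<in> joint_eigenspace \<mu>" for x
    using that by (simp add: conformal_sum joint_eigenspace_def scale_sum_left)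
  have "eig \<omega> (range of_int) = UNIV"
  proof -
    have "(\<Union>\<mu>\<in>range of_int. {x. Y \<omega> 1 x = \<mu> \<cdot> x}) = (\<Union>k. grade V k)" by (auto simp: grade_def)
    then show ?thesis using span_grades unfolding eig_def by auto
  qed
  moreover obtain x where x: "x \<in> joint_eigenspace \<mu>" "x \<noteq> 0" using assms subspace_0[OF subspace_joint_eigenspace] by blast
  moreover have "x \<in> eig \<omega> {\<Sum>i<n. \<mu> i}" using \<omega>1[OF x(1)] by (rule eigI) simp
  ultimately have "range of_int \<inter> {\<Sum>i<n. \<mu> i} \<noteq> {}" using eig_disjoint by blast
  then obtain k where "(\<Sum>i<n. \<mu> i) = of_int k" by auto
  then have "joint_eigenspace \<mu> \<subseteq> grade V k" using \<omega>1 by (auto simp: grade_def)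
  then show thesis by (rule that)
qed

end

text \<open>To be instantiated twice, by \<theta> and by \<theta> composed with itself.\<close>

locale framed_aut = framed_VOA V n es for V :: "('v::ab_group_add) voa" and n es +
  fixes \<Phi> :: "'v \<Rightarrow> 'v"
  assumes linear_aut: "Vector_Spaces.linear (smul V) (smul V) \<Phi>"
    and aut_product: "\<Phi> (vop V u k v) = vop V (\<Phi> u) k (\<Phi> v)"
    and aut_es: "i < n \<Longrightarrow> \<Phi> (es i) = es i"
begin

sublocale aut: Vector_Spaces.linear "smul V" "smul V" \<Phi>
  by (rule linear_aut)

lemma aut_mode: "i < n \<Longrightarrow> \<Phi> (Y (es i) m x) = Y (es i) m (\<Phi> x)"
  by (simp add: aut_product aut_es)

lemma eigenvector_in_joint_span:
  assumes "joint_span A \<noteq> {0}"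
  obtains w l where "w \<in> joint_span A" "w \<noteq> 0" "\<Phi> w = l \<cdot> w"
proof -
  obtain \<mu> where \<mu>: "\<mu> \<in> A" "joint_eigenspace \<mu> \<noteq> {0}"
  proof (rule ccontr)
    assume "\<not> thesis"
    then have "\<And>\<mu>. \<mu> \<in> A \<Longrightarrow> joint_eigenspace \<mu> = {0}" using that by blast
    then have "joint_span A \<subseteq> {0}" by (intro joint_span_minimal) auto
    then show False using assms subspace_0[OF subspace_joint_span] by blast
  qed
  obtain k where k: "joint_eigenspace \<mu> \<subseteq> grade V k" using joint_eigenspace_subset_grade[OF \<mu>(2)] .
  obtain B where B: "finite B" "grade V k \<subseteq> span B" by (rule grade_finite_dim)
  obtain w l where "w \<in> joint_eigenspace \<mu>" "w \<noteq> 0" "\<Phi> w = l \<cdot> w"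
  proof (rule exists_eigenvector[OF vector_space_axioms linear_aut subspace_joint_eigenspace \<mu>(2) _ B(1)])
    show "joint_eigenspace \<mu> \<subseteq> span B" using k B by blast
    show "\<Phi> x \<in> joint_eigenspace \<mu>" if "x \<in> joint_eigenspace \<mu>" for x
      using that aut_mode[of _ 1 x, symmetric] by (auto simp: joint_eigenspace_def aut.scale)
  qed
  then show thesis using that joint_eigenspace_subset_span[OF \<mu>(1)] by blast
qed

context
  fixes H\<^sub>0 H\<^sub>1
  assumes sg: "site_grading H\<^sub>0 H\<^sub>1"
    and triv: "\<And>x. x \<in> piece H\<^sub>0 H\<^sub>1 {} \<Longrightarrow> \<Phi> x = x"
begin

lemma site_subset_weights: "\<forall>i<n. (if i \<in> \<beta> then H\<^sub>1 else H\<^sub>0) \<subseteq> ising_weights"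
  using sg by (auto simp: site_grading_def)

lemma piece_product:
  assumes "u \<in> piece H\<^sub>0 H\<^sub>1 \<beta>" "v \<in> piece H\<^sub>0 H\<^sub>1 \<gamma>"
  shows "Y u k v \<in> piece H\<^sub>0 H\<^sub>1 (sym_diff \<beta> \<gamma>)"
  unfolding piece_def
proof (rule type_space_product[OF site_subset_weights site_subset_weights site_subset_weights _ assms[unfolded piece_def]])
  fix i a b c
  assume ab: "a \<in> (if i \<in> \<beta> then H\<^sub>1 else H\<^sub>0)" "b \<in> (if i \<in> \<gamma> then H\<^sub>1 else H\<^sub>0)"
    and c: "c \<in> ising_weights" "fuses a b c"
  have "a \<in> ising_weights" "b \<in> ising_weights" using ab sg by (auto simp: site_grading_def split: if_splits)
  then show "c \<in> (if i \<in> sym_diff \<beta> \<gamma> then H\<^sub>1 else H\<^sub>0)"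
    using sg ab c unfolding site_grading_def by (auto split: if_splits)
qed

lemma off_piece_product:
  assumes \<mu>: "\<mu> \<in> allowed" "i < n" "\<mu> i \<notin> weight_classes H\<^sub>0" and u: "u \<in> joint_eigenspace \<mu>" and w: "w \<in> piece H\<^sub>0 H\<^sub>1 \<beta>"
  shows "Y u k w \<in> joint_span (allowed - PiE {..<n} (\<lambda>i. weight_classes (if i \<in> \<beta> then H\<^sub>1 else H\<^sub>0)))"
proof -
  interpret i: ising_VOA V "es i" using \<mu> by (intro ising_es)
  let ?H = "if i \<in> \<beta> then H\<^sub>1 else H\<^sub>0"
  have H0: "H\<^sub>0 \<subseteq> ising_weights" using sg by (simp add: site_grading_def)
  have "\<mu> i \<in> weight_classes ising_weights" using \<mu>(1,2) by (auto simp: allowed_def)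
  then have "\<mu> i \<in> weight_classes (ising_weights - H\<^sub>0)" using \<mu>(3) weight_classes_split[OF H0] by blast
  then have "u \<in> eig (es i) (weight_classes (ising_weights - H\<^sub>0))" using u \<mu>(2) by (intro eigI) (auto simp: joint_eigenspace_def)
  moreover have "w \<in> eig (es i) (weight_classes ?H)"
    using w \<mu>(2) unfolding piece_def type_space_eq[OF site_subset_weights] by auto
  ultimately have "Y u k w \<in> eig (es i) (weight_classes (ising_weights - ?H))"
  proof (rule i.fusion_classes[rotated 3])
    fix a b c assume *: "a \<in> ising_weights - H\<^sub>0" "b \<in> ?H" "c \<in> ising_weights" "fuses a b c"
    have "b \<in> ising_weights" using * site_subset_weights \<mu>(2) by blast
    then show "c \<in> ising_weights - ?H" using sg * unfolding site_grading_def by (auto split: if_splits)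
  qed (use site_subset_weights \<mu>(2) in auto)
  then have "Y u k w \<in> joint_span {\<mu>\<in>allowed. \<mu> i \<in> weight_classes (ising_weights - ?H)}"
    using \<mu>(2) by (intro joint_span_restrict) (auto simp: joint_span_allowed)
  also have "\<dots> \<subseteq> joint_span (allowed - PiE {..<n} (\<lambda>i. weight_classes (if i \<in> \<beta> then H\<^sub>1 else H\<^sub>0)))"
  proof (intro joint_span_mono subsetI DiffI)
    fix \<nu> assume \<nu>: "\<nu> \<in> {\<mu>\<in>allowed. \<mu> i \<in> weight_classes (ising_weights - ?H)}"
    then show "\<nu> \<in> allowed" by blast
    have "weight_classes (ising_weights - ?H) \<inter> weight_classes ?H = {}"
      using site_subset_weights[of \<beta>] \<mu>(2) by (intro weight_classes_disjoint) blast+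
    then have "\<nu> i \<notin> weight_classes ?H" using \<nu> by blast
    then show "\<nu> \<notin> PiE {..<n} (\<lambda>i. weight_classes (if i \<in> \<beta> then H\<^sub>1 else H\<^sub>0))"
      using \<mu>(2) PiE_mem[of \<nu> "{..<n}" _ i] by blast
  qed
  finally show ?thesis .
qed

lemma aut_scalar_on_piece:
  "\<exists>l. \<forall>z\<in>piece H\<^sub>0 H\<^sub>1 \<beta>. \<Phi> z = l \<cdot> z"
proof (cases "piece H\<^sub>0 H\<^sub>1 \<beta> = {0}")
  case True
  then show ?thesis by (auto simp: aut.zero)
next
  case False
  let ?P = "PiE {..<n} (\<lambda>i. weight_classes (if i \<in> \<beta> then H\<^sub>1 else H\<^sub>0))"
  let ?Q = "PiE {..<n} (\<lambda>i. weight_classes (if i \<in> {} then H\<^sub>1 else H\<^sub>0))"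
  have PJ: "piece H\<^sub>0 H\<^sub>1 \<beta> = joint_span ?P" by (simp only: piece_def type_space_def)
  obtain w l where "w \<in> joint_span ?P" "w \<noteq> 0" "\<Phi> w = l \<cdot> w"
    using eigenvector_in_joint_span[OF False[unfolded PJ]] .
  note w = this[folded PJ]
  let ?A = "span {Y v q w |v q. v \<in> piece H\<^sub>0 H\<^sub>1 {}}"
  have "\<Phi> z = l \<cdot> z" if z: "z \<in> piece H\<^sub>0 H\<^sub>1 \<beta>" for z
  proof -
    \<comment> \<open>\<open>v\<close> is sorted by joint eigenvalues: either all sites have degree
      zero, or a single bad site already moves the product out of the component of
      \<open>w\<close>.\<close>
    have gen: "Y v q w \<in> span (?A \<union> joint_span (allowed - ?P))" for v q
    proof -
      have "v \<in> joint_span allowed" by (simp add: joint_span_allowed)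
      then show ?thesis unfolding joint_span_def[of allowed]
      proof (rule linear_span_image[OF linear_Y_left subspace_span])
        fix u assume "u \<in> (\<Union>\<mu>\<in>allowed. joint_eigenspace \<mu>)"
        then obtain \<mu> where \<mu>: "\<mu> \<in> allowed" "u \<in> joint_eigenspace \<mu>" by blast
        show "Y u q w \<in> span (?A \<union> joint_span (allowed - ?P))"
        proof (cases "\<forall>i<n. \<mu> i \<in> weight_classes H\<^sub>0")
          case True
          then have "\<mu> \<in> ?Q" using \<mu> by (auto simp: allowed_def PiE_def)
          then have "u \<in> piece H\<^sub>0 H\<^sub>1 {}"
            using \<mu>(2) joint_eigenspace_subset_span unfolding piece_def type_space_def by blast
          then have "Y u q w \<in> ?A" by (intro span_base) blast
          then show ?thesis by (intro span_base) blast
        next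
          case False
          then obtain i where "i < n" "\<mu> i \<notin> weight_classes H\<^sub>0" by blast
          then have "Y u q w \<in> joint_span (allowed - ?P)"
            using \<mu> w(1) by (intro off_piece_product)
          then show ?thesis by (intro span_base) blast
        qed
      qed
    qed
    have "{Y v q w |v q. True} \<subseteq> span (?A \<union> joint_span (allowed - ?P))" using gen by blast
    then have "span {Y v q w |v q. True} \<subseteq> span (?A \<union> joint_span (allowed - ?P))"
      by (rule span_minimal) simp
    then have "z \<in> span (?A \<union> joint_span (allowed - ?P))" using cyclic_span[OF w(2)] by blast
    then obtain a b where ab: "z = a + b" "a \<in> ?A" "b \<in> joint_span (allowed - ?P)"
      unfolding span_Un by (auto simp: joint_span_def span_span)
    have "?A \<subseteq> piece H\<^sub>0 H\<^sub>1 \<beta>"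
      using piece_product[of _ "{}" w \<beta>] w(1) by (intro span_minimal subspace_piece) auto
    then have "z - a \<in> piece H\<^sub>0 H\<^sub>1 \<beta>" using z ab by (intro subspace_diff subspace_piece) auto
    then have "b \<in> joint_span ?P" using ab by (simp add: piece_def type_space_def)
    then have "b = 0" using ab(3)
      by (intro joint_span_disjoint[of ?P "allowed - ?P"]) (auto simp: allowed_def PiE_def)
    moreover have "\<Phi> a = l \<cdot> a"
    proof -
      have "?A \<subseteq> {x. \<Phi> x = l \<cdot> x}"
      proof (rule span_minimal)
        show "subspace {x. \<Phi> x = l \<cdot> x}"
          by (rule subspaceI) (auto simp: aut.add aut.scale aut.zero scale_right_distrib mult.commute)
        show "{Y v q w |v q. v \<in> piece H\<^sub>0 H\<^sub>1 {}} \<subseteq> {x. \<Phi> x = l \<cdot> x}"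
          using triv w(3) by (auto simp: aut_product Y_right)
      qed
      then show ?thesis using ab by blast
    qed
    ultimately show ?thesis using ab by simp
  qed
  then show ?thesis by blast
qed

theorem aut_acts_by_character:
  "\<exists>\<xi>\<subseteq>{..<n}. \<forall>\<beta>\<subseteq>{..<n}. \<forall>z\<in>piece H\<^sub>0 H\<^sub>1 \<beta>. \<Phi> z = ((-1) ^ card (\<beta> \<inter> \<xi>)) \<cdot> z"
proof -
  obtain s where s: "\<And>\<beta> z. z \<in> piece H\<^sub>0 H\<^sub>1 \<beta> \<Longrightarrow> \<Phi> z = s \<beta> \<cdot> z"
    using aut_scalar_on_piece by metis
  \<comment> \<open>On zero components the scalar chosen in \<open>s\<close> is arbitrary, so only
    the nonzero ones enter; they are closed under products because products of nonzero vectors do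
    not all vanish.\<close>
  let ?C = "{\<beta>. \<beta> \<subseteq> {..<n} \<and> piece H\<^sub>0 H\<^sub>1 \<beta> \<noteq> {0}}"
  have mult: "sym_diff \<beta> \<gamma> \<in> ?C \<and> s (sym_diff \<beta> \<gamma>) = s \<beta> * s \<gamma>" if \<beta>: "\<beta> \<in> ?C" "\<gamma> \<in> ?C" for \<beta> \<gamma>
  proof -
    obtain u where u: "u \<in> piece H\<^sub>0 H\<^sub>1 \<beta>" "u \<noteq> 0" using \<beta> subspace_0[OF subspace_piece] by blast
    obtain v where v: "v \<in> piece H\<^sub>0 H\<^sub>1 \<gamma>" "v \<noteq> 0" using \<beta> subspace_0[OF subspace_piece] by blast
    obtain k where k: "Y u k v \<noteq> 0" using product_nonzero[OF u(2) v(2)] .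
    have uv: "Y u k v \<in> piece H\<^sub>0 H\<^sub>1 (sym_diff \<beta> \<gamma>)" using u v by (intro piece_product)
    have "s (sym_diff \<beta> \<gamma>) \<cdot> Y u k v = \<Phi> (Y u k v)" using s[OF uv] by simp
    also have "\<dots> = (s \<beta> * s \<gamma>) \<cdot> Y u k v" by (simp add: aut_product s[OF u(1)] s[OF v(1)] Y_left Y_right)
    finally show ?thesis using k uv \<beta> by auto
  qed
  have one: "s {} = 1" if 0: "{} \<in> ?C"
  proof -
    obtain x where x: "x \<in> piece H\<^sub>0 H\<^sub>1 {}" "x \<noteq> 0" using 0 subspace_0[OF subspace_piece] by blast
    then have "s {} \<cdot> x = 1 \<cdot> x" using s[OF x(1)] triv[OF x(1)] by simp
    then show ?thesis using x by (simp only: scale_cancel_right) simp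
  qed
  have "s \<beta> * s \<beta> = 1" if "\<beta> \<in> ?C" for \<beta>
    using mult[OF that that] one by simp
  then obtain \<xi> where \<xi>: "\<xi> \<subseteq> {..<n}" "\<forall>\<beta>\<in>?C. s \<beta> = (-1) ^ card (\<beta> \<inter> \<xi>)"
    using character_extension[of ?C n s] mult by blast
  have "\<Phi> z = ((-1) ^ card (\<beta> \<inter> \<xi>)) \<cdot> z" if "\<beta> \<subseteq> {..<n}" "z \<in> piece H\<^sub>0 H\<^sub>1 \<beta>" for \<beta> z
  proof (cases "z = 0")
    case True
    then show ?thesis by (simp add: aut.zero)
  next
    case False
    then have "\<beta> \<in> ?C" using that by blast
    then show ?thesis using s[OF that(2)] \<xi>(2) by simp
  qed
  then show ?thesis using \<xi>(1) by blast
qed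

end

end

context framed_aut
begin

text \<open>Complete reducibility, applied to one Ising vector after the other, reduces the claim to joint
  highest weight vectors of weight zero; these are translation invariant.\<close>

lemma aut_fixes_trivial_type:
  assumes vac: "\<Phi> \<Omega> = \<Omega>" and x: "x \<in> type_space (\<lambda>_. {0})"
  shows "\<Phi> x = x"
proof -
  let ?T = "type_space (\<lambda>_. {0})"
  have Ht: "\<forall>i<n. {0} \<subseteq> ising_weights" by (simp add: ising_weights_def)
  have T_eig: "?T = (\<Inter>i\<in>{..<n}. eig (es i) (weight_class 0))"
    using type_space_eq[of "\<lambda>_. {0}", OF Ht] by (simp add: weight_classes_def)
  let ?U = "\<lambda>m. {x\<in>?T. \<forall>i<m. hwv (es i) 0 x}"
  \<comment> \<open>The induction runs from \<open>n\<close> down to 0: \<open>?U m\<close> grows as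
    the highest weight condition is dropped one site at a time.\<close>
  have "\<forall>x\<in>?U m. \<Phi> x = x" if "m \<le> n" for m
    using that
  proof (induction rule: inc_induct)
    case base
    show ?case
    proof
      fix x assume x: "x \<in> ?U n"
      have "Y (es i) 0 x = 0" "Y (es i) 1 x = 0" if "i < n" for i
        using x that ising_VOA.hwv_null1[OF ising_es[OF that]] by (auto simp: hwv_def)
      then have "Y \<omega> 0 x = 0" "x \<in> grade V 0" by (simp_all add: conformal_sum grade_def)
      then obtain c where "x = c \<cdot> \<Omega>" by (rule translation_invariant_imp_scalar)
      then show "\<Phi> x = x" by (simp add: aut.scale vac)
    qed
  next
    case (step m)
    interpret m: ising_VOA V "es m" using step by (intro ising_es)
    have "subspace (?U m)"
      by (rule subspaceI) (auto simp: hwv_def Y_right subspace_0 subspace_add subspace_scale subspace_type_space)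
    moreover have "Y (es m) k y \<in> ?U m" if "y \<in> ?U m" for k y
    proof -
      have "Y (es m) k y \<in> ?T"
        using that type_space_stable[of "\<lambda>_. {0}", OF Ht] step by (auto simp: stable_def)
      moreover have "hwv (es i) 0 (Y (es m) k y)" if "i < m" for i
        using \<open>y \<in> ?U m\<close> that step es_commute[of i m] by (auto simp: hwv_def Y_right)
      ultimately show ?thesis by blast
    qed
    ultimately have U: "stable {es m} (?U m)" by (auto simp: stable_def)
    have fixed: "\<Phi> y = y" if y: "w \<in> ?U m" "h \<in> ising_weights" "hwv (es m) h w" "m.desc w k y" for w h k y
    proof -
      have "\<Phi> w = w"
      proof (cases "w = 0")
        case False
        have "w \<in> eig (es m) (weight_class 0)" using y(1) step unfolding T_eig by blast
        moreover have "w \<in> eig (es m) {h}" using y(3) by (intro eigI) (auto simp: hwv_def)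
        ultimately have "weight_class 0 \<inter> {h} \<noteq> {}" using eig_disjoint False by metis
        then have "h = 0" using ising_weight_in_class[of 0 h] y(2) by (auto simp: ising_weights_def)
        then have "w \<in> ?U (Suc m)" using y by (auto simp: less_Suc_eq)
        then show ?thesis using step.IH by blast
      qed (simp add: aut.zero)
      show ?thesis using y(4)
        by induction (use \<open>\<Phi> w = w\<close> step in \<open>auto simp: aut_mode\<close>)
    qed
    show ?case
    proof
      fix x assume "x \<in> ?U m"
      then have "x \<in> m.gen_hw (?U m)" by (rule m.complete_reducibility[OF U])
      also have "\<dots> \<subseteq> {x. \<Phi> x = x}"
        unfolding m.gen_hw_def
      proof (rule span_minimal)
        show "{x. \<exists>w\<in>?U m. \<exists>h\<in>ising_weights. hwv (es m) h w \<and> (\<exists>k. m.desc w k x)} \<subseteq> {x. \<Phi> x = x}"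
          using fixed by blast
        show "subspace {x. \<Phi> x = x}" by (rule subspaceI) (auto simp: aut.add aut.scale aut.zero)
      qed
      finally show "\<Phi> x = x" by blast
    qed
  qed
  from this[of 0] x show ?thesis by simp
qed

end

subsection \<open>Products of Miyamoto involutions\<close>

lemma (in VOA) eig_Un:
  assumes "x \<in> eig e (A \<union> B)"
  obtains a b where "x = a + b" "a \<in> eig e A" "b \<in> eig e B"
  using assms unfolding eig_def UN_Un span_Un by blast

context ising_VOA
begin

text \<open>The description in \<open>sigma\<close> is unique only on sums of the two isotypic
  components, where the decomposition is unique because the classes of 0 and 1/2 are
  disjoint.\<close>

lemma sigma_eq:
  assumes ab: "a \<in> eig e (weight_class 0)" "b \<in> eig e (weight_class (1/2))"
  shows "sigma V e (a + b) = a - b"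
proof -
  have w: "0 \<in> ising_weights" "1/2 \<in> ising_weights" by (auto simp: ising_weights_def)
  have disj: "weight_class 0 \<inter> weight_class (1/2) = {}" by (rule weight_class_disjoint[OF w]) simp
  show ?thesis
    unfolding sigma_def Vh_eq_eig[OF w(1)] Vh_eq_eig[OF w(2)]
  proof (rule the_equality)
    show "\<exists>a' b'. a' \<in> eig e (weight_class 0) \<and> b' \<in> eig e (weight_class (1/2)) \<and> a + b = a' + b' \<and> a - b = a' - b'"
      using ab by blast
    fix w assume "\<exists>a' b'. a' \<in> eig e (weight_class 0) \<and> b' \<in> eig e (weight_class (1/2)) \<and> a + b = a' + b' \<and> w = a' - b'"
    then obtain a' b' where w: "a' \<in> eig e (weight_class 0)" "b' \<in> eig e (weight_class (1/2))" "a + b = a' + b'" "w = a' - b'"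
      by blast
    have "a - a' \<in> eig e (weight_class 0)" using ab w by (intro subspace_diff subspace_eig)
    moreover have "b' - b \<in> eig e (weight_class (1/2))" using ab w by (intro subspace_diff subspace_eig)
    moreover have "a - a' = b' - b" using w(3) by (simp add: algebra_simps)
    ultimately have "a - a' = 0" using eig_disjoint[OF disj] by metis
    then show "w = a - b" using w by simp
  qed
qed

lemma tau_eq:
  assumes a: "a \<in> eig e (weight_classes {0, 1/2})" and d: "d \<in> eig e (weight_class (1/16))"
  shows "tau V e (a + d) = a - d"
proof -
  have w: "0 \<in> ising_weights" "1/2 \<in> ising_weights" "1/16 \<in> ising_weights" by (auto simp: ising_weights_def)
  have weight_classes: "weight_classes {0, 1/2} = weight_class 0 \<union> weight_class (1/2)" by (simp add: weight_classes_def)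
  have disj: "weight_classes {0, 1/2} \<inter> weight_class (1/16) = {}"
    using weight_classes_disjoint[of "{0, 1/2}" "{1/16}"] w by (simp add: weight_classes_def)
  have sub: "eig e (weight_class 0) \<subseteq> eig e (weight_classes {0, 1/2})" "eig e (weight_class (1/2)) \<subseteq> eig e (weight_classes {0, 1/2})"
    by (simp_all add: weight_classes eig_mono)
  show ?thesis
    unfolding tau_def Vh_eq_eig[OF w(1)] Vh_eq_eig[OF w(2)] Vh_eq_eig[OF w(3)]
  proof (rule the_equality)
    obtain b c where "a = b + c" "b \<in> eig e (weight_class 0)" "c \<in> eig e (weight_class (1/2))"
      using a unfolding weight_classes by (rule eig_Un)
    then show "\<exists>a' b' d'. a' \<in> eig e (weight_class 0) \<and> b' \<in> eig e (weight_class (1/2)) \<and> d' \<in> eig e (weight_class (1/16)) \<and>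
        a + d = a' + b' + d' \<and> a - d = a' + b' - d'"
      using d by (intro exI[of _ b] exI[of _ c] exI[of _ d]) simp
    fix w assume "\<exists>a' b' d'. a' \<in> eig e (weight_class 0) \<and> b' \<in> eig e (weight_class (1/2)) \<and> d' \<in> eig e (weight_class (1/16)) \<and>
        a + d = a' + b' + d' \<and> w = a' + b' - d'"
    then obtain a' b' d' where w: "a' \<in> eig e (weight_class 0)" "b' \<in> eig e (weight_class (1/2))"
      "d' \<in> eig e (weight_class (1/16))" "a + d = a' + b' + d'" "w = a' + b' - d'"
      by blast
    have "a' + b' \<in> eig e (weight_classes {0, 1/2})" using w sub by (intro subspace_add subspace_eig) blast+
    then have "a - (a' + b') \<in> eig e (weight_classes {0, 1/2})" using a by (intro subspace_diff subspace_eig)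
    moreover have "d' - d \<in> eig e (weight_class (1/16))" using d w by (intro subspace_diff subspace_eig)
    moreover have "a - (a' + b') = d' - d" using w(4) by (simp add: algebra_simps)
    ultimately have "a - (a' + b') = 0" using eig_disjoint[OF disj] by metis
    then show "w = a - d" using w by simp
  qed
qed

end

context framed_VOA
begin

definition pieces :: "complex set \<Rightarrow> complex set \<Rightarrow> 'v set" where
  "pieces H\<^sub>0 H\<^sub>1 = span (\<Union>\<beta>\<in>Pow {..<n}. piece H\<^sub>0 H\<^sub>1 \<beta>)"

lemma piece_subset_pieces: "\<beta> \<subseteq> {..<n} \<Longrightarrow> piece H\<^sub>0 H\<^sub>1 \<beta> \<subseteq> pieces H\<^sub>0 H\<^sub>1"
  unfolding pieces_def by (auto intro: span_base)

lemma piece_subset_eig: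
  assumes "i < n"
  shows "piece H\<^sub>0 H\<^sub>1 \<beta> \<subseteq> eig (es i) (weight_classes (if i \<in> \<beta> then H\<^sub>1 else H\<^sub>0))"
  unfolding piece_def type_space_def
proof (rule joint_span_subset_eig[OF assms])
  fix \<mu> assume "\<mu> \<in> PiE {..<n} (\<lambda>i. weight_classes (if i \<in> \<beta> then H\<^sub>1 else H\<^sub>0))"
  then show "\<mu> i \<in> weight_classes (if i \<in> \<beta> then H\<^sub>1 else H\<^sub>0)" by (rule PiE_mem) (simp add: assms)
qed

lemma pieces_subset_eig:
  assumes "i < n"
  shows "pieces H\<^sub>0 H\<^sub>1 \<subseteq> eig (es i) (weight_classes H\<^sub>0 \<union> weight_classes H\<^sub>1)"
proof -
  have "piece H\<^sub>0 H\<^sub>1 \<beta> \<subseteq> eig (es i) (weight_classes H\<^sub>0 \<union> weight_classes H\<^sub>1)" for \<beta>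
    using piece_subset_eig[OF assms, of H\<^sub>0 H\<^sub>1 \<beta>] eig_mono[of "weight_classes H\<^sub>0" "weight_classes H\<^sub>0 \<union> weight_classes H\<^sub>1" "es i"]
      eig_mono[of "weight_classes H\<^sub>1" "weight_classes H\<^sub>0 \<union> weight_classes H\<^sub>1" "es i"] by (cases "i \<in> \<beta>") auto
  then show ?thesis unfolding pieces_def by (intro span_minimal subspace_eig) blast
qed

lemma joint_eigenspace_subset_piece:
  assumes "\<mu> \<in> PiE {..<n} (\<lambda>_. weight_classes (H\<^sub>0 \<union> H\<^sub>1))"
  shows "joint_eigenspace \<mu> \<subseteq> piece H\<^sub>0 H\<^sub>1 {i. i < n \<and> \<mu> i \<in> weight_classes H\<^sub>1}"
  unfolding piece_def type_space_def
proof (intro joint_eigenspace_subset_span PiE_I)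
  fix i assume "i \<in> {..<n}"
  moreover from this have "\<mu> i \<in> weight_classes (H\<^sub>0 \<union> H\<^sub>1)" using assms by (rule PiE_mem[rotated])
  ultimately show "\<mu> i \<in> weight_classes (if i \<in> {i. i < n \<and> \<mu> i \<in> weight_classes H\<^sub>1} then H\<^sub>1 else H\<^sub>0)"
    by (auto simp: weight_classes_def)
next
  fix i assume "i \<notin> {..<n}"
  then show "\<mu> i = undefined" using assms by (rule PiE_arb[rotated])
qed

text \<open>Covers the products of \<sigma> and of \<tau> alike. Each \<open>t i\<close> is
  specified only on a sum of two eigenspans, so linearity and invariance have to be proved on
  \<open>pieces\<close> before composites can be compared with \<Phi> on a spanning set.\<close>

lemma involution_product:
  assumes t: "\<And>i a b. i < n \<Longrightarrow> a \<in> eig (es i) (weight_classes H\<^sub>0) \<Longrightarrow> b \<in> eig (es i) (weight_classes H\<^sub>1) \<Longrightarrow> t i (a + b) = a - b"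
    and lin: "Vector_Spaces.linear (smul V) (smul V) \<Phi>"
    and \<xi>: "\<xi> \<subseteq> {..<n}"
    and \<Phi>: "\<And>\<beta> z. \<beta> \<subseteq> {..<n} \<Longrightarrow> z \<in> piece H\<^sub>0 H\<^sub>1 \<beta> \<Longrightarrow> \<Phi> z = ((-1) ^ card (\<beta> \<inter> \<xi>)) \<cdot> z"
    and x: "x \<in> pieces H\<^sub>0 H\<^sub>1"
  shows "foldr (\<lambda>i f. t i \<circ> f) (sorted_list_of_set \<xi>) id x = \<Phi> x"
proof -
  let ?D = "pieces H\<^sub>0 H\<^sub>1"
  define F where "F is = foldr (\<lambda>i f. t i \<circ> f) is id" for "is"
  have F_simps: "F [] x = x" "F (i # is) x = t i (F is x)" for x i "is" by (simp_all add: F_def)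
  interpret \<Phi>: Vector_Spaces.linear "smul V" "smul V" \<Phi> by (rule lin)
  have D: "subspace ?D" by (simp add: pieces_def)
  have t_add: "t i (c \<cdot> x + y) = c \<cdot> t i x + t i y" if xy: "i < n" "x \<in> ?D" "y \<in> ?D" for i c x y
  proof -
    obtain a b where ab: "x = a + b" "a \<in> eig (es i) (weight_classes H\<^sub>0)" "b \<in> eig (es i) (weight_classes H\<^sub>1)"
      using eig_Un pieces_subset_eig[OF xy(1)] xy(2) by blast
    obtain a' b' where ab': "y = a' + b'" "a' \<in> eig (es i) (weight_classes H\<^sub>0)" "b' \<in> eig (es i) (weight_classes H\<^sub>1)"
      using eig_Un pieces_subset_eig[OF xy(1)] xy(3) by blast
    have "t i ((c \<cdot> a + a') + (c \<cdot> b + b')) = (c \<cdot> a + a') - (c \<cdot> b + b')"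
      by (rule t) (use xy ab ab' in \<open>auto intro!: subspace_add subspace_scale subspace_eig\<close>)
    moreover have "c \<cdot> x + y = (c \<cdot> a + a') + (c \<cdot> b + b')"
      by (simp add: ab ab' scale_right_distrib)
    moreover have "t i x = a - b" "t i y = a' - b'" using t xy ab ab' by auto
    ultimately show ?thesis by (simp add: scale_right_diff_distrib)
  qed
  have t_sign: "t i x = (if i \<in> \<beta> then - x else x)" if "i < n" "x \<in> piece H\<^sub>0 H\<^sub>1 \<beta>" for i \<beta> x
    using t[of i 0 x] t[of i x 0] that piece_subset_eig[of i H\<^sub>0 H\<^sub>1 \<beta>]
    by (auto simp: subspace_0 subspace_eig)
  note pD = piece_subset_pieces[of _ H\<^sub>0 H\<^sub>1]
  have t_D: "t i x \<in> ?D" if i: "i < n" and x: "x \<in> ?D" for i x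
  proof -
    have "x \<in> ?D \<and> t i x \<in> ?D"
      using x unfolding pieces_def[of H\<^sub>0 H\<^sub>1]
    proof (induction rule: span_induct_alt)
      case base
      have "t i 0 = 0" using t[of i 0 0] i by (simp add: subspace_0 subspace_eig)
      then show ?case by (simp add: span_zero)
    next
      case (step c x y)
      then obtain \<beta> where \<beta>: "\<beta> \<subseteq> {..<n}" "x \<in> piece H\<^sub>0 H\<^sub>1 \<beta>" by blast
      then have xD: "x \<in> ?D" using pD by blast
      have yD: "y \<in> ?D" "t i y \<in> ?D" using step by (simp_all add: pieces_def)
      have "t i x \<in> ?D" using t_sign[OF i \<beta>(2)] xD D by (auto intro: subspace_neg)
      then have "t i (c \<cdot> x + y) \<in> ?D"
        unfolding t_add[OF i xD yD(1)] using yD D by (intro subspace_add subspace_scale)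
      moreover have "c \<cdot> x + y \<in> ?D" using xD yD D by (intro subspace_add subspace_scale)
      ultimately show ?case by (simp add: pieces_def)
    qed
    then show ?thesis ..
  qed
  \<comment> \<open>Invariance, linearity and the sign are carried together: the next factor is
    linear only on \<open>?D\<close>, and its sign is read off only on vectors still inside the
    component.\<close>
  have F: "(\<forall>x\<in>?D. F is x \<in> ?D) \<and> (\<forall>c. \<forall>x\<in>?D. \<forall>y\<in>?D. F is (c \<cdot> x + y) = c \<cdot> F is x + F is y) \<and>
      (\<forall>\<beta>\<subseteq>{..<n}. \<forall>x\<in>piece H\<^sub>0 H\<^sub>1 \<beta>. F is x = ((-1) ^ card (\<beta> \<inter> set is)) \<cdot> x)"
    if "set is \<subseteq> {..<n}" "distinct is" for "is"
    using that
  proof (induction "is")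
    case Nil
    then show ?case by (simp add: F_simps)
  next
    case (Cons i "is")
    then have i: "i < n" "i \<notin> set is" and s: "set is \<subseteq> {..<n}" "distinct is" by auto
    have IH: "\<And>x. x \<in> ?D \<Longrightarrow> F is x \<in> ?D"
      "\<And>c x y. x \<in> ?D \<Longrightarrow> y \<in> ?D \<Longrightarrow> F is (c \<cdot> x + y) = c \<cdot> F is x + F is y"
      "\<And>\<beta> x. \<beta> \<subseteq> {..<n} \<Longrightarrow> x \<in> piece H\<^sub>0 H\<^sub>1 \<beta> \<Longrightarrow> F is x = ((-1) ^ card (\<beta> \<inter> set is)) \<cdot> x"
      using Cons.IH[OF s] by blast+
    have "F (i # is) x = ((-1) ^ card (\<beta> \<inter> set (i # is))) \<cdot> x"
      if x: "\<beta> \<subseteq> {..<n}" "x \<in> piece H\<^sub>0 H\<^sub>1 \<beta>" for \<beta> x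
    proof -
      have "F is x \<in> piece H\<^sub>0 H\<^sub>1 \<beta>" unfolding IH(3)[OF x] by (intro subspace_scale subspace_piece x)
      then have "F (i # is) x = (if i \<in> \<beta> then - F is x else F is x)"
        using t_sign[OF i(1)] by (simp add: F_simps)
      then show ?thesis using IH(3)[OF x] i(2) by (simp add: Int_insert_right)
    qed
    then show ?case using IH(1,2) t_D[OF i(1)] t_add[OF i(1)] by (simp add: F_simps)
  qed
  have fin: "finite \<xi>" using \<xi> finite_subset by blast
  have F\<xi>: "set (sorted_list_of_set \<xi>) \<subseteq> {..<n}" "distinct (sorted_list_of_set \<xi>)"
    using fin \<xi> by auto
  note F' = F[OF F\<xi>]
  have "x \<in> ?D \<and> F (sorted_list_of_set \<xi>) x = \<Phi> x"
    using x unfolding pieces_def[of H\<^sub>0 H\<^sub>1]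
  proof (induction rule: span_induct_alt)
    case base
    have "0 \<in> piece H\<^sub>0 H\<^sub>1 {}" by (rule subspace_0[OF subspace_piece])
    then have "F (sorted_list_of_set \<xi>) 0 = ((-1) ^ card ({} \<inter> set (sorted_list_of_set \<xi>))) \<cdot> 0"
      using F' by blast
    then show ?case by (simp add: \<Phi>.zero span_zero)
  next
    case (step c x y)
    then obtain \<beta> where \<beta>: "\<beta> \<subseteq> {..<n}" "x \<in> piece H\<^sub>0 H\<^sub>1 \<beta>" by blast
    then have xD: "x \<in> ?D" using pD by blast
    have yD: "y \<in> ?D" using step by (simp add: pieces_def)
    have "F (sorted_list_of_set \<xi>) x = ((-1) ^ card (\<beta> \<inter> set (sorted_list_of_set \<xi>))) \<cdot> x"
      using F' \<beta> by blast
    then have "F (sorted_list_of_set \<xi>) x = \<Phi> x" using \<Phi>[OF \<beta>] fin by simp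
    moreover have "F (sorted_list_of_set \<xi>) (c \<cdot> x + y)
        = c \<cdot> F (sorted_list_of_set \<xi>) x + F (sorted_list_of_set \<xi>) y"
      using F' xD yD by blast
    moreover have "c \<cdot> x + y \<in> ?D" using xD yD D by (intro subspace_add subspace_scale)
    ultimately show ?case using step by (simp add: pieces_def \<Phi>.add \<Phi>.scale)
  qed
  then show ?thesis by (simp add: F_def)
qed

text \<open>The highest weight vector of an irreducible summand lies in one component. That
  component is a module over the frame, so by irreducibility it contains the whole summand.\<close>

lemma V0_subset_pieces: "V0 V n es \<subseteq> pieces {0} {1/2}"
  unfolding V0_def vspan_def
proof (rule span_minimal)
  show "subspace (pieces {0} {1/2})" by (simp add: pieces_def)
  show "\<Union>{M. irr_submod V (frame V n es) M \<and>
       (\<exists>hs. (\<forall>i<n. hs i \<in> {0, 1/2}) \<and> hw_type V {..<n} es hs M)} \<subseteq> pieces {0} {1/2}"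
  proof (rule Union_least)
    fix M assume "M \<in> {M. irr_submod V (frame V n es) M \<and>
       (\<exists>hs. (\<forall>i<n. hs i \<in> {0, 1/2}) \<and> hw_type V {..<n} es hs M)}"
    then obtain hs w where M: "irr_submod V (frame V n es) M" and hs: "\<And>i. i < n \<Longrightarrow> hs i \<in> {0, 1/2}"
      and w: "w \<in> M" "w \<noteq> 0" "\<And>i. i < n \<Longrightarrow> Y (es i) 1 w = hs i \<cdot> w"
      unfolding hw_type_def by blast
    define \<mu> where "\<mu> = restrict hs {..<n}"
    define \<beta> where "\<beta> = {i. i < n \<and> \<mu> i \<in> weight_classes {1/2}}"
    have "0 \<in> weight_class 0" "1/2 \<in> weight_class (1/2)" using shift_in_weight_class[of 0 0] shift_in_weight_class[of "1/2" 0] by simp_all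
    then have "h \<in> weight_classes ({0} \<union> {1/2})" if "h \<in> {0, 1/2}" for h
      using that unfolding weight_classes_def by blast
    then have "\<mu> \<in> PiE {..<n} (\<lambda>_. weight_classes ({0} \<union> {1/2}))" using hs by (auto simp: \<mu>_def)
    then have "joint_eigenspace \<mu> \<subseteq> piece {0} {1/2} \<beta>" unfolding \<beta>_def by (rule joint_eigenspace_subset_piece)
    moreover have "w \<in> joint_eigenspace \<mu>" using w by (simp add: joint_eigenspace_def \<mu>_def)
    ultimately have wp: "w \<in> piece {0} {1/2} \<beta>" by blast
    have "stable (es ` {..<n}) (piece {0} {1/2} \<beta>)"
      unfolding piece_def by (rule type_space_stable) (simp add: ising_weights_def)
    moreover have "stable (es ` {..<n}) M"
      using M by (simp add: irr_submod_def frame_def stable_iff_submod)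
    ultimately have "stable (es ` {..<n}) (M \<inter> piece {0} {1/2} \<beta>)"
      unfolding stable_def by (auto intro: subspace_inter)
    then have "M \<inter> piece {0} {1/2} \<beta> = {0} \<or> M \<inter> piece {0} {1/2} \<beta> = M"
      using M unfolding irr_submod_def stable_iff_submod frame_def by blast
    then have "M \<subseteq> piece {0} {1/2} \<beta>" using w wp by blast
    also have "\<dots> \<subseteq> pieces {0} {1/2}"
      unfolding \<beta>_def by (rule piece_subset_pieces) blast
    finally show "M \<subseteq> pieces {0} {1/2}" .
  qed
qed

lemma pieces_tau: "pieces {0, 1/2} {1/16} = UNIV"
proof -
  have "ising_weights = {0, 1/2} \<union> {1/16}" by (auto simp: ising_weights_def)
  then have "joint_eigenspace \<mu> \<subseteq> pieces {0, 1/2} {1/16}" if "\<mu> \<in> allowed" for \<mu>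
  proof -
    have "joint_eigenspace \<mu> \<subseteq> piece {0, 1/2} {1/16} {i. i < n \<and> \<mu> i \<in> weight_classes {1/16}}"
      using that \<open>ising_weights = _\<close> unfolding allowed_def by (intro joint_eigenspace_subset_piece) simp
    also have "\<dots> \<subseteq> pieces {0, 1/2} {1/16}"
      by (rule piece_subset_pieces) blast
    finally show ?thesis .
  qed
  then have "joint_span allowed \<subseteq> pieces {0, 1/2} {1/16}" by (intro joint_span_minimal) (auto simp: pieces_def)
  then show ?thesis by (simp add: joint_span_allowed top.extremum_uniqueI)
qed

end

theorem theorem6p3:
  fixes V :: "('v::ab_group_add) voa" and n :: nat and es :: "nat \<Rightarrow> 'v" and \<theta> :: "'v \<Rightarrow> 'v"
  assumes "framed V n es"
    and "\<theta> \<in> stab_pt V (frame V n es)"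
  shows "\<exists>\<xi> \<eta>. \<xi> \<subseteq> {..<n} \<and> \<eta> \<subseteq> {..<n} \<and>
           (\<forall>v\<in>V0 V n es. \<theta> v = sigma_prod V es \<xi> v) \<and>
           \<theta> \<circ> \<theta> = tau_prod V es \<eta> \<and>
           \<theta> ^^ 4 = id"
proof -
  have simple: "simple_VOA V" using assms(1) unfolding framed_def by (elim conjE)
  then have voa: "is_VOA V" unfolding simple_VOA_def by (elim conjE)
  interpret framed_VOA V n es
    by (intro framed_VOA.intro simple_voa.intro VOA.intro simple_voa_axioms.intro framed_VOA_axioms.intro
        voa simple assms(1))
  have \<theta>: "Vector_Spaces.linear (smul V) (smul V) \<theta>" "\<theta> \<Omega> = \<Omega>"
    "\<And>u k v. \<theta> (Y u k v) = Y (\<theta> u) k (\<theta> v)" "\<And>x. x \<in> frame V n es \<Longrightarrow> \<theta> x = x"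
    using assms(2) by (auto simp: stab_pt_def voa_aut_def)
  have es: "\<theta> (es i) = es i" if "i < n" for i
    using gen_sub_props(3)[of "es ` {..<n}"] that by (intro \<theta>(4)) (auto simp: frame_def)
  interpret A: framed_aut V n es \<theta>
    by (intro framed_aut.intro framed_VOA_axioms framed_aut_axioms.intro \<theta> es)
  interpret B: framed_aut V n es "\<theta> \<circ> \<theta>"
    by unfold_locales (simp_all add: A.aut.add A.aut.scale \<theta>(3) es)
  have "\<theta> x = x" if "x \<in> piece {0} {1/2} {}" for x
    by (rule A.aut_fixes_trivial_type[OF \<theta>(2)]) (use that in \<open>simp add: piece_def\<close>)
  then have "\<exists>\<xi>\<subseteq>{..<n}. \<forall>\<beta>\<subseteq>{..<n}. \<forall>z\<in>piece {0} {1/2} \<beta>. \<theta> z = ((-1) ^ card (\<beta> \<inter> \<xi>)) \<cdot> z"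
    by (rule A.aut_acts_by_character[OF site_grading_sigma])
  then obtain \<xi> where "\<xi> \<subseteq> {..<n}"
    and "\<forall>\<beta>\<subseteq>{..<n}. \<forall>z\<in>piece {0} {1/2} \<beta>. \<theta> z = ((-1) ^ card (\<beta> \<inter> \<xi>)) \<cdot> z"
    by (elim exE conjE)
  then have \<xi>: "\<xi> \<subseteq> {..<n}"
    "\<And>\<beta> z. \<beta> \<subseteq> {..<n} \<Longrightarrow> z \<in> piece {0} {1/2} \<beta> \<Longrightarrow> \<theta> z = ((-1) ^ card (\<beta> \<inter> \<xi>)) \<cdot> z"
    by simp_all
  have sq: "(-1 :: complex) ^ m * (-1) ^ m = 1" for m
    by (simp flip: power_mult_distrib)
  have "(\<theta> \<circ> \<theta>) x = x" if "x \<in> piece {0, 1/2} {1/16} {}" for x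
  proof -
    have "piece {0, 1/2} {1/16} {} \<subseteq> {x. (\<theta> \<circ> \<theta>) x = x}"
      unfolding piece_def type_space_def
    proof (rule joint_span_minimal)
      show "subspace {x. (\<theta> \<circ> \<theta>) x = x}"
        by (rule subspaceI) (simp_all add: A.aut.add A.aut.scale A.aut.zero)
      \<comment> \<open>An eigenvalue function with all classes 0 or 1/2 belongs to one fine
        component, where \<theta> is a sign; so \<theta>^2 is the identity there.\<close>
      fix \<mu> assume "\<mu> \<in> PiE {..<n} (\<lambda>i. weight_classes (if i \<in> {} then {1/16} else {0, 1/2}))"
      then have "joint_eigenspace \<mu> \<subseteq> piece {0} {1/2} {i. i < n \<and> \<mu> i \<in> weight_classes {1/2}}"
        by (intro joint_eigenspace_subset_piece) (simp add: insert_is_Un[of 0 "{1/2}"])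
      then have "\<theta> x = ((-1) ^ card ({i. i < n \<and> \<mu> i \<in> weight_classes {1/2}} \<inter> \<xi>)) \<cdot> x" if "x \<in> joint_eigenspace \<mu>" for x
        using that by (intro \<xi>(2)) auto
      then show "joint_eigenspace \<mu> \<subseteq> {x. (\<theta> \<circ> \<theta>) x = x}" by (simp add: subset_eq A.aut.scale sq)
    qed
    then show ?thesis using that by blast
  qed
  then have "\<exists>\<eta>\<subseteq>{..<n}. \<forall>\<beta>\<subseteq>{..<n}. \<forall>z\<in>piece {0, 1/2} {1/16} \<beta>.
      (\<theta> \<circ> \<theta>) z = ((-1) ^ card (\<beta> \<inter> \<eta>)) \<cdot> z"
    by (rule B.aut_acts_by_character[OF site_grading_tau])
  then obtain \<eta> where "\<eta> \<subseteq> {..<n}"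
    and "\<forall>\<beta>\<subseteq>{..<n}. \<forall>z\<in>piece {0, 1/2} {1/16} \<beta>. (\<theta> \<circ> \<theta>) z = ((-1) ^ card (\<beta> \<inter> \<eta>)) \<cdot> z"
    by (elim exE conjE)
  then have \<eta>: "\<eta> \<subseteq> {..<n}"
    "\<And>\<beta> z. \<beta> \<subseteq> {..<n} \<Longrightarrow> z \<in> piece {0, 1/2} {1/16} \<beta> \<Longrightarrow> (\<theta> \<circ> \<theta>) z = ((-1) ^ card (\<beta> \<inter> \<eta>)) \<cdot> z"
    by simp_all
  have CL1: "weight_classes {h} = weight_class h" for h by (simp add: weight_classes_def)
  have "\<theta> v = sigma_prod V es \<xi> v" if "v \<in> V0 V n es" for v
    unfolding sigma_prod_def
    by (rule involution_product[OF _ \<theta>(1) \<xi>, symmetric])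
       (use that V0_subset_pieces ising_VOA.sigma_eq[OF ising_es] in \<open>auto simp: CL1\<close>)
  moreover have "\<theta> \<circ> \<theta> = tau_prod V es \<eta>"
  proof
    fix v
    show "(\<theta> \<circ> \<theta>) v = tau_prod V es \<eta> v"
      unfolding tau_prod_def
      by (rule involution_product[OF _ B.linear_aut \<eta>, symmetric])
         (use ising_VOA.tau_eq[OF ising_es] in \<open>auto simp: CL1 pieces_tau\<close>)
  qed
  moreover have "\<theta> ^^ 4 = id"
  proof
    fix v
    \<comment> \<open>On each coarse component \<theta>^2 is a sign, so \<theta>^4 is the identity
      there, and these components span V.\<close>
    have "pieces {0, 1/2} {1/16} \<subseteq> {x. \<theta> (\<theta> (\<theta> (\<theta> x))) = x}"
      unfolding pieces_def
    proof (rule span_minimal)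
      show "subspace {x. \<theta> (\<theta> (\<theta> (\<theta> x))) = x}"
        by (rule subspaceI) (simp_all add: A.aut.add A.aut.scale A.aut.zero)
      show "(\<Union>\<beta>\<in>Pow {..<n}. piece {0, 1/2} {1/16} \<beta>) \<subseteq> {x. \<theta> (\<theta> (\<theta> (\<theta> x))) = x}"
        using \<eta>(2) by (auto simp: A.aut.scale sq)
    qed
    then have "\<theta> (\<theta> (\<theta> (\<theta> v))) = v" using pieces_tau by blast
    then show "(\<theta> ^^ 4) v = id v" by (simp add: numeral_eq_Suc)
  qed
  ultimately show ?thesis using \<xi>(1) \<eta>(1) by blast
qed

end
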